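(* Let $k$ be a field, $R=k[x_1,\ldots,x_r]$ a standard graded polynomial ring, and $I$ a nonzero proper monomial ideal of $R$. Then both limits below exist and $$\lim_{n\to\infty}\frac{\omega(I^{(n)})}{n}=\lim_{n\to\infty}\frac{\operatorname{reg}(I^{(n)})}{n}=\delta(I).$$
   Context: For a homogeneous ideal $I$ of $R$, the $n$-th symbolic power is $I^{(n)}=\bigcap_{\mathfrak p\in \operatorname{Min}(I)} (I^nR_{\mathfrak p}\cap R)$, where $\operatorname{Min}(I)$ is the set of minimal primes of $I$. For a finitely generated graded module $M$, $\omega(M)$ denotes the maximal degree of a minimal homogeneous generator of $M$, and $\operatorname{reg}(M)$ the Castelnuovo–Mumford regularity over $R$. For a monomial ideal $Q$, its Newton polyhedron is $NP(Q)=\operatorname{conv}\{\boldsymbol\alpha\in\mathbb N^r : x^{\boldsymbol\alpha}\in Q\}\subset\mathbb R^r$. Let $I=Q_1\cap\cdots\cap Q_s\cap Q_{s+1}\cap\cdots\cap Q_t$ be a minimal primary decomposition of the monomial ideal $I$ into primary monomial ideals, where $Q_1,\ldots,Q_s$ are the components whose radicals are the minimal primes of $I$. Define the convex polyhedron $$\mathcal{SP}(I)=NP(Q_1)\cap\cdots\cap NP(Q_s)\subset\mathbb R^r .$$ For $\mathbf v=(v_1,\ldots,v_r)$ put $|\mathbf v|=v_1+\cdots+v_r$, and define $$\delta(I)=\max\{|\mathbf v| : \mathbf v \text{ is a vertex of } \mathcal{SP}(I)\}.$$ *)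

theory Defs
  imports
    "HOL-Analysis.Analysis"
    "HOL-Library.Poly_Mapping"
    "Jordan_Normal_Form.Matrix_Kernel"
begin

section \<open>Ideals of a commutative ring\<close>

definition is_ideal :: "'a::comm_ring_1 set \<Rightarrow> bool" where
  "is_ideal I \<longleftrightarrow> Modules.module.subspace (*) I"

definition ideal_gen :: "'a::comm_ring_1 set \<Rightarrow> 'a set" where
  "ideal_gen S = Modules.module.span (*) S"

text \<open>Only for use as the side condition of the facts of locale \<^locale>\<open>Modules.module\<close>; the locale is not
  interpreted globally because that would make its simp rule for \<open>a * (b * x)\<close> available for
  ordinary multiplication.\<close>

lemma module_mult: "Modules.module ((*) :: 'a::comm_ring_1 \<Rightarrow> 'a \<Rightarrow> 'a)"
  by unfold_locales (simp_all add: algebra_simps)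

primrec ideal_power :: "'a::comm_ring_1 set \<Rightarrow> nat \<Rightarrow> 'a set" where
  "ideal_power I 0 = UNIV"
| "ideal_power I (Suc n) = ideal_gen {a * b | a b. a \<in> I \<and> b \<in> ideal_power I n}"

definition prime_ideal :: "'a::comm_ring_1 set \<Rightarrow> bool" where
  "prime_ideal P \<longleftrightarrow> is_ideal P \<and> P \<noteq> UNIV \<and> (\<forall>a b. a * b \<in> P \<longrightarrow> a \<in> P \<or> b \<in> P)"

definition primary_ideal :: "'a::comm_ring_1 set \<Rightarrow> bool" where
  "primary_ideal Q \<longleftrightarrow>
     is_ideal Q \<and> Q \<noteq> UNIV \<and> (\<forall>a b. a * b \<in> Q \<longrightarrow> a \<in> Q \<or> (\<exists>n. b ^ n \<in> Q))"

definition radical :: "'a::comm_ring_1 set \<Rightarrow> 'a set" where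
  "radical I = {a. \<exists>n. a ^ n \<in> I}"

definition minimal_primes :: "'a::comm_ring_1 set \<Rightarrow> 'a set set" where
  "minimal_primes I =
     {P. prime_ideal P \<and> I \<subseteq> P \<and> (\<forall>P'. prime_ideal P' \<and> I \<subseteq> P' \<and> P' \<subseteq> P \<longrightarrow> P' = P)}"

text \<open>The contraction \<open>J R\<^sub>P \<inter> R\<close>, i.e. the preimage of \<open>J R\<^sub>P\<close> under \<open>R \<rightarrow> R\<^sub>P\<close>: the elements of
  \<open>J R\<^sub>P\<close> are the fractions \<open>a/s\<close> with \<open>a \<in> J\<close>, \<open>s \<notin> P\<close>, and \<open>f/1 = a/s\<close> holds in \<open>R\<^sub>P\<close> iff
  \<open>u (s f - a) = 0\<close> for some \<open>u \<notin> P\<close>.\<close>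

definition localization_contraction :: "'a::comm_ring_1 set \<Rightarrow> 'a set \<Rightarrow> 'a set" where
  "localization_contraction P J = {f. \<exists>a\<in>J. \<exists>s. s \<notin> P \<and> (\<exists>u. u \<notin> P \<and> u * (s * f - a) = 0)}"

definition symbolic_power :: "'a::comm_ring_1 set \<Rightarrow> nat \<Rightarrow> 'a set" where
  "symbolic_power I n = (\<Inter>P\<in>minimal_primes I. localization_contraction P (ideal_power I n))"


section \<open>The standard graded polynomial ring\<close>

text \<open>The variables are indexed by a finite type \<open>'x\<close>, so \<open>r = CARD('x)\<close>. The product of
  \<^type>\<open>poly_mapping\<close> is the convolution product, and \<open>Poly_Mapping.single \<alpha> 1\<close> is the
  monomial \<open>x\<^sup>\<alpha>\<close>.\<close>

type_synonym ('x, 'k) mpoly = "('x \<Rightarrow>\<^sub>0 nat) \<Rightarrow>\<^sub>0 'k"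

abbreviation monomial :: "('x \<Rightarrow>\<^sub>0 nat) \<Rightarrow> ('x, 'k::field) mpoly" where
  "monomial \<alpha> \<equiv> Poly_Mapping.single \<alpha> 1"

definition mdeg :: "('x::finite \<Rightarrow>\<^sub>0 nat) \<Rightarrow> nat" where
  "mdeg \<alpha> = (\<Sum>x\<in>UNIV. Poly_Mapping.lookup \<alpha> x)"

text \<open>The zero polynomial is homogeneous of every degree, and it is the only polynomial that is
  homogeneous of a negative degree.\<close>

definition homogeneous :: "int \<Rightarrow> ('x::finite, 'k::field) mpoly \<Rightarrow> bool" where
  "homogeneous d f \<longleftrightarrow> (\<forall>\<alpha>\<in>Poly_Mapping.keys f. int (mdeg \<alpha>) = d)"

definition variables_ideal :: "('x::finite, 'k::field) mpoly set" where
  "variables_ideal = ideal_gen {monomial (Poly_Mapping.single x 1) | x. True}"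

definition monomial_ideal :: "('x::finite, 'k::field) mpoly set \<Rightarrow> bool" where
  "monomial_ideal I \<longleftrightarrow> (\<exists>S. I = ideal_gen (monomial ` S))"


section \<open>Generator degrees and regularity of homogeneous ideals\<close>

definition minimal_homogeneous_generators ::
    "('x::finite, 'k::field) mpoly set \<Rightarrow> ('x, 'k) mpoly set \<Rightarrow> bool" where
  "minimal_homogeneous_generators J G \<longleftrightarrow>
     (\<forall>g\<in>G. \<exists>d. homogeneous d g) \<and> ideal_gen G = J \<and> (\<forall>G'. G' \<subset> G \<longrightarrow> ideal_gen G' \<noteq> J)"

text \<open>By irredundancy a minimal generator is nonzero, so its degree \<open>d\<close> is determined. By the graded
  Nakayama lemma the degrees that occur are the same for every choice of \<open>G\<close>.\<close>

definition omega :: "('x::finite, 'k::field) mpoly set \<Rightarrow> int" where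
  "omega J = Max {d. \<exists>G. minimal_homogeneous_generators J G \<and> (\<exists>g\<in>G. homogeneous d g)}"

text \<open>A minimal graded free resolution
  \<open>\<dots> \<rightarrow> F\<^sub>1 \<rightarrow> F\<^sub>0 \<rightarrow> J \<rightarrow> 0\<close> of a homogeneous ideal \<open>J\<close>. The list \<open>d i\<close> contains the degrees of
  the basis elements of \<open>F\<^sub>i\<close>, that is, \<open>F\<^sub>i\<close> is the direct sum of the \<open>R(-j)\<close> for \<open>j\<close> in
  \<open>d i\<close>. The matrix \<open>\<phi> (Suc i)\<close> describes \<open>F\<^bsub>i+1\<^esub> \<rightarrow> F\<^sub>i\<close>; the one-row matrix \<open>\<phi> 0\<close> describes
  the augmentation \<open>F\<^sub>0 \<rightarrow> J \<subseteq> R\<close>, to which the minimality condition (entries in the ideal generated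
  by the variables) does not apply. The degree conditions say that all maps are homogeneous of
  degree zero.\<close>

definition minimal_graded_free_resolution ::
    "('x::finite, 'k::field) mpoly set \<Rightarrow> (nat \<Rightarrow> int list) \<Rightarrow> (nat \<Rightarrow> ('x, 'k) mpoly mat) \<Rightarrow> bool"
  where
  "minimal_graded_free_resolution J d \<phi> \<longleftrightarrow>
     \<phi> 0 \<in> carrier_mat 1 (length (d 0)) \<and>
     (\<forall>m<length (d 0). homogeneous (d 0 ! m) (\<phi> 0 $$ (0, m))) \<and>
     (\<lambda>w. vec_index (\<phi> 0 *\<^sub>v w) 0) ` carrier_vec (length (d 0)) = J \<and>
     (\<forall>i. \<phi> (Suc i) \<in> carrier_mat (length (d i)) (length (d (Suc i))) \<and>
          (\<forall>l<length (d i). \<forall>m<length (d (Suc i)).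
             homogeneous (d (Suc i) ! m - d i ! l) (\<phi> (Suc i) $$ (l, m)) \<and>
             \<phi> (Suc i) $$ (l, m) \<in> variables_ideal) \<and>
          (\<lambda>w. \<phi> (Suc i) *\<^sub>v w) ` carrier_vec (length (d (Suc i))) = mat_kernel (\<phi> i))"

text \<open>The maximum of \<open>j - i\<close> over the nonzero graded Betti numbers \<open>\<beta>\<^bsub>i,j\<^esub>(J)\<close>. Minimal graded free
  resolutions are unique up to isomorphism, so the degrees in \<open>d i\<close> do not depend on the choice of
  the resolution.\<close>

definition regularity :: "('x::finite, 'k::field) mpoly set \<Rightarrow> int" where
  "regularity J =
     Max {j - int i | i j. \<exists>d \<phi>. minimal_graded_free_resolution J d \<phi> \<and> j \<in> set (d i)}"


section \<open>The symbolic polyhedron\<close>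

definition exponent_vector :: "('x::finite \<Rightarrow>\<^sub>0 nat) \<Rightarrow> real ^ 'x" where
  "exponent_vector \<alpha> = (\<chi> x. real (Poly_Mapping.lookup \<alpha> x))"

definition newton_polyhedron :: "('x::finite, 'k::field) mpoly set \<Rightarrow> (real ^ 'x) set" where
  "newton_polyhedron Q = convex hull (exponent_vector ` {\<alpha>. monomial \<alpha> \<in> Q})"

text \<open>Minimal means irredundant with pairwise distinct radicals.\<close>

definition minimal_monomial_primary_decomposition ::
    "('x::finite, 'k::field) mpoly set \<Rightarrow> ('x, 'k) mpoly set set \<Rightarrow> bool" where
  "minimal_monomial_primary_decomposition I \<Q> \<longleftrightarrow>
     finite \<Q> \<and> (\<forall>Q\<in>\<Q>. monomial_ideal Q \<and> primary_ideal Q) \<and> \<Inter>\<Q> = I \<and>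
     (\<forall>Q\<in>\<Q>. \<Inter>(\<Q> - {Q}) \<noteq> I) \<and> inj_on radical \<Q>"

text \<open>The components whose radicals are the minimal primes of \<open>I\<close> are the same in every minimal
  primary decomposition, so the choice below does not matter.\<close>

definition symbolic_polyhedron :: "('x::finite, 'k::field) mpoly set \<Rightarrow> (real ^ 'x) set" where
  "symbolic_polyhedron I =
     (let \<Q> = (SOME \<Q>. minimal_monomial_primary_decomposition I \<Q>)
      in \<Inter>Q\<in>{Q \<in> \<Q>. radical Q \<in> minimal_primes I}. newton_polyhedron Q)"

definition delta :: "('x::finite, 'k::field) mpoly set \<Rightarrow> real" where
  "delta I =
     Max {(\<Sum>x\<in>UNIV. vec_nth v x) | v. v extreme_point_of symbolic_polyhedron I}"

end

theory Submission
  imports Defs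
begin

text \<open>
  Write \<open>S\<^sub>n\<close> for the set of exponents of \<open>I\<^sup>(\<^sup>n\<^sup>)\<close>. If \<open>Q\<^sub>T\<close> is the component of \<open>I\<close> whose radical is the
  minimal prime generated by the variables in \<open>T\<close>, then \<open>\<alpha> \<in> Q\<^sub>T\<close> iff \<open>\<alpha> + \<gamma> \<in> I\<close> for some \<open>\<gamma>\<close> off \<open>T\<close>, and
  \<open>S\<^sub>n\<close> is the intersection of the \<open>n\<close>-fold sumsets of the exponents of the \<open>Q\<^sub>T\<close>.

  Every point of the symbolic polyhedron lies above a convex combination of vertices, so an
  \<open>\<alpha> \<in> S\<^sub>n\<close> with \<open>|\<alpha>| > \<delta> n + C\<close> has an entry \<open>j\<close> that can be lowered by a large constant without leaving
  \<open>S\<^sub>n\<close>. Then \<open>\<alpha>\<close> is not a minimal generator. Moreover, since \<open>Q\<^sub>T\<close> contains a power of \<open>x\<^sub>j\<close> or does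
  not involve \<open>x\<^sub>j\<close>, the complex \<open>{\<tau>. \<alpha> - \<tau> \<in> S\<^sub>n}\<close> is a cone with apex \<open>j\<close>, so that the Koszul homology of
  \<open>I\<^sup>(\<^sup>n\<^sup>)\<close> vanishes in multidegree \<open>\<alpha>\<close>. Hence all degrees in a minimal resolution are at most \<open>\<delta> n + C\<close>,
  and therefore \<open>\<omega>(I\<^sup>(\<^sup>n\<^sup>)) \<le> reg(I\<^sup>(\<^sup>n\<^sup>)) \<le> \<delta> n + C\<close>.

  Conversely, let \<open>v\<close> be a vertex with \<open>|v| = \<delta>\<close>. Some element of \<open>S\<^sub>n\<close> is within bounded distance of
  \<open>n v\<close>, and a minimal generator \<open>\<alpha>\<close> below it satisfies \<open>\<alpha>/n \<rightarrow> v\<close>, because \<open>v\<close> is the only point of the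
  polyhedron that is \<open>\<le> v\<close>.
\<close>

text \<open>The "large constant" has two sources. A point of a Newton polyhedron is a convex
  combination of at most \<open>CARD('x) + 1\<close> exponents (Caratheodory), so rounding its
  coefficients down loses at most that many factors, whatever \<open>n\<close> is; each lost factor
  is paid for by one \<open>p\<close>-th power of the removable variable. The cone property has to
  tolerate the loss of up to \<open>CARD('x)\<close> further variables, at the same price. One
  \<open>p\<close> serves all minimal primes; for primes not containing the variable, its powers
  simply cancel. Resolutions are graded by total degree with arbitrary bases, so the passage from
  Koszul homology to their degrees is an explicit chase through a double complex. Its entries are
  homogeneous only in total degree, hence the cone property is required of all exponents of that
  degree. Both \<open>omega\<close> and \<open>regularity\<close> are maxima of sets of integers.
  Two-sided bounds make these sets finite; explicit minimal generators and an explicit minimal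
  resolution make them nonempty and large.\<close>

abbreviation lookup :: "('a \<Rightarrow>\<^sub>0 'b::zero) \<Rightarrow> 'a \<Rightarrow> 'b" where "lookup \<equiv> Poly_Mapping.lookup"
abbreviation keys :: "('a \<Rightarrow>\<^sub>0 'b::zero) \<Rightarrow> 'a set" where "keys \<equiv> Poly_Mapping.keys"
abbreviation single :: "'a \<Rightarrow> 'b::zero \<Rightarrow> 'a \<Rightarrow>\<^sub>0 'b" where "single \<equiv> Poly_Mapping.single"

section \<open>Monomial ideals and their exponents\<close>

lemma is_ideal_iff:
  "is_ideal I \<longleftrightarrow> 0 \<in> I \<and> (\<forall>a\<in>I. \<forall>b\<in>I. a + b \<in> I) \<and> (\<forall>r. \<forall>a\<in>I. r * a \<in> I)"
  unfolding is_ideal_def Modules.module.subspace_def[OF module_mult] by blast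

lemma is_ideal_gen: "is_ideal (ideal_gen S)"
  unfolding is_ideal_def ideal_gen_def by (rule Modules.module.subspace_span[OF module_mult])

lemma ideal_gen_superset: "S \<subseteq> ideal_gen S"
  unfolding ideal_gen_def by (rule Modules.module.span_superset[OF module_mult])

lemma ideal_gen_least: "S \<subseteq> J \<Longrightarrow> is_ideal J \<Longrightarrow> ideal_gen S \<subseteq> J"
  unfolding is_ideal_def ideal_gen_def by (rule Modules.module.span_minimal[OF module_mult])

lemma ideal_gen_mono: "S \<subseteq> S' \<Longrightarrow> ideal_gen S \<subseteq> ideal_gen S'"
  by (meson ideal_gen_least ideal_gen_superset is_ideal_gen order_trans)

lemma is_ideal_sum: "is_ideal I \<Longrightarrow> (\<And>i. i \<in> A \<Longrightarrow> f i \<in> I) \<Longrightarrow> sum f A \<in> I"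
  by (induction A rule: infinite_finite_induct) (auto simp: is_ideal_iff)

lemma is_ideal_multI: "is_ideal I \<Longrightarrow> a \<in> I \<Longrightarrow> r * a \<in> I"
  by (simp add: is_ideal_iff)

lemma is_ideal_multI2: "is_ideal I \<Longrightarrow> a \<in> I \<Longrightarrow> a * r \<in> I"
  using is_ideal_multI[of I a r] by (simp add: mult.commute)

lemma is_ideal_diff: "is_ideal I \<Longrightarrow> a \<in> I \<Longrightarrow> b \<in> I \<Longrightarrow> a - b \<in> I" for a :: "'a::comm_ring_1"
  using is_ideal_multI[of I b "-1"] unfolding is_ideal_iff by (metis add_uminus_conv_diff mult_minus1)

section \<open>Divisibility of exponents, and monomial ideals as sets of exponents\<close>

definition exp_le :: "('x \<Rightarrow>\<^sub>0 nat) \<Rightarrow> ('x \<Rightarrow>\<^sub>0 nat) \<Rightarrow> bool" (infix "\<preceq>" 50) where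
  "\<alpha> \<preceq> \<beta> \<longleftrightarrow> (\<forall>x. lookup \<alpha> x \<le> lookup \<beta> x)"

lemma exp_le_refl [simp]: "\<alpha> \<preceq> \<alpha>" and exp_le_trans: "\<alpha> \<preceq> \<beta> \<Longrightarrow> \<beta> \<preceq> \<gamma> \<Longrightarrow> \<alpha> \<preceq> \<gamma>"
  by (auto simp: exp_le_def intro: order_trans)

lemma exp_le_add [simp]: "\<alpha> \<preceq> \<alpha> + \<gamma>" "\<alpha> \<preceq> \<gamma> + \<alpha>"
  by (simp_all add: exp_le_def lookup_add)

lemma exp_le_minus: "\<alpha> \<preceq> \<beta> \<Longrightarrow> (\<beta> - \<alpha>) + \<alpha> = \<beta>"
  by (intro poly_mapping_eqI) (simp add: exp_le_def lookup_add lookup_minus)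

lemma exp_le_iff: "\<alpha> \<preceq> \<beta> \<longleftrightarrow> (\<exists>\<gamma>. \<beta> = \<alpha> + \<gamma>)"
  by (metis exp_le_minus add.commute exp_le_add(1))

lemma mdeg_add: "mdeg (\<alpha> + \<beta>) = mdeg \<alpha> + mdeg \<beta>"
  by (simp add: mdeg_def lookup_add sum.distrib)

lemma mdeg_zero [simp]: "mdeg 0 = 0"
  by (simp add: mdeg_def)

lemma mdeg_single [simp]: "mdeg (single x n) = n"
  by (simp add: mdeg_def lookup_single when_def)

lemma mdeg_mono: "\<alpha> \<preceq> \<beta> \<Longrightarrow> mdeg \<alpha> \<le> mdeg \<beta>"
  unfolding exp_le_def mdeg_def by (simp add: sum_mono)

lemma mdeg_eq_0_iff: "mdeg \<alpha> = 0 \<longleftrightarrow> \<alpha> = 0"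
  by (auto simp: mdeg_def intro!: poly_mapping_eqI)

lemma exp_le_mdeg_eq: "\<alpha> \<preceq> \<beta> \<Longrightarrow> mdeg \<alpha> = mdeg \<beta> \<Longrightarrow> \<alpha> = \<beta>"
  by (metis add_cancel_left_right exp_le_iff mdeg_add mdeg_eq_0_iff)

definition exp_of :: "('x::finite \<Rightarrow> nat) \<Rightarrow> ('x \<Rightarrow>\<^sub>0 nat)" where
  "exp_of f = Abs_poly_mapping f"

lemma lookup_exp_of [simp]: "lookup (exp_of f) x = f x"
  by (simp add: exp_of_def)

definition up_closed :: "('x \<Rightarrow>\<^sub>0 nat) set \<Rightarrow> bool" where
  "up_closed E \<longleftrightarrow> (\<forall>\<alpha>\<in>E. \<forall>\<gamma>. \<alpha> + \<gamma> \<in> E)"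

lemma up_closed_le: "up_closed E \<Longrightarrow> \<alpha> \<in> E \<Longrightarrow> \<alpha> \<preceq> \<beta> \<Longrightarrow> \<beta> \<in> E"
  by (auto simp: up_closed_def exp_le_iff)

lemma up_closed_addI: "up_closed E \<Longrightarrow> \<alpha> \<in> E \<Longrightarrow> \<alpha> + \<gamma> \<in> E"
  by (simp add: up_closed_def)

text \<open>The linear span over the field of the monomials with exponents in \<open>E\<close>. For
  up-closed \<open>E\<close> these are exactly the monomial ideals
  (\<open>monomial_ideal_iff\<close>), and \<open>exponents\<close> recovers \<open>E\<close>; this
  dictionary turns the ideals below into combinatorial sets.\<close>

definition exp_span :: "('x \<Rightarrow>\<^sub>0 nat) set \<Rightarrow> ('x, 'k::field) mpoly set" where
  "exp_span E = {f. keys f \<subseteq> E}"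

definition exponents :: "('x, 'k::field) mpoly set \<Rightarrow> ('x \<Rightarrow>\<^sub>0 nat) set" where
  "exponents Q = {\<alpha>. monomial \<alpha> \<in> Q}"

lemma exponents_exp_span [simp]: "exponents (exp_span E) = E"
  by (simp add: exponents_def exp_span_def)

lemma is_ideal_exp_span: "up_closed E \<Longrightarrow> is_ideal (exp_span E)"
proof (unfold is_ideal_iff, intro conjI ballI allI)
  assume E: "up_closed E"
  fix r a :: "('a, 'b) mpoly" assume a: "a \<in> exp_span E"
  have "\<alpha> \<in> E" if "\<alpha> \<in> keys (r * a)" for \<alpha>
  proof -
    from that keys_mult[of r a] obtain \<beta> \<gamma> where "\<alpha> = \<beta> + \<gamma>" "\<gamma> \<in> keys a" by blast
    moreover from this a E have "\<gamma> + \<beta> \<in> E" by (auto simp: exp_span_def up_closed_def)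
    ultimately show ?thesis by (simp add: add.commute)
  qed
  then show "r * a \<in> exp_span E" by (auto simp: exp_span_def)
next
  fix a b :: "('a, 'b) mpoly" assume "a \<in> exp_span E" "b \<in> exp_span E"
  then show "a + b \<in> exp_span E" using Poly_Mapping.keys_add[of a b] by (auto simp: exp_span_def)
qed (auto simp: exp_span_def)

lemma poly_expand: "f = (\<Sum>\<alpha>\<in>keys f. single \<alpha> (lookup f \<alpha>))"
  by (rule poly_mapping_eqI) (auto simp: lookup_sum lookup_single when_def in_keys_iff)

lemma single_eq_mult: "single \<alpha> (c::'k::field) = single 0 c * monomial \<alpha>"
  by (simp add: mult_single)

lemma monomial_mult: "monomial \<alpha> * monomial \<beta> = (monomial (\<alpha> + \<beta>) :: ('x, 'k::field) mpoly)"
  by (simp add: mult_single)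

lemma is_ideal_keysI:
  fixes f :: "('x, 'k::field) mpoly"
  assumes "is_ideal I" "\<And>\<alpha>. \<alpha> \<in> keys f \<Longrightarrow> monomial \<alpha> \<in> I"
  shows "f \<in> I"
proof -
  have "(\<Sum>\<alpha>\<in>keys f. single \<alpha> (lookup f \<alpha>)) \<in> I"
  proof (rule is_ideal_sum[OF assms(1)])
    fix \<alpha> assume "\<alpha> \<in> keys f"
    then show "single \<alpha> (lookup f \<alpha>) \<in> I"
      using is_ideal_multI[OF assms(1) assms(2)] single_eq_mult by metis
  qed
  then show ?thesis using poly_expand[of f] by simp
qed

lemma up_closed_exponents: "is_ideal I \<Longrightarrow> up_closed (exponents I)"
  unfolding up_closed_def exponents_def using is_ideal_multI2 monomial_mult
  by (metis mem_Collect_eq)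

lemma ideal_gen_monomials:
  "ideal_gen (monomial ` S) = (exp_span {\<alpha>. \<exists>\<beta>\<in>S. \<beta> \<preceq> \<alpha>} :: ('x, 'k::field) mpoly set)"
proof
  have "\<exists>\<beta>\<in>S. \<beta> \<preceq> \<alpha> + \<gamma>" if "\<beta> \<in> S" "\<beta> \<preceq> \<alpha>" for \<alpha> \<beta> \<gamma>
    using that exp_le_trans[of \<beta> \<alpha> "\<alpha> + \<gamma>"] by auto
  then have "up_closed {\<alpha>. \<exists>\<beta>\<in>S. \<beta> \<preceq> \<alpha>}"
    unfolding up_closed_def by auto
  moreover have "monomial ` S \<subseteq> (exp_span {\<alpha>. \<exists>\<beta>\<in>S. \<beta> \<preceq> \<alpha>} :: ('x, 'k) mpoly set)"
    by (auto simp: exp_span_def intro: bexI[where P = "\<lambda>\<beta>. \<beta> \<preceq> _", OF exp_le_refl])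
  ultimately show "ideal_gen (monomial ` S) \<subseteq> (exp_span {\<alpha>. \<exists>\<beta>\<in>S. \<beta> \<preceq> \<alpha>} :: ('x, 'k) mpoly set)"
    by (intro ideal_gen_least is_ideal_exp_span)
next
  let ?I = "ideal_gen (monomial ` S) :: ('x, 'k) mpoly set"
  have "monomial \<alpha> \<in> ?I" if "\<beta> \<in> S" "\<beta> \<preceq> \<alpha>" for \<alpha> \<beta>
    using that up_closed_le[OF up_closed_exponents[OF is_ideal_gen], of \<beta> "monomial ` S" \<alpha>]
      ideal_gen_superset[of "monomial ` S"] by (auto simp: exponents_def)
  then have "f \<in> ?I" if "keys f \<subseteq> {\<alpha>. \<exists>\<beta>\<in>S. \<beta> \<preceq> \<alpha>}" for f
    using that by (intro is_ideal_keysI[OF is_ideal_gen, of f]) blast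
  then show "exp_span {\<alpha>. \<exists>\<beta>\<in>S. \<beta> \<preceq> \<alpha>} \<subseteq> ?I"
    unfolding exp_span_def by blast
qed

lemma monomial_ideal_iff: "monomial_ideal I \<longleftrightarrow> (\<exists>E. up_closed E \<and> I = exp_span E)"
proof
  assume "monomial_ideal I"
  then obtain S where S: "I = ideal_gen (monomial ` S)" by (auto simp: monomial_ideal_def)
  moreover have "up_closed {\<alpha>. \<exists>\<beta>\<in>S. \<beta> \<preceq> \<alpha>}"
    using up_closed_exponents[OF is_ideal_gen, of "monomial ` S"] unfolding ideal_gen_monomials by simp
  ultimately show "\<exists>E. up_closed E \<and> I = exp_span E"
    unfolding ideal_gen_monomials by blast
next
  assume "\<exists>E. up_closed E \<and> I = exp_span E"
  then obtain E where "up_closed E" "I = exp_span E" by blast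
  moreover from this have "{\<alpha>. \<exists>\<beta>\<in>E. \<beta> \<preceq> \<alpha>} \<subseteq> E"
    using up_closed_le[of E] by auto
  moreover have "E \<subseteq> {\<alpha>. \<exists>\<beta>\<in>E. \<beta> \<preceq> \<alpha>}" by (auto intro: bexI[where P = "\<lambda>\<beta>. \<beta> \<preceq> _", OF exp_le_refl])
  ultimately have "{\<alpha>. \<exists>\<beta>\<in>E. \<beta> \<preceq> \<alpha>} = E" by blast
  with \<open>I = exp_span E\<close> have "I = ideal_gen (monomial ` E)" by (simp only: ideal_gen_monomials)
  then show "monomial_ideal I" unfolding monomial_ideal_def by blast
qed

lemma monomial_ideal_exponents:
  assumes "monomial_ideal I" shows "I = exp_span (exponents I)" "up_closed (exponents I)"
  using assms unfolding monomial_ideal_iff by auto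

section \<open>Coefficients of products, and projections onto sets of monomials\<close>

lemma mult_expand:
  fixes f g :: "('x, 'k::field) mpoly"
  shows "f * g = (\<Sum>\<alpha>\<in>keys f. \<Sum>\<beta>\<in>keys g.
    single (\<alpha> + \<beta>) (lookup f \<alpha> * lookup g \<beta>))"
proof -
  have "f * g = (\<Sum>\<alpha>\<in>keys f. single \<alpha> (lookup f \<alpha>)) *
      (\<Sum>\<beta>\<in>keys g. single \<beta> (lookup g \<beta>))"
    by (rule arg_cong2[OF poly_expand poly_expand])
  then show ?thesis by (simp add: sum_product mult_single)
qed

text \<open>At an exponent that arises from only one pair of monomials nothing can cancel. Together
  with \<open>unique_sum\<close> this plays the role of a leading term.\<close>

lemma lookup_mult_unique:
  fixes f g :: "('x, 'k::field) mpoly"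
  assumes "\<And>\<alpha>' \<beta>'. \<alpha>' \<in> keys f \<Longrightarrow> \<beta>' \<in> keys g \<Longrightarrow> \<alpha>' + \<beta>' = \<alpha> + \<beta> \<Longrightarrow> \<alpha>' = \<alpha> \<and> \<beta>' = \<beta>"
  shows "lookup (f * g) (\<alpha> + \<beta>) = lookup f \<alpha> * lookup g \<beta>"
proof -
  have "lookup (f * g) (\<alpha> + \<beta>) =
    (\<Sum>\<alpha>'\<in>keys f. \<Sum>\<beta>'\<in>keys g. if \<alpha>' = \<alpha> then if \<beta>' = \<beta> then
       lookup f \<alpha> * lookup g \<beta> else 0 else 0)"
    unfolding mult_expand lookup_sum using assms
    by (intro sum.cong refl) (auto simp: lookup_single when_def)
  also have "\<dots> = (\<Sum>\<alpha>'\<in>keys f. if \<alpha>' = \<alpha> then (\<Sum>\<beta>'\<in>keys g. if \<beta>' = \<beta> then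
       lookup f \<alpha> * lookup g \<beta> else 0) else 0)"
    by (intro sum.cong) auto
  also have "\<dots> = lookup f \<alpha> * lookup g \<beta>"
    by (auto simp: in_keys_iff)
  finally show ?thesis .
qed

lemma lookup_single_mult:
  "lookup (single \<beta> c * f) (\<alpha> + \<beta>) = c * lookup (f :: ('x, 'k::field) mpoly) \<alpha>"
proof -
  have "lookup (single \<beta> c * f) (\<beta> + \<alpha>) = lookup (single \<beta> c) \<beta> * lookup f \<alpha>"
    by (rule lookup_mult_unique) (auto split: if_splits)
  then show ?thesis by (simp add: add.commute)
qed

lemma lookup_single_mult_eq_0:
  assumes "\<not> \<beta> \<preceq> \<gamma>"
  shows "lookup (single \<beta> c * f) \<gamma> = (0 :: 'k::field)"
proof -
  have "\<gamma> \<notin> keys (single \<beta> c * f)"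
    using keys_mult[of "single \<beta> c" f] assms by (auto split: if_splits)
  then show ?thesis by (simp add: in_keys_iff)
qed

text \<open>Projection onto the monomials selected by \<open>P\<close>. It is used to extract the
  part outside an exponent set, the part of low degree, and multihomogeneous components.\<close>

definition poly_filter :: "(('x \<Rightarrow>\<^sub>0 nat) \<Rightarrow> bool) \<Rightarrow> ('x, 'k::field) mpoly \<Rightarrow> ('x, 'k) mpoly" where
  "poly_filter P f = (\<Sum>\<alpha>\<in>{\<alpha> \<in> keys f. P \<alpha>}. single \<alpha> (lookup f \<alpha>))"

lemma lookup_poly_filter [simp]:
  "lookup (poly_filter P f) \<alpha> = (if P \<alpha> then lookup f \<alpha> else 0)"
  by (auto simp: poly_filter_def lookup_sum lookup_single when_def in_keys_iff)

lemma keys_poly_filter [simp]: "keys (poly_filter P f) = {\<alpha> \<in> keys f. P \<alpha>}"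
  by (auto simp: in_keys_iff split: if_splits)

lemma poly_filter_add: "poly_filter P (f + g) = poly_filter P f + poly_filter P g"
  by (rule poly_mapping_eqI) (simp add: lookup_add)

lemma poly_filter_zero [simp]: "poly_filter P 0 = 0"
  by (rule poly_mapping_eqI) simp

lemma poly_filter_sum: "poly_filter P (sum f A) = (\<Sum>i\<in>A. poly_filter P (f i))"
  by (induction A rule: infinite_finite_induct) (auto simp: poly_filter_add)

lemma poly_filter_id: "(\<And>\<alpha>. \<alpha> \<in> keys f \<Longrightarrow> P \<alpha>) \<Longrightarrow> poly_filter P f = f"
  by (rule poly_mapping_eqI) (auto simp: in_keys_iff)

lemma poly_filter_eq_0: "(\<And>\<alpha>. \<alpha> \<in> keys f \<Longrightarrow> \<not> P \<alpha>) \<Longrightarrow> poly_filter P f = 0"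
  by (rule poly_mapping_eqI) (auto simp: in_keys_iff)

text \<open>The assumption holds when \<open>g\<close> is homogeneous and \<open>P\<close>,
  \<open>Q\<close> select degrees: multiplication by \<open>g\<close> then only shifts degrees, so
  the projection can be moved to the factor \<open>f\<close>.\<close>

lemma poly_filter_mult:
  fixes f g :: "('x, 'k::field) mpoly"
  assumes "\<And>\<alpha> \<beta>. \<alpha> \<in> keys f \<Longrightarrow> \<beta> \<in> keys g \<Longrightarrow> P (\<alpha> + \<beta>) \<longleftrightarrow> Q \<alpha>"
  shows "poly_filter P (f * g) = poly_filter Q f * g"
proof -
  have *: "f = poly_filter Q f + poly_filter (\<lambda>\<alpha>. \<not> Q \<alpha>) f"
    by (rule poly_mapping_eqI) (simp add: lookup_add)
  have "poly_filter P (poly_filter Q f * g) = poly_filter Q f * g"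
    using assms keys_mult[of "poly_filter Q f" g] by (intro poly_filter_id) fastforce
  moreover have "poly_filter P (poly_filter (\<lambda>\<alpha>. \<not> Q \<alpha>) f * g) = 0"
    using assms keys_mult[of "poly_filter (\<lambda>\<alpha>. \<not> Q \<alpha>) f" g] by (intro poly_filter_eq_0) fastforce
  ultimately show ?thesis
    by (subst *) (simp add: distrib_right poly_filter_add)
qed

section \<open>Dickson's lemma\<close>

text \<open>Induction on the set of relevant variables. With \<open>F0\<close> a basis for
  \<open>V\<close>, an exponent whose \<open>y\<close>-entry is at least that of all elements of
  \<open>F0\<close> lies above one of them; the finitely many smaller values of the
  \<open>y\<close>-entry give slices, each with its own basis for \<open>V\<close>.\<close>

lemma dickson_aux:
  fixes E :: "('x \<Rightarrow>\<^sub>0 nat) set"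
  assumes "finite V"
  shows "\<exists>F\<subseteq>E. finite F \<and> (\<forall>\<alpha>\<in>E. \<exists>\<beta>\<in>F. \<forall>x\<in>V. lookup \<beta> x \<le> lookup \<alpha> x)"
  using assms
proof (induction V arbitrary: E)
  case empty
  show ?case
  proof (cases "E = {}")
    case False
    then obtain e where "e \<in> E" by blast
    then show ?thesis by (intro exI[of _ "{e}"]) auto
  qed auto
next
  case (insert y V)
  obtain F0 where F0: "F0 \<subseteq> E" "finite F0"
    "\<And>\<alpha>. \<alpha> \<in> E \<Longrightarrow> \<exists>\<beta>\<in>F0. \<forall>x\<in>V. lookup \<beta> x \<le> lookup \<alpha> x"
    using insert.IH[of E] by blast
  \<comment> \<open>Inserting 0 keeps the maximum meaningful when \<open>F0\<close> is
    empty.\<close>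
  define m where "m = Max (insert 0 ((\<lambda>\<beta>. lookup \<beta> y) ` F0))"
  have m: "lookup \<beta> y \<le> m" if "\<beta> \<in> F0" for \<beta>
    unfolding m_def using that F0(2) by (intro Max_ge) auto
  let ?E = "\<lambda>k. {\<alpha>\<in>E. lookup \<alpha> y = k}"
  have "\<forall>k. \<exists>F. F \<subseteq> ?E k \<and> finite F \<and>
     (\<forall>\<alpha>\<in>?E k. \<exists>\<beta>\<in>F. \<forall>x\<in>V. lookup \<beta> x \<le> lookup \<alpha> x)"
    by (intro allI insert.IH)
  from choice[OF this] obtain F where FF: "\<forall>k. F k \<subseteq> ?E k \<and> finite (F k) \<and>
     (\<forall>\<alpha>\<in>?E k. \<exists>\<beta>\<in>F k. \<forall>x\<in>V. lookup \<beta> x \<le> lookup \<alpha> x)" ..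
  have F: "F k \<subseteq> ?E k" "finite (F k)"
     "\<alpha> \<in> ?E k \<Longrightarrow> \<exists>\<beta>\<in>F k. \<forall>x\<in>V. lookup \<beta> x \<le> lookup \<alpha> x" for k \<alpha>
    using FF[rule_format, of k] by simp_all
  have "\<exists>\<beta>\<in>F0 \<union> (\<Union>k<m. F k). \<forall>x\<in>insert y V. lookup \<beta> x \<le> lookup \<alpha> x" if a: "\<alpha> \<in> E" for \<alpha>
  proof (cases "lookup \<alpha> y < m")
    case True
    obtain \<beta> where b: "\<beta> \<in> F (lookup \<alpha> y)" "\<forall>x\<in>V. lookup \<beta> x \<le> lookup \<alpha> x"
      using F(3)[of \<alpha> "lookup \<alpha> y"] a by auto
    then have "lookup \<beta> y = lookup \<alpha> y" using F(1)[of "lookup \<alpha> y"] by auto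
    then show ?thesis using b True by (intro bexI[of _ \<beta>]) auto
  next
    case False
    obtain \<beta> where b: "\<beta> \<in> F0" "\<forall>x\<in>V. lookup \<beta> x \<le> lookup \<alpha> x"
      using F0(3)[OF a] by blast
    then show ?thesis using m[OF b(1)] False by (intro bexI[of _ \<beta>]) auto
  qed
  moreover have "F0 \<union> (\<Union>k<m. F k) \<subseteq> E" using F0(1) F(1) by auto
  moreover have "finite (F0 \<union> (\<Union>k<m. F k))" using F0(2) F(2) by simp
  ultimately show ?case by metis
qed

lemma dickson:
  fixes E :: "('x::finite \<Rightarrow>\<^sub>0 nat) set"
  shows "\<exists>F\<subseteq>E. finite F \<and> (\<forall>\<alpha>\<in>E. \<exists>\<beta>\<in>F. \<beta> \<preceq> \<alpha>)"
  using dickson_aux[of "UNIV::'x set" E] unfolding exp_le_def by simp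

section \<open>Exponents with a unique decomposition as a sum\<close>

text \<open>Modelled on the faces of two Newton polytopes where a common linear functional is
  minimal: sums from \<open>A'\<close> and \<open>B'\<close> have no other decompositions over
  \<open>A\<close> and \<open>B\<close>.\<close>

definition sum_face :: "'a::plus set \<Rightarrow> 'a set \<Rightarrow> 'a set \<Rightarrow> 'a set \<Rightarrow> bool" where
  "sum_face A B A' B' \<longleftrightarrow> A' \<subseteq> A \<and> B' \<subseteq> B \<and> A' \<noteq> {} \<and> B' \<noteq> {} \<and>
    (\<forall>\<alpha>\<in>A'. \<forall>\<beta>\<in>B'. \<forall>\<alpha>'\<in>A. \<forall>\<beta>'\<in>B. \<alpha>' + \<beta>' = \<alpha> + \<beta> \<longrightarrow> \<alpha>' \<in> A' \<and> \<beta>' \<in> B')"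

lemma sum_faceI:
  assumes "A' \<subseteq> A" "B' \<subseteq> B" "A' \<noteq> {}" "B' \<noteq> {}"
    "\<And>\<alpha> \<beta> \<alpha>' \<beta>'. \<alpha> \<in> A' \<Longrightarrow> \<beta> \<in> B' \<Longrightarrow> \<alpha>' \<in> A \<Longrightarrow> \<beta>' \<in> B \<Longrightarrow> \<alpha>' + \<beta>' = \<alpha> + \<beta> \<Longrightarrow> \<alpha>' \<in> A' \<and> \<beta>' \<in> B'"
  shows "sum_face A B A' B'"
  unfolding sum_face_def by (intro conjI ballI impI assms(1-4)) (blast dest: assms(5))+

lemma sum_faceD:
  assumes "sum_face A B A' B'" "\<alpha> \<in> A'" "\<beta> \<in> B'" "\<alpha>' \<in> A" "\<beta>' \<in> B" "\<alpha>' + \<beta>' = \<alpha> + \<beta>"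
  shows "\<alpha>' \<in> A'" "\<beta>' \<in> B'"
  using assms unfolding sum_face_def by (metis, metis)

lemma sum_face_subset:
  assumes "sum_face A B A' B'" shows "A' \<subseteq> A" "B' \<subseteq> B" "A' \<noteq> {}" "B' \<noteq> {}"
  using assms unfolding sum_face_def by simp_all

lemma sum_face_trans:
  assumes 1: "sum_face A B A1 B1" and 2: "sum_face A1 B1 A2 B2"
  shows "sum_face A B A2 B2"
proof (rule sum_faceI)
  show "A2 \<subseteq> A" "B2 \<subseteq> B" "A2 \<noteq> {}" "B2 \<noteq> {}" 
    using sum_face_subset[OF 1] sum_face_subset[OF 2] by auto
next
  fix \<alpha> \<beta> \<alpha>' \<beta>' assume *: "\<alpha> \<in> A2" "\<beta> \<in> B2" "\<alpha>' \<in> A" "\<beta>' \<in> B" "\<alpha>' + \<beta>' = \<alpha> + \<beta>"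
  have "\<alpha> \<in> A1" "\<beta> \<in> B1" using sum_face_subset[OF 2] * by auto
  note sum_faceD[OF 1 this *(3-5)]
  from sum_faceD[OF 2 *(1,2) this *(5)] show "\<alpha>' \<in> A2 \<and> \<beta>' \<in> B2" by blast
qed

text \<open>A sum attains the minimum of \<open>l\<close> only if both summands do. That
  \<open>b\<close> is the minimum over \<open>B\<close> is kept in the conclusion so that
  \<open>unique_sum\<close> can identify it as 0.\<close>

lemma min_face:
  fixes A B :: "'a::plus set" and l :: "'a \<Rightarrow> nat"
  assumes l: "\<And>\<alpha> \<beta>. l (\<alpha> + \<beta>) = l \<alpha> + l \<beta>" and A: "A \<noteq> {}" and B: "B \<noteq> {}"
  shows "\<exists>a b. sum_face A B {\<alpha>\<in>A. l \<alpha> = a} {\<beta>\<in>B. l \<beta> = b} \<and> (\<forall>\<beta>\<in>B. b \<le> l \<beta>)"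
proof -
  define a where "a = (LEAST n. \<exists>\<alpha>\<in>A. l \<alpha> = n)"
  define b where "b = (LEAST n. \<exists>\<beta>\<in>B. l \<beta> = n)"
  have a: "\<exists>\<alpha>\<in>A. l \<alpha> = a" unfolding a_def using A by (intro LeastI_ex[of "\<lambda>n. \<exists>\<alpha>\<in>A. l \<alpha> = n"]) auto
  have a': "\<forall>\<alpha>\<in>A. a \<le> l \<alpha>" unfolding a_def by (auto intro: Least_le)
  have b: "\<exists>\<beta>\<in>B. l \<beta> = b" unfolding b_def using B by (intro LeastI_ex[of "\<lambda>n. \<exists>\<beta>\<in>B. l \<beta> = n"]) auto
  have b': "\<forall>\<beta>\<in>B. b \<le> l \<beta>" unfolding b_def by (auto intro: Least_le)
  have *: "l \<alpha>' = a \<and> l \<beta>' = b" if "l \<alpha> = a" "l \<beta> = b" "\<alpha>' \<in> A" "\<beta>' \<in> B" "\<alpha>' + \<beta>' = \<alpha> + \<beta>" for \<alpha> \<beta> \<alpha>' \<beta>'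
  proof -
    have "l \<alpha>' + l \<beta>' = a + b" using l[of \<alpha>' \<beta>'] l[of \<alpha> \<beta>] that by simp
    moreover have "a \<le> l \<alpha>'" "b \<le> l \<beta>'" using a' b' that by auto
    ultimately show ?thesis by linarith
  qed
  have "sum_face A B {\<alpha>\<in>A. l \<alpha> = a} {\<beta>\<in>B. l \<beta> = b}"
  proof (rule sum_faceI)
    fix \<alpha> \<beta> \<alpha>' \<beta>' assume "\<alpha> \<in> {\<alpha>\<in>A. l \<alpha> = a}" "\<beta> \<in> {\<beta>\<in>B. l \<beta> = b}" "\<alpha>' \<in> A" "\<beta>' \<in> B" "\<alpha>' + \<beta>' = \<alpha> + \<beta>"
    then show "\<alpha>' \<in> {\<alpha>\<in>A. l \<alpha> = a} \<and> \<beta>' \<in> {\<beta>\<in>B. l \<beta> = b}"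
      using *[of \<alpha> \<beta> \<alpha>' \<beta>'] by simp
  qed (use a b in auto)
  then show ?thesis using b' by blast
qed

text \<open>Minimising one variable after the other leaves a single pair.\<close>

lemma unique_sum_aux:
  fixes A B :: "('x \<Rightarrow>\<^sub>0 nat) set"
  assumes "finite V" "A \<noteq> {}" "B \<noteq> {}"
  shows "\<exists>A' B'. sum_face A B A' B' \<and>
    (\<forall>x\<in>V. \<exists>c. \<forall>\<alpha>\<in>A'. lookup \<alpha> x = c) \<and> (\<forall>x\<in>V. \<exists>c. \<forall>\<beta>\<in>B'. lookup \<beta> x = c)"
  using assms(1)
proof (induction V)
  case empty
  show ?case using assms by (intro exI[of _ A] exI[of _ B]) (simp add: sum_face_def)
next
  case (insert y V)
  from insert.IH obtain A1 B1 where 1: "sum_face A B A1 B1"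
    "\<forall>x\<in>V. \<exists>c. \<forall>\<alpha>\<in>A1. lookup \<alpha> x = c" "\<forall>x\<in>V. \<exists>c. \<forall>\<beta>\<in>B1. lookup \<beta> x = c"
    by (elim exE conjE)
  have ne: "A1 \<noteq> {}" "B1 \<noteq> {}" using sum_face_subset[OF 1(1)] by auto
  obtain a b where F: "sum_face A1 B1 {\<alpha>\<in>A1. lookup \<alpha> y = a} {\<beta>\<in>B1. lookup \<beta> y = b}"
    using min_face[of "\<lambda>\<alpha>. lookup \<alpha> y" A1 B1] ne by (auto simp: lookup_add)
  have "\<exists>c. \<forall>\<alpha>\<in>{\<alpha>\<in>A1. lookup \<alpha> y = a}. lookup \<alpha> x = c" if "x \<in> insert y V" for x
    using that 1(2) by (cases "x = y") auto
  moreover have "\<exists>c. \<forall>\<alpha>\<in>{\<alpha>\<in>B1. lookup \<alpha> y = b}. lookup \<alpha> x = c" if "x \<in> insert y V" for x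
    using that 1(3) by (cases "x = y") auto
  ultimately show ?case using sum_face_trans[OF 1(1) F] by blast
qed

text \<open>The degree in the variables of \<open>T\<close> is minimised before the single
  variables. As \<open>\<beta>0\<close> has degree 0 there, the surviving \<open>\<beta>\<close>
  avoids \<open>T\<close> too; minimising single variables at once could lose this.\<close>

lemma unique_sum:
  fixes A B :: "('x::finite \<Rightarrow>\<^sub>0 nat) set"
  assumes "A \<noteq> {}" "\<beta>0 \<in> B" "\<forall>x\<in>T. lookup \<beta>0 x = 0"
  obtains \<alpha> \<beta> where "\<alpha> \<in> A" "\<beta> \<in> B" "\<forall>x\<in>T. lookup \<beta> x = 0"
    "\<And>\<alpha>' \<beta>'. \<alpha>' \<in> A \<Longrightarrow> \<beta>' \<in> B \<Longrightarrow> \<alpha>' + \<beta>' = \<alpha> + \<beta> \<Longrightarrow> \<alpha>' = \<alpha> \<and> \<beta>' = \<beta>"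
proof -
  let ?l = "\<lambda>\<alpha>. \<Sum>x\<in>T. lookup \<alpha> x"
  have l: "?l (\<alpha> + \<beta>) = ?l \<alpha> + ?l \<beta>" for \<alpha> \<beta> :: "'x \<Rightarrow>\<^sub>0 nat"
    by (simp add: lookup_add sum.distrib)
  have "B \<noteq> {}" using assms by blast
  obtain a b where F: "sum_face A B {\<alpha>\<in>A. ?l \<alpha> = a} {\<beta>\<in>B. ?l \<beta> = b}" "\<forall>\<beta>\<in>B. b \<le> ?l \<beta>"
    using min_face[of ?l A B] l assms(1) \<open>B \<noteq> {}\<close> by auto
  have "?l \<beta>0 = 0" using assms(3) by simp
  then have "b = 0" using F(2) assms(2) by fastforce
  let ?A = "{\<alpha>\<in>A. ?l \<alpha> = a}" and ?B = "{\<beta>\<in>B. ?l \<beta> = b}"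
  have "?A \<noteq> {}" "?B \<noteq> {}" using sum_face_subset[OF F(1)] by auto
  from unique_sum_aux[OF finite_class.finite_UNIV this] obtain A' B' where *: "sum_face ?A ?B A' B'"
    "\<And>x. \<exists>c. \<forall>\<alpha>\<in>A'. lookup \<alpha> x = c" "\<And>x. \<exists>c. \<forall>\<beta>\<in>B'. lookup \<beta> x = c"
    by auto
  note face = sum_face_trans[OF F(1) *(1)]
  obtain \<alpha> \<beta> where ab: "\<alpha> \<in> A'" "\<beta> \<in> B'" using sum_face_subset[OF *(1)] by auto
  show thesis
  proof (rule that[of \<alpha> \<beta>])
    show "\<alpha> \<in> A" "\<beta> \<in> B" using ab sum_face_subset[OF face] by auto
    have "\<beta> \<in> ?B" using ab sum_face_subset[OF *(1)] by auto
    then show "\<forall>x\<in>T. lookup \<beta> x = 0" using \<open>b = 0\<close> by simp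
  next
    fix \<alpha>' \<beta>' assume "\<alpha>' \<in> A" "\<beta>' \<in> B" "\<alpha>' + \<beta>' = \<alpha> + \<beta>"
    then have "\<alpha>' \<in> A'" "\<beta>' \<in> B'" using sum_faceD[OF face ab] by blast+
    then show "\<alpha>' = \<alpha> \<and> \<beta>' = \<beta>" using *(2,3) ab by (metis poly_mapping_eqI)
  qed
qed

section \<open>Monomial primes, localization and symbolic powers\<close>

text \<open>Equivalently, the monomial lies outside the prime generated by the variables in
  \<open>T\<close>, so it becomes a unit in the localization.\<close>

definition avoids :: "'x set \<Rightarrow> ('x \<Rightarrow>\<^sub>0 nat) \<Rightarrow> bool" where
  "avoids T \<alpha> \<longleftrightarrow> (\<forall>x\<in>T. lookup \<alpha> x = 0)"

lemma avoids_zero [simp]: "avoids T 0"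
  by (simp add: avoids_def)

lemma avoids_add: "avoids T (\<alpha> + \<beta>) \<longleftrightarrow> avoids T \<alpha> \<and> avoids T \<beta>"
  by (auto simp: avoids_def lookup_add)

lemma avoids_sum: "(\<And>i. i \<in> A \<Longrightarrow> avoids T (f i)) \<Longrightarrow> avoids T (sum f A)"
  by (induction A rule: infinite_finite_induct) (auto simp: avoids_add)

text \<open>Monomials off \<open>T\<close> can be cancelled. For up-closed \<open>E\<close> this
  says that \<open>exp_span E\<close> is contracted from the localization at
  \<open>var_prime T\<close>.\<close>

definition saturated :: "'x set \<Rightarrow> ('x \<Rightarrow>\<^sub>0 nat) set \<Rightarrow> bool" where
  "saturated T E \<longleftrightarrow> (\<forall>\<alpha> \<beta>. avoids T \<beta> \<longrightarrow> \<alpha> + \<beta> \<in> E \<longrightarrow> \<alpha> \<in> E)"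

lemma saturatedD: "saturated T E \<Longrightarrow> avoids T \<beta> \<Longrightarrow> \<alpha> + \<beta> \<in> E \<Longrightarrow> \<alpha> \<in> E"
  by (auto simp: saturated_def)

text \<open>A polynomial \<open>t\<close> outside \<open>var_prime T\<close> is a nonzerodivisor
  modulo a saturated monomial ideal. After discarding the terms of \<open>f\<close> in
  \<open>E\<close>, \<open>unique_sum\<close> finds a term of the product that cannot cancel, and
  saturation puts its factor from \<open>f\<close> into \<open>E\<close>. Primality of
  \<open>var_prime T\<close>, the primary ideals and the contractions all rest on this.\<close>

lemma exp_span_cancel:
  fixes f t :: "('x::finite, 'k::field) mpoly"
  assumes E: "up_closed E" and sat: "saturated T E" and ft: "f * t \<in> exp_span E"
    and b0: "\<beta>0 \<in> keys t" "avoids T \<beta>0"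
  shows "f \<in> exp_span E"
proof (rule ccontr)
  assume f: "f \<notin> exp_span E"
  define f' where "f' = poly_filter (\<lambda>\<alpha>. \<alpha> \<notin> E) f"
  define f'' where "f'' = poly_filter (\<lambda>\<alpha>. \<alpha> \<in> E) f"
  have "f = f' + f''" by (rule poly_mapping_eqI) (simp add: f'_def f''_def lookup_add)
  then have "f' * t = f * t - f'' * t" by (simp add: algebra_simps)
  moreover have "f'' * t \<in> exp_span E"
    by (rule is_ideal_multI2[OF is_ideal_exp_span[OF E]]) (auto simp: f''_def exp_span_def)
  ultimately have f't: "f' * t \<in> exp_span E" using is_ideal_diff[OF is_ideal_exp_span[OF E] ft] by simp
  have "keys f' \<noteq> {}" using f by (auto simp: f'_def exp_span_def)
  then obtain \<alpha> \<beta> where ab: "\<alpha> \<in> keys f'" "\<beta> \<in> keys t" "avoids T \<beta>"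
    "\<And>\<alpha>' \<beta>'. \<alpha>' \<in> keys f' \<Longrightarrow> \<beta>' \<in> keys t \<Longrightarrow> \<alpha>' + \<beta>' = \<alpha> + \<beta> \<Longrightarrow> \<alpha>' = \<alpha> \<and> \<beta>' = \<beta>"
    using unique_sum[of "keys f'" \<beta>0 "keys t" T] b0 unfolding avoids_def by metis
  have "lookup (f' * t) (\<alpha> + \<beta>) = lookup f' \<alpha> * lookup t \<beta>"
    by (rule lookup_mult_unique) (rule ab(4))
  then have "\<alpha> + \<beta> \<in> keys (f' * t)" using ab(1,2) by (simp add: in_keys_iff)
  then have "\<alpha> + \<beta> \<in> E" using f't by (auto simp: exp_span_def)
  then have "\<alpha> \<in> E" using saturatedD[OF sat ab(3)] by blast
  then show False using ab(1) by (simp add: f'_def)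
qed

definition var_prime :: "'x set \<Rightarrow> ('x::finite, 'k::field) mpoly set" where
  "var_prime T = exp_span {\<alpha>. \<not> avoids T \<alpha>}"

lemma up_closed_not_avoids: "up_closed {\<alpha>. \<not> avoids T \<alpha>}"
  by (auto simp: up_closed_def avoids_add)

lemma saturated_not_avoids: "saturated T {\<alpha>. \<not> avoids T \<alpha>}"
  by (auto simp: saturated_def avoids_add)

lemma is_ideal_var_prime: "is_ideal (var_prime T)"
  unfolding var_prime_def by (rule is_ideal_exp_span[OF up_closed_not_avoids])

lemma not_in_var_prime: "f \<notin> var_prime T \<longleftrightarrow> (\<exists>\<beta>\<in>keys f. avoids T \<beta>)"
  by (auto simp: var_prime_def exp_span_def)

lemma monomial_in_var_prime: "monomial \<alpha> \<in> var_prime T \<longleftrightarrow> \<not> avoids T \<alpha>"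
  by (auto simp: var_prime_def exp_span_def)

lemma prime_ideal_var_prime: "prime_ideal (var_prime T :: ('x::finite, 'k::field) mpoly set)"
  unfolding prime_ideal_def
proof (intro conjI allI impI)
  show "var_prime T \<noteq> (UNIV :: ('x, 'k) mpoly set)"
    using monomial_in_var_prime[of 0 T] by auto
  fix a b :: "('x, 'k) mpoly" assume ab: "a * b \<in> var_prime T"
  show "a \<in> var_prime T \<or> b \<in> var_prime T"
  proof (rule disjCI)
    assume "b \<notin> var_prime T"
    then obtain \<beta> where "\<beta> \<in> keys b" "avoids T \<beta>" by (auto simp: not_in_var_prime)
    then show "a \<in> var_prime T"
      using exp_span_cancel[OF up_closed_not_avoids saturated_not_avoids] ab unfolding var_prime_def by blast
  qed
qed (rule is_ideal_var_prime)

lemma var_prime_subset_iff: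
  "(var_prime T :: ('x::finite, 'k::field) mpoly set) \<subseteq> var_prime T' \<longleftrightarrow> T \<subseteq> T'"
proof
  assume *: "(var_prime T :: ('x, 'k) mpoly set) \<subseteq> var_prime T'"
  show "T \<subseteq> T'"
  proof
    fix x assume "x \<in> T"
    then have "(monomial (single x 1) :: ('x, 'k) mpoly) \<in> var_prime T"
      unfolding monomial_in_var_prime avoids_def by (auto intro!: bexI[of _ x])
    then have "(monomial (single x 1) :: ('x, 'k) mpoly) \<in> var_prime T'" using * by blast
    then have "\<not> avoids T' (single x (1::nat))" by (rule monomial_in_var_prime[THEN iffD1])
    then show "x \<in> T'" by (auto simp: avoids_def lookup_single when_def split: if_splits)
  qed
next
  assume "T \<subseteq> T'"
  then have "{\<alpha>. \<not> avoids T \<alpha>} \<subseteq> {\<alpha>. \<not> avoids T' \<alpha>}" by (auto simp: avoids_def)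
  then show "(var_prime T :: ('x, 'k) mpoly set) \<subseteq> var_prime T'"
    unfolding var_prime_def exp_span_def by blast
qed

lemma var_prime_eq_iff: "(var_prime T :: ('x::finite, 'k::field) mpoly set) = var_prime T' \<longleftrightarrow> T = T'"
  using var_prime_subset_iff by (metis subset_antisym subset_refl)

lemma minus_single_add:
  assumes "lookup \<alpha> x \<noteq> (0::nat)"
  shows "\<alpha> - single x 1 + single x 1 = \<alpha>"
  using assms by (intro poly_mapping_eqI) (auto simp: lookup_add lookup_minus lookup_single when_def)

lemma exp_nonzero_ex: "\<alpha> \<noteq> 0 \<Longrightarrow> \<exists>x. lookup \<alpha> x \<noteq> (0::nat)"
  by (metis lookup_zero poly_mapping_eqI)

lemma prime_ideal_monomial:
  fixes P :: "('x::finite, 'k::field) mpoly set"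
  assumes P: "prime_ideal P"
  shows "monomial \<alpha> \<in> P \<Longrightarrow> \<exists>x. lookup \<alpha> x \<noteq> 0 \<and> monomial (single x 1) \<in> P"
proof (induction "mdeg \<alpha>" arbitrary: \<alpha> rule: less_induct)
  case less
  have id: "is_ideal P" "P \<noteq> UNIV" using P by (auto simp: prime_ideal_def)
  show ?case
  proof (cases "\<alpha> = 0")
    case True
    then have "1 \<in> P" using less.prems by simp
    then have "r \<in> P" for r using is_ideal_multI[OF id(1), of 1 r] by simp
    then show ?thesis using id(2) by auto
  next
    case False
    then obtain x where x: "lookup \<alpha> x \<noteq> 0" using exp_nonzero_ex by blast
    define \<beta> where "\<beta> = \<alpha> - single x 1"
    have eq: "\<alpha> = \<beta> + single x 1" using minus_single_add[OF x] by (simp add: \<beta>_def)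
    then have "monomial \<beta> * monomial (single x 1) \<in> P" using less.prems by (simp add: mult_single)
    then have "monomial \<beta> \<in> P \<or> monomial (single x 1) \<in> P" using P unfolding prime_ideal_def by blast
    then show ?thesis
    proof
      assume b: "monomial \<beta> \<in> P"
      have "mdeg \<beta> < mdeg \<alpha>" by (simp add: eq mdeg_add)
      from less.hyps[OF this b] show ?thesis by (auto simp: eq lookup_add)
    qed (use x in auto)
  qed
qed

section \<open>Minimal primes as minimal covers\<close>

text \<open>The sets of variables meeting the support of every exponent, as vertex covers of a
  hypergraph do. They correspond to the primes \<open>var_prime T\<close> that contain
  \<open>exp_span E\<close>.\<close>

definition covers :: "('x \<Rightarrow>\<^sub>0 nat) set \<Rightarrow> 'x set set" where
  "covers E = {T. \<forall>\<alpha>\<in>E. \<not> avoids T \<alpha>}"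

definition minimal_covers :: "('x \<Rightarrow>\<^sub>0 nat) set \<Rightarrow> 'x set set" where
  "minimal_covers E = {T \<in> covers E. \<forall>T'\<in>covers E. T' \<subseteq> T \<longrightarrow> T' = T}"

lemma exp_span_mono_iff: "(exp_span E :: ('x::finite, 'k::field) mpoly set) \<subseteq> exp_span E' \<longleftrightarrow> E \<subseteq> E'"
proof
  assume "(exp_span E :: ('x, 'k) mpoly set) \<subseteq> exp_span E'"
  then have "exponents (exp_span E :: ('x, 'k) mpoly set) \<subseteq> exponents (exp_span E' :: ('x, 'k) mpoly set)"
    by (auto simp: exponents_def)
  then show "E \<subseteq> E'" by simp
qed (auto simp: exp_span_def)

lemma exp_span_subset_var_prime:
  "(exp_span E :: ('x::finite, 'k::field) mpoly set) \<subseteq> var_prime T \<longleftrightarrow> T \<in> covers E"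
  unfolding var_prime_def exp_span_mono_iff covers_def by blast

text \<open>A prime containing a monomial contains one of the variables dividing it, so the
  variables lying in \<open>P\<close> form a cover.\<close>

lemma prime_contains_var_prime:
  fixes P :: "('x::finite, 'k::field) mpoly set"
  assumes "prime_ideal P" "exp_span E \<subseteq> P"
  obtains T where "T \<in> covers E" "var_prime T \<subseteq> P"
proof -
  define T where "T = {x. monomial (single x 1) \<in> P}"
  have id: "is_ideal P" using assms by (auto simp: prime_ideal_def)
  have "\<not> avoids T \<alpha>" if "\<alpha> \<in> E" for \<alpha>
  proof -
    have "monomial \<alpha> \<in> (exp_span E :: ('x, 'k) mpoly set)" using that by (simp add: exp_span_def)
    then have "monomial \<alpha> \<in> P" using assms(2) by blast
    from prime_ideal_monomial[OF assms(1) this] show ?thesis by (auto simp: T_def avoids_def)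
  qed
  then have "T \<in> covers E" by (auto simp: covers_def)
  moreover have "var_prime T \<subseteq> P"
  proof
    fix f :: "('x, 'k) mpoly" assume f: "f \<in> var_prime T"
    show "f \<in> P"
    proof (rule is_ideal_keysI[OF id])
      fix \<alpha> assume "\<alpha> \<in> keys f"
      then obtain x where x: "x \<in> T" "lookup \<alpha> x \<noteq> 0"
        using f by (auto simp: var_prime_def exp_span_def avoids_def)
      have "monomial (\<alpha> - single x 1) * monomial (single x 1) \<in> P"
        by (rule is_ideal_multI[OF id]) (use x in \<open>simp add: T_def\<close>)
      then show "monomial \<alpha> \<in> P" unfolding monomial_mult minus_single_add[OF x(2)] .
    qed
  qed
  ultimately show ?thesis using that by blast
qed

lemma minimal_primes_exp_span:
  "minimal_primes (exp_span E :: ('x::finite, 'k::field) mpoly set) = var_prime ` minimal_covers E"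
proof (intro equalityI subsetI)
  fix P :: "('x, 'k) mpoly set" assume P: "P \<in> minimal_primes (exp_span E)"
  then have Pp: "prime_ideal P" "exp_span E \<subseteq> P" by (auto simp: minimal_primes_def)
  have Pm: "P' = P" if "prime_ideal P'" "exp_span E \<subseteq> P'" "P' \<subseteq> P" for P'
    using P that by (simp add: minimal_primes_def)
  obtain T where T: "T \<in> covers E" "var_prime T \<subseteq> P" using prime_contains_var_prime[OF Pp] by blast
  then have eq: "var_prime T = P"
    by (intro Pm prime_ideal_var_prime) (simp_all add: exp_span_subset_var_prime)
  have "T' = T" if "T' \<in> covers E" "T' \<subseteq> T" for T'
  proof -
    have "(var_prime T' :: ('x, 'k) mpoly set) \<subseteq> var_prime T" using that by (simp add: var_prime_subset_iff)
    then have "var_prime T' = P" using that eq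
      by (intro Pm prime_ideal_var_prime) (simp_all add: exp_span_subset_var_prime)
    then show ?thesis using eq var_prime_eq_iff by metis
  qed
  then have "T \<in> minimal_covers E" using T by (auto simp: minimal_covers_def)
  then show "P \<in> var_prime ` minimal_covers E" using eq by blast
next
  fix P :: "('x, 'k) mpoly set" assume "P \<in> var_prime ` minimal_covers E"
  then obtain T where T: "T \<in> minimal_covers E" "P = var_prime T" by blast
  have "P' = P" if P': "prime_ideal P'" "exp_span E \<subseteq> P'" "P' \<subseteq> P" for P'
  proof -
    obtain T' where T': "T' \<in> covers E" "var_prime T' \<subseteq> P'" using prime_contains_var_prime[OF P'(1,2)] by blast
    then have "(var_prime T' :: ('x, 'k) mpoly set) \<subseteq> var_prime T" using P'(3) T(2) by blast
    then have "T' \<subseteq> T" by (simp add: var_prime_subset_iff)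
    then have "T' = T" using T(1) T'(1) by (auto simp: minimal_covers_def)
    then show ?thesis using T' P' T by blast
  qed
  moreover have "exp_span E \<subseteq> P" using T by (simp add: exp_span_subset_var_prime minimal_covers_def)
  ultimately show "P \<in> minimal_primes (exp_span E)"
    using prime_ideal_var_prime T(2) unfolding minimal_primes_def by blast
qed

lemma minimal_cover_exists:
  fixes E :: "('x::finite \<Rightarrow>\<^sub>0 nat) set"
  assumes "0 \<notin> E" shows "minimal_covers E \<noteq> {}"
proof -
  have "\<not> avoids UNIV \<alpha>" if "\<alpha> \<in> E" for \<alpha>
    using exp_nonzero_ex[of \<alpha>] that assms by (auto simp: avoids_def)
  then have "UNIV \<in> covers E" by (auto simp: covers_def)
  moreover have "finite (covers E)" by simp
  ultimately obtain T where "T \<in> covers E" "\<forall>T'\<in>covers E. T' \<subseteq> T \<longrightarrow> T' = T"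
    using finite_has_minimal[of "covers E"] by blast
  then show ?thesis by (auto simp: minimal_covers_def)
qed

section \<open>Localization at a monomial prime\<close>

text \<open>The exponents of the contraction of the localized ideal; \<open>\<gamma>\<close> is a
  monomial denominator. For a minimal cover \<open>T\<close> this will be the primary component over
  \<open>var_prime T\<close>.\<close>

definition exp_loc :: "'x set \<Rightarrow> ('x \<Rightarrow>\<^sub>0 nat) set \<Rightarrow> ('x \<Rightarrow>\<^sub>0 nat) set" where
  "exp_loc T E = {\<alpha>. \<exists>\<gamma>. avoids T \<gamma> \<and> \<alpha> + \<gamma> \<in> E}"

lemma exp_loc_superset: "E \<subseteq> exp_loc T E"
  by (auto simp: exp_loc_def intro!: exI[of _ 0])

lemma up_closed_exp_loc: "up_closed E \<Longrightarrow> up_closed (exp_loc T E)"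
  unfolding up_closed_def exp_loc_def
proof (intro ballI allI)
  fix \<alpha> \<delta> assume E: "\<forall>\<alpha>\<in>E. \<forall>\<gamma>. \<alpha> + \<gamma> \<in> E" and "\<alpha> \<in> {\<alpha>. \<exists>\<gamma>. avoids T \<gamma> \<and> \<alpha> + \<gamma> \<in> E}"
  then obtain \<gamma> where g: "avoids T \<gamma>" "\<alpha> + \<gamma> \<in> E" by blast
  then have "\<alpha> + \<delta> + \<gamma> \<in> E" using E[rule_format, OF g(2), of \<delta>] by (simp add: ac_simps)
  then show "\<alpha> + \<delta> \<in> {\<alpha>. \<exists>\<gamma>. avoids T \<gamma> \<and> \<alpha> + \<gamma> \<in> E}" using g(1) by blast
qed

lemma saturated_exp_loc: "saturated T (exp_loc T E)"
  unfolding saturated_def exp_loc_def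
proof (intro allI impI)
  fix \<alpha> \<beta> assume b: "avoids T \<beta>" and "\<alpha> + \<beta> \<in> {\<alpha>. \<exists>\<gamma>. avoids T \<gamma> \<and> \<alpha> + \<gamma> \<in> E}"
  then obtain \<gamma> where "avoids T \<gamma>" "\<alpha> + \<beta> + \<gamma> \<in> E" by blast
  then have "avoids T (\<beta> + \<gamma>) \<and> \<alpha> + (\<beta> + \<gamma>) \<in> E" using b by (simp add: avoids_add ac_simps)
  then show "\<alpha> \<in> {\<alpha>. \<exists>\<gamma>. avoids T \<gamma> \<and> \<alpha> + \<gamma> \<in> E}" by blast
qed

text \<open>Arbitrary denominators outside the prime are cancelled by
  \<open>exp_span_cancel\<close>. Conversely, the product of monomial denominators for the finitely
  many terms of \<open>f\<close> is a common denominator.\<close>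

lemma localization_contraction_exp_span:
  fixes E :: "('x::finite \<Rightarrow>\<^sub>0 nat) set"
  assumes E: "up_closed E"
  shows "localization_contraction (var_prime T) (exp_span E) = (exp_span (exp_loc T E) :: ('x, 'k::field) mpoly set)"
proof (intro equalityI subsetI)
  fix f :: "('x, 'k) mpoly" assume "f \<in> localization_contraction (var_prime T) (exp_span E)"
  then obtain a s u where a: "a \<in> exp_span E" "s \<notin> var_prime T" "u \<notin> var_prime T" "u * (s * f - a) = 0"
    by (auto simp: localization_contraction_def)
  have us: "u * s \<notin> var_prime T" using a(2,3) prime_ideal_var_prime unfolding prime_ideal_def by blast
  then obtain \<beta> where b: "\<beta> \<in> keys (u * s)" "avoids T \<beta>" by (auto simp: not_in_var_prime)
  have "f * (u * s) = u * a" using a(4) by (simp add: algebra_simps)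
  moreover have "u * a \<in> exp_span E" using is_ideal_multI[OF is_ideal_exp_span[OF E] a(1)] .
  ultimately have "f * (u * s) \<in> exp_span (exp_loc T E)"
    using exp_loc_superset[of E T] by (auto simp: exp_span_def)
  then show "f \<in> exp_span (exp_loc T E)"
    by (rule exp_span_cancel[OF up_closed_exp_loc[OF E] saturated_exp_loc _ b])
next
  fix f :: "('x, 'k) mpoly" assume f: "f \<in> exp_span (exp_loc T E)"
  then have "\<forall>\<alpha>\<in>keys f. \<exists>\<gamma>. avoids T \<gamma> \<and> \<alpha> + \<gamma> \<in> E" by (auto simp: exp_span_def exp_loc_def)
  then obtain c where c: "\<And>\<alpha>. \<alpha> \<in> keys f \<Longrightarrow> avoids T (c \<alpha>) \<and> \<alpha> + c \<alpha> \<in> E" by metis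
  define \<gamma> where "\<gamma> = (\<Sum>\<alpha>\<in>keys f. c \<alpha>)"
  have g: "avoids T \<gamma>" unfolding \<gamma>_def using c by (intro avoids_sum) blast
  have fE: "\<alpha> + \<gamma> \<in> E" if "\<alpha> \<in> keys f" for \<alpha>
  proof -
    have "\<gamma> = c \<alpha> + (\<Sum>\<alpha>\<in>keys f - {\<alpha>}. c \<alpha>)"
      unfolding \<gamma>_def using that by (simp add: sum.remove)
    then show ?thesis using up_closed_addI[OF E, of "\<alpha> + c \<alpha>"] c[OF that] by (simp add: add.assoc)
  qed
  have "monomial \<gamma> * f \<in> exp_span E"
    unfolding exp_span_def using keys_mult[of "monomial \<gamma>" f] fE
    by (auto simp: add.commute)
  moreover have "monomial \<gamma> \<notin> (var_prime T :: ('x, 'k) mpoly set)" using g by (simp add: monomial_in_var_prime)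
  moreover have "(1 :: ('x, 'k) mpoly) \<notin> var_prime T" using monomial_in_var_prime[of 0 T] by simp
  ultimately show "f \<in> localization_contraction (var_prime T) (exp_span E)"
    unfolding localization_contraction_def
    by (intro CollectI bexI[of _ "monomial \<gamma> * f"] exI[of _ "monomial \<gamma>"] conjI exI[of _ 1]) simp_all
qed

section \<open>Powers of exponent sets and symbolic powers\<close>

text \<open>The base case matches \<open>ideal_power I 0\<close>, the whole ring. The innermost
  summand is thus arbitrary, which makes every \<open>exp_power E n\<close> up-closed.\<close>

primrec exp_power :: "('x \<Rightarrow>\<^sub>0 nat) set \<Rightarrow> nat \<Rightarrow> ('x \<Rightarrow>\<^sub>0 nat) set" where
  "exp_power E 0 = UNIV"
| "exp_power E (Suc n) = {\<alpha> + \<beta> | \<alpha> \<beta>. \<alpha> \<in> E \<and> \<beta> \<in> exp_power E n}"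

lemma exp_power_SucI: "\<alpha> \<in> E \<Longrightarrow> \<beta> \<in> exp_power E n \<Longrightarrow> \<alpha> + \<beta> \<in> exp_power E (Suc n)"
  by auto

lemma up_closed_exp_power: "up_closed (exp_power E n)"
proof (induction n)
  case (Suc n)
  show ?case unfolding up_closed_def
  proof (intro ballI allI)
    fix \<alpha> \<gamma> assume "\<alpha> \<in> exp_power E (Suc n)"
    then obtain \<alpha>1 \<beta> where "\<alpha> = \<alpha>1 + \<beta>" "\<alpha>1 \<in> E" "\<beta> \<in> exp_power E n" by auto
    then show "\<alpha> + \<gamma> \<in> exp_power E (Suc n)"
      using exp_power_SucI[of \<alpha>1 E "\<beta> + \<gamma>" n] up_closed_addI[OF Suc] by (simp add: add.assoc)
  qed
qed (simp add: up_closed_def)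

lemma ideal_power_exp_span:
  assumes "up_closed E"
  shows "ideal_power (exp_span E) n = (exp_span (exp_power E n) :: ('x::finite, 'k::field) mpoly set)"
proof (induction n)
  case 0 show ?case by (auto simp: exp_span_def)
next
  case (Suc n)
  let ?G = "{a * b |a b. a \<in> exp_span E \<and> b \<in> (exp_span (exp_power E n) :: ('x, 'k) mpoly set)}"
  have "ideal_gen ?G = exp_span (exp_power E (Suc n))"
  proof
    have "a * b \<in> exp_span (exp_power E (Suc n))" if ab: "a \<in> exp_span E" "b \<in> exp_span (exp_power E n)" for a b :: "('x, 'k) mpoly"
      unfolding exp_span_def
    proof (intro CollectI subsetI)
      fix \<gamma> assume "\<gamma> \<in> keys (a * b)"
      then obtain \<alpha> \<beta> where "\<gamma> = \<alpha> + \<beta>" "\<alpha> \<in> keys a" "\<beta> \<in> keys b"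
        using keys_mult[of a b] by blast
      then show "\<gamma> \<in> exp_power E (Suc n)" using ab exp_power_SucI[of \<alpha> E \<beta> n] by (auto simp: exp_span_def)
    qed
    then show "ideal_gen ?G \<subseteq> exp_span (exp_power E (Suc n))"
      by (intro ideal_gen_least is_ideal_exp_span up_closed_exp_power) blast
  next
    show "exp_span (exp_power E (Suc n)) \<subseteq> ideal_gen ?G"
    proof
      fix f :: "('x, 'k) mpoly" assume f: "f \<in> exp_span (exp_power E (Suc n))"
      show "f \<in> ideal_gen ?G"
      proof (rule is_ideal_keysI[OF is_ideal_gen])
        fix \<gamma> assume "\<gamma> \<in> keys f"
        then obtain \<alpha> \<beta> where g: "\<gamma> = \<alpha> + \<beta>" "\<alpha> \<in> E" "\<beta> \<in> exp_power E n" using f by (auto simp: exp_span_def)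
        have "monomial \<alpha> * monomial \<beta> \<in> ?G"
          by (intro CollectI exI[of _ "monomial \<alpha>"] exI[of _ "monomial \<beta>"] conjI refl) (use g in \<open>simp_all add: exp_span_def\<close>)
        then show "monomial \<gamma> \<in> ideal_gen ?G" using ideal_gen_superset[of ?G] unfolding g(1) monomial_mult by blast
      qed
    qed
  qed
  then show ?case using Suc by simp
qed

lemma exp_power_mono: "E \<subseteq> E' \<Longrightarrow> exp_power E n \<subseteq> exp_power E' n"
proof (induction n)
  case (Suc n)
  then show ?case by (auto 4 3)
qed simp

text \<open>Riesz decomposition: \<open>\<gamma>\<close> is taken out of \<open>a\<close> as far as
  possible, and what remains of it is at most \<open>b\<close>.\<close>

lemma exp_riesz:
  fixes \<alpha> \<gamma> a b :: "'x::finite \<Rightarrow>\<^sub>0 nat"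
  assumes eq: "\<alpha> + \<gamma> = a + b"
  obtains a' b' \<gamma>1 \<gamma>2 where "a = a' + \<gamma>1" "b = b' + \<gamma>2" "\<gamma> = \<gamma>1 + \<gamma>2" "\<alpha> = a' + b'"
proof -
  define \<gamma>1 where "\<gamma>1 = exp_of (\<lambda>x. min (lookup a x) (lookup \<gamma> x))"
  have le: "lookup \<alpha> x + lookup \<gamma> x = lookup a x + lookup b x" for x
    using eq by (metis lookup_add)
  show thesis
  proof (rule that[of "a - \<gamma>1" \<gamma>1 "b - (\<gamma> - \<gamma>1)" "\<gamma> - \<gamma>1"]; rule poly_mapping_eqI)
    fix x
    show "lookup a x = lookup (a - \<gamma>1 + \<gamma>1) x"
      by (simp add: lookup_add lookup_minus \<gamma>1_def)
    show "lookup b x = lookup (b - (\<gamma> - \<gamma>1) + (\<gamma> - \<gamma>1)) x"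
      using le[of x] by (simp add: lookup_add lookup_minus \<gamma>1_def)
    show "lookup \<gamma> x = lookup (\<gamma>1 + (\<gamma> - \<gamma>1)) x"
      by (simp add: lookup_add lookup_minus \<gamma>1_def)
    show "lookup \<alpha> x = lookup (a - \<gamma>1 + (b - (\<gamma> - \<gamma>1))) x"
      using le[of x] by (simp add: lookup_add lookup_minus \<gamma>1_def min_def split: if_splits)
  qed
qed

lemma saturated_exp_power:
  fixes E :: "('x::finite \<Rightarrow>\<^sub>0 nat) set"
  assumes "saturated T E" shows "saturated T (exp_power E n)"
proof (induction n)
  case (Suc n)
  show ?case unfolding saturated_def
  proof (intro allI impI)
    fix \<alpha> \<gamma> assume g: "avoids T \<gamma>" and "\<alpha> + \<gamma> \<in> exp_power E (Suc n)"
    then obtain a b where ab: "\<alpha> + \<gamma> = a + b" "a \<in> E" "b \<in> exp_power E n" by auto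
    obtain a' b' \<gamma>1 \<gamma>2 where r: "a = a' + \<gamma>1" "b = b' + \<gamma>2" "\<gamma> = \<gamma>1 + \<gamma>2" "\<alpha> = a' + b'"
      using exp_riesz[OF ab(1)] .
    have "a' \<in> E" using saturatedD[OF assms, of \<gamma>1 a'] ab r g by (simp add: avoids_add)
    moreover have "b' \<in> exp_power E n" using saturatedD[OF Suc, of \<gamma>2 b'] ab r g by (simp add: avoids_add)
    ultimately show "\<alpha> \<in> exp_power E (Suc n)" unfolding r(4) by (rule exp_power_SucI)
  qed
qed (simp add: saturated_def)

text \<open>Localization commutes with powers: one inclusion uses that powers of saturated sets are
  saturated, the other multiplies the denominators of the factors. So a symbolic power is an
  intersection of ordinary powers of the components.\<close>

lemma exp_loc_exp_power:
  fixes E :: "('x::finite \<Rightarrow>\<^sub>0 nat) set"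
  shows "exp_loc T (exp_power E n) = exp_power (exp_loc T E) n"
proof (intro equalityI subsetI)
  fix \<alpha> assume "\<alpha> \<in> exp_loc T (exp_power E n)"
  then obtain \<gamma> where g: "avoids T \<gamma>" "\<alpha> + \<gamma> \<in> exp_power E n" by (auto simp: exp_loc_def)
  then have "\<alpha> + \<gamma> \<in> exp_power (exp_loc T E) n" using exp_power_mono[OF exp_loc_superset] by blast
  then show "\<alpha> \<in> exp_power (exp_loc T E) n"
    using saturatedD[OF saturated_exp_power[OF saturated_exp_loc] g(1)] by blast
next
  show "\<alpha> \<in> exp_loc T (exp_power E n)" if "\<alpha> \<in> exp_power (exp_loc T E) n" for \<alpha>
    using that
  proof (induction n arbitrary: \<alpha>)
    case 0 show ?case by (auto simp: exp_loc_def intro: exI[of _ 0])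
  next
    case (Suc n)
    then obtain a b where ab: "\<alpha> = a + b" "a \<in> exp_loc T E" "b \<in> exp_power (exp_loc T E) n" by auto
    obtain c1 where c1: "avoids T c1" "a + c1 \<in> E" using ab(2) by (auto simp: exp_loc_def)
    obtain c2 where c2: "avoids T c2" "b + c2 \<in> exp_power E n" using Suc.IH[OF ab(3)] by (auto simp: exp_loc_def)
    have "(a + c1) + (b + c2) \<in> exp_power E (Suc n)" using c1 c2 by (intro exp_power_SucI)
    moreover have "(a + c1) + (b + c2) = \<alpha> + (c1 + c2)" by (simp add: ab(1) ac_simps)
    ultimately have "avoids T (c1 + c2) \<and> \<alpha> + (c1 + c2) \<in> exp_power E (Suc n)"
      using c1 c2 by (simp only: avoids_add)
    then show ?case unfolding exp_loc_def by blast
  qed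
qed

definition symbolic_exponents :: "('x \<Rightarrow>\<^sub>0 nat) set \<Rightarrow> nat \<Rightarrow> ('x \<Rightarrow>\<^sub>0 nat) set" where
  "symbolic_exponents E n = (\<Inter>T\<in>minimal_covers E. exp_power (exp_loc T E) n)"

lemma symbolic_power_exp_span:
  fixes E :: "('x::finite \<Rightarrow>\<^sub>0 nat) set"
  assumes "up_closed E"
  shows "symbolic_power (exp_span E) n = (exp_span (symbolic_exponents E n) :: ('x, 'k::field) mpoly set)"
proof -
  have "symbolic_power (exp_span E) n =
      (\<Inter>T\<in>minimal_covers E. exp_span (exp_power (exp_loc T E) n) :: ('x, 'k) mpoly set)"
    unfolding symbolic_power_def minimal_primes_exp_span
    by (simp add: ideal_power_exp_span[OF assms] localization_contraction_exp_span[OF up_closed_exp_power] exp_loc_exp_power)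
  then show ?thesis by (auto simp: exp_span_def symbolic_exponents_def)
qed

lemma up_closed_symbolic_exponents: "up_closed (symbolic_exponents E n)"
  using up_closed_exp_power unfolding up_closed_def symbolic_exponents_def by blast

section \<open>Primary decomposition of monomial ideals\<close>

text \<open>The exponent sets of monomial ideals primary to \<open>var_prime T\<close>: monomials
  off \<open>T\<close> cancel, and every variable of \<open>T\<close> has a power in the
  ideal.\<close>

definition primary_exps :: "'x set \<Rightarrow> ('x \<Rightarrow>\<^sub>0 nat) set \<Rightarrow> bool" where
  "primary_exps T E \<longleftrightarrow> up_closed E \<and> 0 \<notin> E \<and> saturated T E \<and> (\<forall>x\<in>T. \<exists>n. single x n \<in> E)"

lemma keys_power_not_avoids:
  fixes b :: "('x::finite, 'k::field) mpoly"
  assumes "b \<in> var_prime T" "\<gamma> \<in> keys (b ^ n)"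
  shows "n \<le> (\<Sum>x\<in>T. lookup \<gamma> x)"
  using assms(2)
proof (induction n arbitrary: \<gamma>)
  case (Suc n)
  then obtain \<alpha> \<beta> where g: "\<gamma> = \<alpha> + \<beta>" "\<alpha> \<in> keys b" "\<beta> \<in> keys (b ^ n)"
    using keys_mult[of b "b ^ n"] by auto
  then obtain x where x: "x \<in> T" "lookup \<alpha> x \<noteq> 0"
    using assms(1) by (auto simp: var_prime_def exp_span_def avoids_def)
  have "lookup \<alpha> x \<le> (\<Sum>x\<in>T. lookup \<alpha> x)"
    by (rule member_le_sum) (use x in auto)
  then show ?case using Suc.IH[OF g(3)] x(2) by (simp add: g(1) lookup_add sum.distrib)
qed simp

text \<open>Pigeonhole: a term whose degree in \<open>T\<close> exceeds the sum of the
  \<open>p x\<close> has an entry above some \<open>p x\<close>, so a pure power in \<open>E\<close>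
  divides it.\<close>

lemma primary_exps_power:
  fixes b :: "('x::finite, 'k::field) mpoly"
  assumes E: "primary_exps T E" and b: "b \<in> var_prime T"
  shows "\<exists>n. b ^ n \<in> exp_span E"
proof -
  have "\<forall>x\<in>T. \<exists>n. single x n \<in> E" using E by (simp add: primary_exps_def)
  then obtain p where p: "\<And>x. x \<in> T \<Longrightarrow> single x (p x) \<in> E" by metis
  define N where "N = (\<Sum>x\<in>T. p x)"
  have "b ^ Suc N \<in> exp_span E" unfolding exp_span_def
  proof (intro CollectI subsetI)
    fix \<gamma> assume "\<gamma> \<in> keys (b ^ Suc N)"
    then have "Suc N \<le> (\<Sum>x\<in>T. lookup \<gamma> x)" by (rule keys_power_not_avoids[OF b])
    then have "\<not> (\<Sum>x\<in>T. lookup \<gamma> x) \<le> (\<Sum>x\<in>T. p x)" by (simp add: N_def)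
    then obtain x where x: "x \<in> T" "p x < lookup \<gamma> x" using sum_mono[of T "lookup \<gamma>" p] by force
    then have "single x (p x) \<preceq> \<gamma>" by (auto simp: exp_le_def lookup_single when_def)
    then show "\<gamma> \<in> E" using up_closed_le[OF _ p[OF x(1)]] E by (auto simp: primary_exps_def)
  qed
  then show ?thesis by blast
qed

lemma primary_exps_cover: "primary_exps T E \<Longrightarrow> \<alpha> \<in> E \<Longrightarrow> \<not> avoids T \<alpha>"
  unfolding primary_exps_def saturated_def by (metis add_0)

lemma prime_ideal_power: "prime_ideal P \<Longrightarrow> a ^ n \<in> P \<Longrightarrow> a \<in> P"
proof (induction n)
  case 0
  then have "1 \<in> P" "is_ideal P" by (auto simp: prime_ideal_def)
  then show ?case using is_ideal_multI[of P 1 a] by simp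
next
  case (Suc n)
  then have "a \<in> P \<or> a ^ n \<in> P" unfolding prime_ideal_def by simp
  then show ?case using Suc by blast
qed

lemma radical_exp_span:
  assumes E: "primary_exps T E"
  shows "radical (exp_span E) = (var_prime T :: ('x::finite, 'k::field) mpoly set)"
proof (intro equalityI subsetI)
  fix a :: "('x, 'k) mpoly" assume "a \<in> radical (exp_span E)"
  then obtain n where "a ^ n \<in> exp_span E" by (auto simp: radical_def)
  moreover have "exp_span E \<subseteq> (var_prime T :: ('x, 'k) mpoly set)"
    unfolding exp_span_subset_var_prime covers_def using primary_exps_cover[OF E] by blast
  ultimately show "a \<in> var_prime T" using prime_ideal_power[OF prime_ideal_var_prime] by blast
next
  fix a :: "('x, 'k) mpoly" assume "a \<in> var_prime T"
  then show "a \<in> radical (exp_span E)" using primary_exps_power[OF E] by (simp add: radical_def)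
qed

lemma primary_ideal_exp_span:
  assumes E: "primary_exps T E"
  shows "primary_ideal (exp_span E :: ('x::finite, 'k::field) mpoly set)"
  unfolding primary_ideal_def
proof (intro conjI allI impI)
  show "is_ideal (exp_span E :: ('x, 'k) mpoly set)" using E by (auto simp: primary_exps_def is_ideal_exp_span)
  have "0 \<notin> E" using E by (simp add: primary_exps_def)
  then have "(1 :: ('x, 'k) mpoly) \<notin> exp_span E" by (simp add: exp_span_def)
  then show "exp_span E \<noteq> (UNIV :: ('x, 'k) mpoly set)" by blast
  fix a b :: "('x, 'k) mpoly" assume ab: "a * b \<in> exp_span E"
  show "a \<in> exp_span E \<or> (\<exists>n. b ^ n \<in> exp_span E)"
  proof (cases "b \<in> var_prime T")
    case True
    then show ?thesis using primary_exps_power[OF E] by blast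
  next
    case False
    then obtain \<beta> where "\<beta> \<in> keys b" "avoids T \<beta>" by (auto simp: not_in_var_prime)
    then show ?thesis using exp_span_cancel[OF _ _ ab] E by (auto simp: primary_exps_def)
  qed
qed

lemma monomial_single_power:
  "monomial (single x m) ^ n = (monomial (single x (n * m)) :: ('x, 'k::field) mpoly)"
  by (induction n) (simp_all add: mult_single flip: single_add)

text \<open>\<open>T\<close> collects the variables with a power in \<open>Q\<close>. The primary
  property cancels any other variable, so a monomial off \<open>T\<close> is cancelled one variable
  at a time.\<close>

lemma primary_monomial_ideal:
  fixes Q :: "('x::finite, 'k::field) mpoly set"
  assumes Q: "monomial_ideal Q" "primary_ideal Q"
  obtains T where "primary_exps T (exponents Q)"
proof -
  define T where "T = {x. \<exists>n. single x n \<in> exponents Q}"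
  have id: "is_ideal Q" "Q \<noteq> UNIV" and pr: "\<And>a b. a * b \<in> Q \<Longrightarrow> a \<in> Q \<or> (\<exists>n. b ^ n \<in> Q)"
    using Q(2) by (auto simp: primary_ideal_def)
  have "0 \<notin> exponents Q"
  proof
    assume "0 \<in> exponents Q"
    then have "1 \<in> Q" by (simp add: exponents_def)
    then have "r \<in> Q" for r using is_ideal_multI[OF id(1), of 1 r] by simp
    then show False using id(2) by auto
  qed
  moreover have "\<alpha> \<in> exponents Q" if "avoids T \<beta>" "\<alpha> + \<beta> \<in> exponents Q" for \<alpha> \<beta>
    using that
  proof (induction "mdeg \<beta>" arbitrary: \<beta> rule: less_induct)
    case less
    show ?case
    proof (cases "\<beta> = 0")
      case False
      then obtain x where x: "lookup \<beta> x \<noteq> 0" using exp_nonzero_ex by blast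
      then have "x \<notin> T" using less.prems by (auto simp: avoids_def)
      define \<beta>' where "\<beta>' = \<beta> - single x 1"
      have eq: "\<beta> = \<beta>' + single x 1" using minus_single_add[OF x] by (simp add: \<beta>'_def)
      have "monomial (\<alpha> + \<beta>') * monomial (single x 1) \<in> Q"
        using less.prems(2) by (simp add: monomial_mult exponents_def eq add.assoc del: One_nat_def)
      then have "monomial (\<alpha> + \<beta>') \<in> Q \<or> (\<exists>n. monomial (single x 1) ^ n \<in> Q)" by (rule pr)
      moreover have "\<not> (\<exists>n. monomial (single x 1) ^ n \<in> Q)"
        using \<open>x \<notin> T\<close> unfolding monomial_single_power by (auto simp: T_def exponents_def)
      ultimately have "\<alpha> + \<beta>' \<in> exponents Q" by (simp add: exponents_def)
      then show ?thesis using less.hyps[of \<beta>'] less.prems(1) by (simp add: eq mdeg_add avoids_add)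
    qed (use less in auto)
  qed
  ultimately have "primary_exps T (exponents Q)"
    using up_closed_exponents[OF id(1)] unfolding primary_exps_def saturated_def T_def by blast
  then show ?thesis by (rule that)
qed

lemma primary_exps_Int:
  assumes "primary_exps T E" "primary_exps T E'"
  shows "primary_exps T (E \<inter> E')"
proof -
  have "\<exists>n. single x n \<in> E \<inter> E'" if "x \<in> T" for x
  proof -
    have "\<exists>m. single x m \<in> E" "\<exists>n. single x n \<in> E'"
      using assms that by (simp_all add: primary_exps_def)
    then obtain m n where "single x m \<in> E" "single x n \<in> E'" by blast
    moreover have "up_closed E" "up_closed E'" using assms by (simp_all add: primary_exps_def)
    ultimately have "single x m + single x n \<in> E" "single x n + single x m \<in> E'"
      by (auto intro: up_closed_addI)
    then have "single x m + single x n \<in> E \<inter> E'" by (simp add: add.commute)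
    then show ?thesis unfolding single_add[symmetric] by blast
  qed
  then show ?thesis using assms unfolding primary_exps_def up_closed_def saturated_def by blast
qed

section \<open>Existence of minimal monomial primary decompositions\<close>

lemma finite_bounded_exps: "finite {\<beta> :: 'x::finite \<Rightarrow>\<^sub>0 nat. \<forall>x. lookup \<beta> x \<le> N}"
proof (rule finite_subset)
  have "finite {f :: 'x \<Rightarrow> nat. \<forall>x. (x \<in> UNIV \<longrightarrow> f x \<in> {..N}) \<and> (x \<notin> UNIV \<longrightarrow> f x = 0)}"
    by (rule finite_set_of_finite_funs) auto
  then show "finite (exp_of ` {f :: 'x \<Rightarrow> nat. \<forall>x. f x \<le> N})" by simp
  show "{\<beta> :: 'x \<Rightarrow>\<^sub>0 nat. \<forall>x. lookup \<beta> x \<le> N} \<subseteq> exp_of ` {f. \<forall>x. f x \<le> N}"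
  proof
    fix \<beta> :: "'x \<Rightarrow>\<^sub>0 nat" assume "\<beta> \<in> {\<beta>. \<forall>x. lookup \<beta> x \<le> N}"
    moreover have "\<beta> = exp_of (lookup \<beta>)" by (rule poly_mapping_eqI) simp
    ultimately show "\<beta> \<in> exp_of ` {f. \<forall>x. f x \<le> N}" by blast
  qed
qed

text \<open>For each exponent \<open>\<beta>\<close> outside of \<open>E\<close> with entries at most \<open>N\<close> there is an irreducible component, generated
  by the variables \<open>x\<close> with \<open>\<beta> x < N\<close> to the powers \<open>\<beta> x + 1\<close>; the entry \<open>N\<close> plays the role of infinity.\<close>

lemma primary_decomposition_exists:
  fixes E :: "('x::finite \<Rightarrow>\<^sub>0 nat) set"
  assumes E: "up_closed E"
  obtains \<E> where "finite \<E>" "\<forall>F\<in>\<E>. \<exists>T. primary_exps T F" "\<Inter>\<E> = E"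
proof -
  obtain F where F: "F \<subseteq> E" "finite F" "\<forall>\<alpha>\<in>E. \<exists>\<beta>\<in>F. \<beta> \<preceq> \<alpha>" using dickson[of E] by blast
  \<comment> \<open>A common bound for all entries of the generators in \<open>F\<close>.\<close>
  define N where "N = (\<Sum>\<beta>\<in>F. mdeg \<beta>)"
  have N: "lookup \<beta> x \<le> N" if "\<beta> \<in> F" for \<beta> x
  proof -
    have "lookup \<beta> x \<le> mdeg \<beta>" unfolding mdeg_def by (rule member_le_sum) auto
    also have "mdeg \<beta> \<le> N" unfolding N_def by (rule member_le_sum) (use F(2) that in auto)
    finally show ?thesis .
  qed
  define irr where "irr \<beta> = {\<alpha>. \<exists>x. lookup \<beta> x < N \<and> lookup \<beta> x < lookup \<alpha> x}"
    for \<beta> :: "'x \<Rightarrow>\<^sub>0 nat"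
  define B where "B = {\<beta>. \<beta> \<notin> E \<and> (\<forall>x. lookup \<beta> x \<le> N)}"
  show thesis
  proof (rule that[of "irr ` B"])
    show "finite (irr ` B)"
      by (rule finite_imageI, rule finite_subset[OF _ finite_bounded_exps[of N]]) (auto simp: B_def)
  next
    show "\<forall>G\<in>irr ` B. \<exists>T. primary_exps T G"
    proof
      fix G assume "G \<in> irr ` B"
      then obtain \<beta> where G: "G = irr \<beta>" by blast
      have "\<exists>n. single x n \<in> G" if "lookup \<beta> x < N" for x
        by (rule exI[of _ "Suc (lookup \<beta> x)"]) (use that in \<open>auto simp: G irr_def intro!: exI[of _ x]\<close>)
      moreover have "up_closed G"
        unfolding up_closed_def G irr_def by (auto simp: lookup_add intro: trans_less_add1)
      ultimately have "primary_exps {x. lookup \<beta> x < N} G"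
        by (auto simp: primary_exps_def saturated_def avoids_def G irr_def lookup_add)
      then show "\<exists>T. primary_exps T G" by blast
    qed
  next
    show "\<Inter> (irr ` B) = E"
    proof (intro equalityI subsetI)
      fix \<alpha> assume \<alpha>: "\<alpha> \<in> \<Inter> (irr ` B)"
      show "\<alpha> \<in> E"
      proof (rule ccontr)
        assume "\<alpha> \<notin> E"
        \<comment> \<open>Entries are capped at \<open>N\<close>, the value at which
          \<open>irr \<beta>\<close> has no generator; the smaller exponent is still outside
          \<open>E\<close>.\<close>
        define \<beta> where "\<beta> = exp_of (\<lambda>x. min (lookup \<alpha> x) N)"
        have "\<beta> \<preceq> \<alpha>" by (simp add: \<beta>_def exp_le_def)
        then have "\<beta> \<notin> E" using up_closed_le[OF E] \<open>\<alpha> \<notin> E\<close> by blast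
        then have "\<beta> \<in> B" by (simp add: B_def \<beta>_def)
        then have "\<alpha> \<in> irr \<beta>" using \<alpha> by blast
        then show False by (auto simp: irr_def \<beta>_def min_def split: if_splits)
      qed
    next
      fix \<alpha> assume "\<alpha> \<in> E"
      then obtain g where g: "g \<in> F" "g \<preceq> \<alpha>" using F(3) by blast
      have "\<alpha> \<in> irr \<beta>" if "\<beta> \<in> B" for \<beta>
      proof (rule ccontr)
        assume na: "\<alpha> \<notin> irr \<beta>"
        \<comment> \<open>Where \<open>\<beta>\<close> has entry \<open>N\<close> it dominates every
          generator; elsewhere \<open>\<alpha>\<close> does not exceed it, as
          \<open>\<alpha>\<close> is not in \<open>irr \<beta>\<close>.\<close>
        have "lookup g x \<le> lookup \<beta> x" for x
        proof (cases "lookup \<beta> x < N")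
          case True
          then have "lookup \<alpha> x \<le> lookup \<beta> x" using na unfolding irr_def mem_Collect_eq not_ex de_Morgan_conj not_less by (meson leD)
          then show ?thesis using g(2) by (auto simp: exp_le_def intro: order_trans)
        next
          case False
          then show ?thesis using N[OF g(1), of x] by linarith
        qed
        then have "\<beta> \<in> E" using up_closed_le[OF E, of g \<beta>] g(1) F(1) by (auto simp: exp_le_def)
        then show False using that by (simp add: B_def)
      qed
      then show "\<alpha> \<in> \<Inter> (irr ` B)" by blast
    qed
  qed
qed

lemma exp_span_Int: "exp_span E \<inter> exp_span E' = exp_span (E \<inter> E')"
  by (auto simp: exp_span_def)

text \<open>Take a decomposition with the fewest components. Dropping a redundant component, or
  replacing two components of equal radical by their intersection, would make it smaller.\<close>

lemma minimal_decomposition_exists: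
  fixes I :: "('x::finite, 'k::field) mpoly set"
  assumes I: "monomial_ideal I"
  shows "\<exists>\<Q>. minimal_monomial_primary_decomposition I \<Q>"
proof -
  define good where "good \<Q> \<longleftrightarrow> finite \<Q> \<and> (\<forall>Q\<in>\<Q>. monomial_ideal Q \<and> primary_ideal Q) \<and> \<Inter>\<Q> = I"
    for \<Q> :: "('x, 'k) mpoly set set"
  have prim: "monomial_ideal (exp_span F :: ('x, 'k) mpoly set) \<and> primary_ideal (exp_span F :: ('x, 'k) mpoly set)"
    if "primary_exps T F" for T F
    using primary_ideal_exp_span[OF that] that unfolding monomial_ideal_iff primary_exps_def by blast
  obtain \<E> where Ex: "finite \<E>" "\<forall>F\<in>\<E>. \<exists>T. primary_exps T F" "\<Inter>\<E> = exponents I"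
    by (rule primary_decomposition_exists[OF monomial_ideal_exponents(2)[OF I]])
  have "\<Inter> (exp_span ` \<E>) = (exp_span (\<Inter>\<E>) :: ('x, 'k) mpoly set)" by (auto simp: exp_span_def)
  then have "good (exp_span ` \<E>)"
    unfolding good_def using Ex(1,2) prim monomial_ideal_exponents(1)[OF I] Ex(3) by (metis finite_imageI imageE)
  then obtain \<Q> where Q: "good \<Q>" "\<And>\<Q>'. good \<Q>' \<Longrightarrow> card \<Q> \<le> card \<Q>'"
    using ex_has_least_nat[of good "exp_span ` \<E>" card] by blast
  have fin: "finite \<Q>" and mp: "\<And>Q. Q \<in> \<Q> \<Longrightarrow> monomial_ideal Q \<and> primary_ideal Q" and int: "\<Inter>\<Q> = I"
    using Q(1) by (auto simp: good_def)
  have "\<Inter>(\<Q> - {Q}) \<noteq> I" if "Q \<in> \<Q>" for Q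
  proof
    assume "\<Inter>(\<Q> - {Q}) = I"
    then have "good (\<Q> - {Q})" using fin mp by (simp add: good_def)
    then show False using Q(2)[of "\<Q> - {Q}"] card_Diff1_less[OF fin that] by simp
  qed
  moreover have "Q = Q'" if Q2: "Q \<in> \<Q>" "Q' \<in> \<Q>" "radical Q = radical Q'" for Q Q'
  proof (rule ccontr)
    assume ne: "Q \<noteq> Q'"
    obtain T where T: "primary_exps T (exponents Q)" using primary_monomial_ideal mp[OF Q2(1)] by blast
    obtain T' where T': "primary_exps T' (exponents Q')" using primary_monomial_ideal mp[OF Q2(2)] by blast
    have eq: "Q = exp_span (exponents Q)" "Q' = exp_span (exponents Q')"
      using mp Q2 monomial_ideal_exponents(1) by auto
    have "(var_prime T :: ('x, 'k) mpoly set) = var_prime T'"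
      using radical_exp_span[OF T, where 'k = 'k] radical_exp_span[OF T', where 'k = 'k] Q2(3) eq by simp
    then have "primary_exps T (exponents Q \<inter> exponents Q')"
      using primary_exps_Int[OF T] T' by (simp add: var_prime_eq_iff)
    then have "monomial_ideal (Q \<inter> Q') \<and> primary_ideal (Q \<inter> Q')"
      using prim eq by (metis exp_span_Int)
    moreover have "\<Inter>(insert (Q \<inter> Q') (\<Q> - {Q, Q'})) = I" using Q2 int by auto
    ultimately have "good (insert (Q \<inter> Q') (\<Q> - {Q, Q'}))" using fin mp by (simp add: good_def)
    then have "card \<Q> \<le> card (insert (Q \<inter> Q') (\<Q> - {Q, Q'}))" by (rule Q(2))
    also have "\<dots> \<le> Suc (card (\<Q> - {Q, Q'}))" using fin by (simp add: card_insert_if)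
    also have "\<dots> = Suc (card \<Q> - 2)" using ne Q2 fin by (simp add: card_Diff_subset)
    also have "\<dots> < card \<Q>" using card_mono[OF fin, of "{Q, Q'}"] Q2 ne by simp
    finally show False by simp
  qed
  ultimately have "minimal_monomial_primary_decomposition I \<Q>"
    unfolding minimal_monomial_primary_decomposition_def inj_on_def using fin mp int by blast
  then show ?thesis by blast
qed

section \<open>Uniqueness of the components over minimal primes\<close>

text \<open>Each variable of \<open>T'\<close> has a power in \<open>E'\<close>, which must meet
  \<open>T\<close>. So \<open>T'\<close> is a cover contained in the minimal cover
  \<open>T\<close>.\<close>

lemma primary_exps_minimal_cover:
  assumes T: "T \<in> minimal_covers E" and T': "primary_exps T' E'" and "E \<subseteq> E'"
    and na: "\<And>\<alpha>. \<alpha> \<in> E' \<Longrightarrow> \<not> avoids T \<alpha>"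
  shows "T' = T"
proof -
  have "T' \<subseteq> T"
  proof
    fix x assume "x \<in> T'"
    then obtain n where "single x n \<in> E'" using T' by (auto simp: primary_exps_def)
    then show "x \<in> T" using na[of "single x n"]
      by (auto simp: avoids_def lookup_single when_def split: if_splits)
  qed
  moreover have "T' \<in> covers E" using primary_exps_cover[OF T'] assms(3) by (auto simp: covers_def)
  ultimately show ?thesis using T by (auto simp: minimal_covers_def)
qed

text \<open>Localizing at a minimal prime removes the other components, since each of them contains
  a monomial off \<open>T\<close>. Thus the component over \<open>T\<close> is
  \<open>exp_loc T\<close> of the whole ideal, whichever decomposition is chosen.\<close>

lemma minimal_components:
  fixes I :: "('x::finite, 'k::field) mpoly set"
  assumes \<Q>: "minimal_monomial_primary_decomposition I \<Q>" and I: "monomial_ideal I"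
  shows "{Q \<in> \<Q>. radical Q \<in> minimal_primes I} = (\<lambda>T. exp_span (exp_loc T (exponents I))) ` minimal_covers (exponents I)"
proof -
  let ?E = "exponents I"
  have fin: "finite \<Q>" and mp: "\<And>Q. Q \<in> \<Q> \<Longrightarrow> monomial_ideal Q \<and> primary_ideal Q" and int: "\<Inter>\<Q> = I"
    and inj: "inj_on radical \<Q>"
    using \<Q> by (auto simp: minimal_monomial_primary_decomposition_def)
  have "\<forall>Q\<in>\<Q>. \<exists>T. primary_exps T (exponents Q)" using primary_monomial_ideal mp by metis
  then obtain t where t: "\<And>Q. Q \<in> \<Q> \<Longrightarrow> primary_exps (t Q) (exponents Q)" by metis
  have sp: "Q = exp_span (exponents Q)" if "Q \<in> \<Q>" for Q using mp[OF that] monomial_ideal_exponents(1) by blast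
  have rad: "radical Q = var_prime (t Q)" if "Q \<in> \<Q>" for Q
    using radical_exp_span[OF t[OF that], where 'k = 'k] sp[OF that] by simp
  have intE: "?E = (\<Inter>Q\<in>\<Q>. exponents Q)" using int by (auto simp: exponents_def)
  have minI: "minimal_primes I = var_prime ` minimal_covers ?E"
    using minimal_primes_exp_span[of ?E, where 'k = 'k] monomial_ideal_exponents(1)[OF I] by simp
  have sum_in: "(\<Sum>Q\<in>\<Q>'. c Q) + \<gamma> \<in> exponents Q" if "\<And>Q. Q \<in> \<Q>' \<Longrightarrow> c Q \<in> exponents Q" "Q \<in> \<Q>'" "\<Q>' \<subseteq> \<Q>" for c Q \<Q>' \<gamma>
  proof -
    have "finite \<Q>'" using fin that(3) finite_subset by blast
    then have "(\<Sum>Q\<in>\<Q>'. c Q) + \<gamma> = c Q + ((\<Sum>Q\<in>\<Q>' - {Q}. c Q) + \<gamma>)"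
      using that(2) by (simp add: sum.remove add.assoc)
    moreover have "up_closed (exponents Q)" using t that by (auto simp: primary_exps_def)
    ultimately show ?thesis using up_closed_addI that by metis
  qed
  have comp: "exponents Q = exp_loc (t Q) ?E" if Q: "Q \<in> \<Q>" "t Q \<in> minimal_covers ?E" for Q
  proof (intro equalityI subsetI)
    fix \<alpha> assume \<alpha>: "\<alpha> \<in> exponents Q"
    have "\<exists>c. c \<in> exponents Q' \<and> avoids (t Q) c" if "Q' \<in> \<Q> - {Q}" for Q'
    proof (rule ccontr)
      assume "\<nexists>c. c \<in> exponents Q' \<and> avoids (t Q) c"
      then have "t Q' = t Q"
        using primary_exps_minimal_cover[OF Q(2) t[of Q']] that intE by blast
      then have "radical Q' = radical Q" using rad that Q by simp
      then show False using inj that Q unfolding inj_on_def by blast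
    qed
    then obtain c where c: "\<And>Q'. Q' \<in> \<Q> - {Q} \<Longrightarrow> c Q' \<in> exponents Q' \<and> avoids (t Q) (c Q')" by metis
    \<comment> \<open>Multiplying by one monomial off \<open>t Q\<close> from every other component
      moves \<open>\<alpha>\<close> into \<open>I\<close>.\<close>
    define \<gamma> where "\<gamma> = (\<Sum>Q'\<in>\<Q> - {Q}. c Q')"
    have "avoids (t Q) \<gamma>" unfolding \<gamma>_def using c by (intro avoids_sum) blast
    moreover have "\<gamma> + \<alpha> \<in> exponents Q'" if "Q' \<in> \<Q>" for Q'
    proof (cases "Q' = Q")
      case True
      have "up_closed (exponents Q)" using t[OF Q(1)] by (simp add: primary_exps_def)
      then show ?thesis using up_closed_addI[of "exponents Q" \<alpha> \<gamma>] \<alpha> True by (simp add: add.commute)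
    next
      case False
      then show ?thesis unfolding \<gamma>_def using c that by (intro sum_in) auto
    qed
    ultimately show "\<alpha> \<in> exp_loc (t Q) ?E" unfolding exp_loc_def intE by (auto simp: add.commute)
  next
    fix \<alpha> assume "\<alpha> \<in> exp_loc (t Q) ?E"
    then obtain \<gamma> where "avoids (t Q) \<gamma>" "\<alpha> + \<gamma> \<in> exponents Q" using intE Q(1) by (auto simp: exp_loc_def)
    then show "\<alpha> \<in> exponents Q" using t[OF Q(1)] saturatedD unfolding primary_exps_def by blast
  qed
  show ?thesis
  proof (intro equalityI subsetI)
    fix Q assume "Q \<in> {Q \<in> \<Q>. radical Q \<in> minimal_primes I}"
    then have Q: "Q \<in> \<Q>" "radical Q \<in> minimal_primes I" by auto
    then have "t Q \<in> minimal_covers ?E" using rad minI var_prime_eq_iff by (metis imageE)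
    then show "Q \<in> (\<lambda>T. exp_span (exp_loc T ?E)) ` minimal_covers ?E"
      using comp[OF Q(1)] sp[OF Q(1)] by (metis image_eqI)
  next
    fix Q0 assume "Q0 \<in> (\<lambda>T. exp_span (exp_loc T ?E) :: ('x, 'k) mpoly set) ` minimal_covers ?E"
    then obtain T where T: "T \<in> minimal_covers ?E" "Q0 = exp_span (exp_loc T ?E)" by blast
    \<comment> \<open>Otherwise the product of monomials off \<open>T\<close>, one from each
      component, would lie in \<open>I\<close>, although \<open>T\<close> is a cover.\<close>
    have "\<exists>Q\<in>\<Q>. \<forall>\<alpha>\<in>exponents Q. \<not> avoids T \<alpha>"
    proof (rule ccontr)
      assume "\<not> (\<exists>Q\<in>\<Q>. \<forall>\<alpha>\<in>exponents Q. \<not> avoids T \<alpha>)"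
      then obtain c where c: "\<And>Q. Q \<in> \<Q> \<Longrightarrow> c Q \<in> exponents Q \<and> avoids T (c Q)" by metis
      have "(\<Sum>Q\<in>\<Q>. c Q) + 0 \<in> exponents Q" if "Q \<in> \<Q>" for Q using c that by (intro sum_in) auto
      then have "(\<Sum>Q\<in>\<Q>. c Q) \<in> ?E" unfolding intE by simp
      moreover have "avoids T (\<Sum>Q\<in>\<Q>. c Q)" using c by (intro avoids_sum) blast
      ultimately show False using T(1) by (auto simp: minimal_covers_def covers_def)
    qed
    then obtain Q where Q: "Q \<in> \<Q>" "\<And>\<alpha>. \<alpha> \<in> exponents Q \<Longrightarrow> \<not> avoids T \<alpha>" by blast
    have tQ: "t Q = T" using primary_exps_minimal_cover[OF T(1) t[OF Q(1)]] Q intE by blast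
    then have "Q0 = Q" using comp[OF Q(1)] T sp[OF Q(1)] by simp
    then show "Q0 \<in> {Q \<in> \<Q>. radical Q \<in> minimal_primes I}" using Q(1) rad[OF Q(1)] tQ minI T(1) by auto
  qed
qed

lemma symbolic_polyhedron_eq:
  fixes I :: "('x::finite, 'k::field) mpoly set"
  assumes I: "monomial_ideal I"
  shows "symbolic_polyhedron I = (\<Inter>T\<in>minimal_covers (exponents I). convex hull (exponent_vector ` exp_loc T (exponents I)))"
proof -
  have "minimal_monomial_primary_decomposition I (SOME \<Q>. minimal_monomial_primary_decomposition I \<Q>)"
    using minimal_decomposition_exists[OF I] by (rule someI_ex)
  note * = minimal_components[OF this I]
  show ?thesis unfolding symbolic_polyhedron_def Let_def * newton_polyhedron_def
    unfolding exponents_def[symmetric] by simp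
qed

section \<open>Sums of exponents\<close>

text \<open>By minimality \<open>T - {x}\<close> is no cover, so some exponent of \<open>E\<close>
  meets \<open>T\<close> at most in \<open>x\<close>. Localizing strips its part off
  \<open>T\<close> and leaves a pure power.\<close>

lemma primary_exps_exp_loc:
  fixes E :: "('x::finite \<Rightarrow>\<^sub>0 nat) set"
  assumes E: "up_closed E" and T: "T \<in> minimal_covers E"
  shows "primary_exps T (exp_loc T E)"
proof -
  have cov: "\<not> avoids T \<alpha>" if "\<alpha> \<in> E" for \<alpha> using T that by (auto simp: minimal_covers_def covers_def)
  have "0 \<notin> exp_loc T E" using cov by (auto simp: exp_loc_def)
  moreover have "\<exists>n. single x n \<in> exp_loc T E" if x: "x \<in> T" for x
  proof -
    have "T - {x} \<notin> covers E" using T x by (auto simp: minimal_covers_def)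
    then obtain \<alpha> where a: "\<alpha> \<in> E" "avoids (T - {x}) \<alpha>" by (auto simp: covers_def)
    define \<gamma> where "\<gamma> = \<alpha> - single x (lookup \<alpha> x)"
    have "single x (lookup \<alpha> x) + \<gamma> = \<alpha>"
      by (rule poly_mapping_eqI) (simp add: \<gamma>_def lookup_add lookup_minus lookup_single when_def)
    moreover have "avoids T \<gamma>" using a(2) by (auto simp: avoids_def \<gamma>_def lookup_minus lookup_single when_def)
    ultimately have "single x (lookup \<alpha> x) \<in> exp_loc T E"
      using a(1) unfolding exp_loc_def by auto
    then show ?thesis by blast
  qed
  ultimately show ?thesis
    using up_closed_exp_loc[OF E] saturated_exp_loc unfolding primary_exps_def by blast
qed

lemma exp_power_Suc_subset: "exp_power E (Suc n) \<subseteq> exp_power E n"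
proof
  fix \<alpha> assume "\<alpha> \<in> exp_power E (Suc n)"
  then obtain a b where "\<alpha> = b + a" "b \<in> exp_power E n" by (auto simp: add.commute)
  then show "\<alpha> \<in> exp_power E n" using up_closed_addI[OF up_closed_exp_power] by blast
qed

lemma exp_power_antimono: "m \<le> n \<Longrightarrow> exp_power E n \<subseteq> exp_power E m"
  using exp_power_Suc_subset by (rule lift_Suc_antimono_le)

lemma exp_power_add: "\<alpha> \<in> exp_power E m \<Longrightarrow> \<beta> \<in> exp_power E n \<Longrightarrow> \<alpha> + \<beta> \<in> exp_power E (m + n)"
proof (induction m arbitrary: \<alpha>)
  case 0
  then show ?case using up_closed_addI[OF up_closed_exp_power, of \<beta> E n \<alpha>] by (simp add: add.commute)
next
  case (Suc m)
  then obtain a b where ab: "\<alpha> = a + b" "a \<in> E" "b \<in> exp_power E m" by auto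
  then show ?case using exp_power_SucI[OF ab(2) Suc.IH[OF ab(3) Suc.prems(2)]] by (simp add: add.assoc)
qed

lemma exp_power_sum: "finite A \<Longrightarrow> (\<And>i. i \<in> A \<Longrightarrow> f i \<in> exp_power E (k i)) \<Longrightarrow> sum f A \<in> exp_power E (sum k A)"
  by (induction A rule: finite_induct) (auto intro: exp_power_add)

lemma exp_power_multiple: "\<alpha> \<in> E \<Longrightarrow> (\<Sum>i<k. \<alpha>) \<in> exp_power E k"
proof (induction k)
  case (Suc k)
  then show ?case using exp_power_SucI[of \<alpha> E "\<Sum>i<k. \<alpha>" k] by (simp add: add.commute)
qed simp

text \<open>If a factor of a product of \<open>n\<close> elements loses the variable \<open>k\<close>, replace it by \<open>x\<^sub>j\<^sup>p\<close>.\<close>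

lemma exp_power_swap:
  assumes p: "single j p \<in> E"
  shows "\<alpha> + single k 1 \<in> exp_power E n \<Longrightarrow> \<alpha> + single j p \<in> exp_power E n"
proof (induction n arbitrary: \<alpha>)
  case (Suc n)
  let ?k = "single k (1::nat)"
  obtain u v where uv: "\<alpha> + ?k = u + v" "u \<in> E" "v \<in> exp_power E n" using Suc.prems by auto
  show ?case
  proof (cases "lookup u k = 0")
    case False
    then obtain u' where u': "u = u' + ?k" using minus_single_add[OF False] by metis
    then have "\<alpha> + ?k = (u' + v) + ?k" using uv(1) by (simp add: ac_simps)
    then have "\<alpha> = u' + v" by simp
    then have "\<alpha> + single j p = single j p + (v + u')" by (simp add: ac_simps)
    then show ?thesis
      using exp_power_SucI[OF p up_closed_addI[OF up_closed_exp_power uv(3)]] by metis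
  next
    case True
    have "lookup (\<alpha> + ?k) k = lookup (u + v) k" using uv(1) by simp
    then have "lookup v k \<noteq> 0" using True by (simp add: lookup_add)
    then obtain v' where v': "v = v' + ?k" using minus_single_add by metis
    then have "\<alpha> + ?k = (u + v') + ?k" using uv(1) by (simp add: ac_simps)
    then have "\<alpha> = u + v'" by simp
    moreover have "v' + single j p \<in> exp_power E n" using Suc.IH uv(3) v' by blast
    ultimately show ?thesis using exp_power_SucI[OF uv(2)] by (metis add.assoc)
  qed
qed simp

section \<open>Squarefree exponents and the cone property\<close>

text \<open>The multidegree of the Koszul basis element indexed by \<open>\<tau>\<close>.\<close>

definition exp_set :: "'x set \<Rightarrow> ('x::finite \<Rightarrow>\<^sub>0 nat)" where
  "exp_set \<tau> = exp_of (\<lambda>x. if x \<in> \<tau> then 1 else 0)"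

lemma lookup_exp_set [simp]: "lookup (exp_set \<tau>) x = (if x \<in> \<tau> then 1 else 0)"
  by (simp add: exp_set_def)

lemma exp_set_empty [simp]: "exp_set {} = 0"
  by (rule poly_mapping_eqI) simp

lemma exp_set_insert: "k \<notin> \<tau> \<Longrightarrow> exp_set (insert k \<tau>) = exp_set \<tau> + single k 1"
  by (rule poly_mapping_eqI) (auto simp: lookup_add lookup_single when_def)

lemma exp_power_swap_set:
  fixes \<tau> :: "'x::finite set"
  assumes p: "single j p \<in> E"
  shows "\<alpha> + exp_set \<tau> \<in> exp_power E n \<Longrightarrow> \<alpha> + single j (card \<tau> * p) \<in> exp_power E n"
proof (induction \<tau> arbitrary: \<alpha> rule: finite_induct[OF finite])
  case 1 then show ?case by simp
next
  case (2 k \<tau>)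
  have "(\<alpha> + exp_set \<tau>) + single k 1 \<in> exp_power E n"
    using 2 by (simp add: exp_set_insert add.assoc)
  from exp_power_swap[OF p this] have "(\<alpha> + single j p) + exp_set \<tau> \<in> exp_power E n"
    by (simp add: ac_simps)
  from 2(3)[OF this] show ?case using 2(1,2) by (simp add: add.assoc flip: single_add)
qed

definition common_exponent :: "('x \<Rightarrow>\<^sub>0 nat) set \<Rightarrow> nat \<Rightarrow> bool" where
  "common_exponent E p \<longleftrightarrow> (\<forall>T\<in>minimal_covers E. \<forall>x\<in>T. single x p \<in> exp_loc T E)"

lemma common_exponent_exists:
  fixes E :: "('x::finite \<Rightarrow>\<^sub>0 nat) set"
  assumes E: "up_closed E"
  shows "\<exists>p. common_exponent E p"
proof -
  have "\<forall>T\<in>minimal_covers E. \<forall>x\<in>T. \<exists>n. single x n \<in> exp_loc T E"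
    using primary_exps_exp_loc[OF E] by (simp add: primary_exps_def)
  then obtain q where q: "\<And>T x. T \<in> minimal_covers E \<Longrightarrow> x \<in> T \<Longrightarrow> single x (q T x) \<in> exp_loc T E"
    by metis
  define p where "p = (\<Sum>T\<in>UNIV. \<Sum>x\<in>UNIV. q T x)"
  have "single x p \<in> exp_loc T E" if "T \<in> minimal_covers E" "x \<in> T" for T x
  proof -
    have "q T x \<le> (\<Sum>x\<in>UNIV. q T x)" by (rule member_le_sum) auto
    also have "\<dots> \<le> p" unfolding p_def by (rule member_le_sum[of T UNIV "\<lambda>T. \<Sum>x\<in>UNIV. q T x"]) auto
    finally have "single x (q T x) \<preceq> single x p"
      by (auto simp: exp_le_def lookup_single when_def)
    then show ?thesis using up_closed_le[OF up_closed_exp_loc[OF E] q[OF that]] by blast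
  qed
  then show ?thesis unfolding common_exponent_def by blast
qed

text \<open>The complex \<open>{\<tau>. \<alpha> - \<tau> \<in> S}\<close> is a cone with apex \<open>j\<close>.\<close>

definition cone_at :: "('x::finite \<Rightarrow>\<^sub>0 nat) set \<Rightarrow> ('x \<Rightarrow>\<^sub>0 nat) \<Rightarrow> 'x \<Rightarrow> bool" where
  "cone_at S \<alpha> j \<longleftrightarrow> (\<forall>\<tau> \<gamma>. \<gamma> \<in> S \<longrightarrow> \<gamma> + exp_set \<tau> = \<alpha> \<longrightarrow> j \<notin> \<tau> \<longrightarrow> (\<exists>\<gamma>'\<in>S. \<gamma> = \<gamma>' + single j 1))"

text \<open>For components whose prime contains \<open>j\<close>, the at most
  \<open>CARD('x)\<close> variables of \<open>\<tau>\<close> are traded for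
  \<open>CARD('x) * p\<close> copies of \<open>j\<close>; the extra 1 in \<open>K\<close> is the
  copy of \<open>j\<close> that is then removed. For the other components, copies of
  \<open>j\<close> cancel by saturation.\<close>

lemma cone_at_symbolic:
  fixes E :: "('x::finite \<Rightarrow>\<^sub>0 nat) set"
  assumes p: "common_exponent E p" and K: "K = CARD('x) * p + 1"
    and a': "\<alpha>' \<in> symbolic_exponents E n" and \<alpha>: "\<alpha> = \<alpha>' + single j K"
  shows "cone_at (symbolic_exponents E n) \<alpha> j"
  unfolding cone_at_def
proof (intro allI impI)
  fix \<tau> \<gamma> assume g: "\<gamma> \<in> symbolic_exponents E n" "\<gamma> + exp_set \<tau> = \<alpha>" "j \<notin> \<tau>"
  have lk: "lookup \<gamma> x + lookup (exp_set \<tau>) x = lookup \<alpha>' x + lookup (single j K) x" for x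
    using g(2) unfolding \<alpha> by (metis lookup_add)
  \<comment> \<open>As \<open>j\<close> is not in \<open>\<tau>\<close>, all \<open>K\<close> copies
    of \<open>j\<close> added to \<open>\<alpha>'\<close> are still present in
    \<open>\<gamma>\<close>.\<close>
  define \<gamma>0 where "\<gamma>0 = \<gamma> - single j K"
  have g0: "\<gamma> = \<gamma>0 + single j K"
    using lk[of j] g(3) by (intro poly_mapping_eqI) (auto simp: \<gamma>0_def lookup_add lookup_minus lookup_single when_def)
  have "\<gamma>0 + exp_set \<tau> + single j K = \<alpha>' + single j K"
    using g(2) g0 \<alpha> by (simp add: ac_simps)
  then have g0': "\<gamma>0 + exp_set \<tau> = \<alpha>'" by simp
  have "\<gamma>0 + single j (K - 1) \<in> exp_power (exp_loc T E) n" if T: "T \<in> minimal_covers E" for T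
  proof (cases "j \<in> T")
    case True
    then have "single j p \<in> exp_loc T E" using p T by (simp add: common_exponent_def)
    moreover have "\<gamma>0 + exp_set \<tau> \<in> exp_power (exp_loc T E) n" using a' T g0' by (simp add: symbolic_exponents_def)
    ultimately have "\<gamma>0 + single j (card \<tau> * p) \<in> exp_power (exp_loc T E) n" by (rule exp_power_swap_set)
    moreover have "card \<tau> * p \<le> K - 1" unfolding K by (simp add: card_mono)
    then have "\<gamma>0 + single j (card \<tau> * p) \<preceq> \<gamma>0 + single j (K - 1)"
      by (auto simp: exp_le_def lookup_add lookup_single when_def)
    ultimately show ?thesis using up_closed_le[OF up_closed_exp_power] by blast
  next
    case False
    have "avoids T (single j (1::nat))" using False by (auto simp: avoids_def lookup_single when_def)
    moreover have "\<gamma>0 + single j (K - 1) + single j 1 = \<gamma>"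
      unfolding g0 K by (simp add: add.assoc flip: single_add)
    moreover have "\<gamma> \<in> exp_power (exp_loc T E) n" using g(1) T by (auto simp: symbolic_exponents_def)
    ultimately show ?thesis
      using saturatedD[OF saturated_exp_power[OF saturated_exp_loc]] by metis
  qed
  then have "\<gamma>0 + single j (K - 1) \<in> symbolic_exponents E n" by (simp add: symbolic_exponents_def)
  moreover have "\<gamma> = \<gamma>0 + single j (K - 1) + single j 1"
    unfolding g0 K by (simp add: add.assoc flip: single_add)
  ultimately show "\<exists>\<gamma>'\<in>symbolic_exponents E n. \<gamma> = \<gamma>' + single j 1" by blast
qed

section \<open>Rounding points of the Newton polyhedra\<close>

lemma exponent_vector_nth [simp]: "vec_nth (exponent_vector \<alpha>) x = real (lookup \<alpha> x)"
  by (simp add: exponent_vector_def)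

text \<open>\<open>y\<close> is the average of the summands from \<open>F\<close>. Only an
  inequality holds, because the last summand in \<open>exp_power\<close> is arbitrary.\<close>

lemma exp_power_hull:
  fixes F :: "('x::finite \<Rightarrow>\<^sub>0 nat) set"
  shows "\<alpha> \<in> exp_power F (Suc n) \<Longrightarrow> \<exists>y\<in>convex hull (exponent_vector ` F). exponent_vector \<alpha> \<in> {z. \<forall>x. vec_nth z x \<ge> real (Suc n) * vec_nth y x}"
proof (induction n arbitrary: \<alpha>)
  case 0
  then obtain a b where "\<alpha> = a + b" "a \<in> F" by auto
  then show ?case by (intro bexI[of _ "exponent_vector a"]) (auto intro: hull_inc simp: lookup_add)
next
  case (Suc n)
  then obtain a b where ab: "\<alpha> = a + b" "a \<in> F" "b \<in> exp_power F (Suc n)" using exp_power.simps(2)[of F "Suc n"] by blast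
  obtain y where y: "y \<in> convex hull (exponent_vector ` F)" "\<And>x. real (Suc n) * vec_nth y x \<le> real (lookup b x)"
    using Suc.IH[OF ab(3)] by auto
  \<comment> \<open>The weight of the new summand \<open>a\<close> in the average of
    \<open>n + 2\<close> summands.\<close>
  define t where "t = 1 / real (Suc (Suc n))"
  have t: "0 \<le> t" "t \<le> 1" "real (Suc (Suc n)) * t = 1" "real (Suc (Suc n)) * (1 - t) = real (Suc n)" by (auto simp: t_def field_simps)
  define z where "z = (1 - t) *\<^sub>R y + t *\<^sub>R exponent_vector a"
  have "z \<in> convex hull (exponent_vector ` F)"
    unfolding z_def using y(1) ab(2) t by (intro convexD_alt convex_convex_hull) (auto intro: hull_inc)
  moreover have "real (Suc (Suc n)) * vec_nth z x \<le> real (lookup \<alpha> x)" for x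
  proof -
    have "real (Suc (Suc n)) * vec_nth z x = (real (Suc (Suc n)) * (1 - t)) * vec_nth y x + (real (Suc (Suc n)) * t) * real (lookup a x)"
      unfolding z_def by (simp only: vector_add_component vector_scaleR_component exponent_vector_nth) (simp add: algebra_simps)
    then show ?thesis unfolding t(3,4) using y(2)[of x] by (simp add: ab(1) lookup_add)
  qed
  ultimately show ?case by auto
qed

text \<open>Caratheodory bounds the number of exponents by the dimension plus one, so that the
  rounding loss in \<open>exp_power_floor\<close> depends neither on \<open>n\<close> nor on
  \<open>y\<close>.\<close>

lemma hull_combination:
  fixes F :: "('x::finite \<Rightarrow>\<^sub>0 nat) set"
  assumes "y \<in> convex hull (exponent_vector ` F)"
  obtains s u where "finite s" "s \<subseteq> F" "card s \<le> CARD('x) + 1" "\<forall>\<alpha>\<in>s. 0 \<le> u \<alpha>" "sum u s = 1"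
    "\<forall>x. vec_nth y x = (\<Sum>\<alpha>\<in>s. u \<alpha> * real (lookup \<alpha> x))"
proof -
  have inj: "inj_on exponent_vector F"
    by (rule inj_onI, rule poly_mapping_eqI) (metis exponent_vector_nth of_nat_eq_iff)
  obtain S where S: "finite S" "S \<subseteq> exponent_vector ` F" "card S \<le> CARD('x) + 1" "y \<in> convex hull S"
    using assms unfolding caratheodory[of "exponent_vector ` F"] by auto
  obtain w where w: "\<forall>v\<in>S. 0 \<le> w v" "sum w S = 1" "(\<Sum>v\<in>S. w v *\<^sub>R v) = y"
    using S(4) unfolding convex_hull_finite[OF S(1)] by blast
  obtain s where s: "s \<subseteq> F" "S = exponent_vector ` s" using S(2) by (meson subset_imageE)
  have inj': "inj_on exponent_vector s" using inj s(1) inj_on_subset by blast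
  have fin: "finite s" using S(1) inj' unfolding s(2) by (rule finite_imageD)
  have "vec_nth y x = (\<Sum>\<alpha>\<in>s. w (exponent_vector \<alpha>) * real (lookup \<alpha> x))" for x
    unfolding w(3)[symmetric] s(2) by (simp add: sum.reindex[OF inj'] o_def)
  then show thesis
    using that[of s "w \<circ> exponent_vector"] fin s(1) w(1,2) S(3) s(2) by (simp add: sum.reindex[OF inj'] card_image[OF inj'] o_def)
qed

text \<open>Rounding \<open>n * u \<alpha>\<close> down loses at most one factor for each of the at
  most \<open>CARD('x) + 1\<close> exponents; truncated subtraction covers small
  \<open>n\<close>.\<close>

lemma exp_power_floor:
  fixes F :: "('x::finite \<Rightarrow>\<^sub>0 nat) set"
  assumes y: "y \<in> convex hull (exponent_vector ` F)" and b: "\<And>x. real n * vec_nth y x \<le> real (lookup \<beta> x)"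
  shows "\<beta> \<in> exp_power F (n - (CARD('x) + 1))"
proof -
  obtain s u where s: "finite s" "s \<subseteq> F" "card s \<le> CARD('x) + 1" "\<forall>\<alpha>\<in>s. 0 \<le> u \<alpha>" "sum u s = 1"
    "\<forall>x. vec_nth y x = (\<Sum>\<alpha>\<in>s. u \<alpha> * real (lookup \<alpha> x))"
    using hull_combination[OF y] .
  define k where "k \<alpha> = nat \<lfloor>real n * u \<alpha>\<rfloor>" for \<alpha>
  have k: "real (k \<alpha>) \<le> real n * u \<alpha>" "real n * u \<alpha> \<le> real (k \<alpha>) + 1" if "\<alpha> \<in> s" for \<alpha>
    using s(4) that by (auto simp: k_def)
  define g where "g = (\<Sum>\<alpha>\<in>s. \<Sum>i<k \<alpha>. \<alpha>)"
  have g: "g \<in> exp_power F (sum k s)"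
    unfolding g_def using s(1,2) by (intro exp_power_sum exp_power_multiple) auto
  have "real n = (\<Sum>\<alpha>\<in>s. real n * u \<alpha>)" using s(5) by (simp flip: sum_distrib_left)
  also have "\<dots> \<le> (\<Sum>\<alpha>\<in>s. real (k \<alpha>) + 1)" using k by (intro sum_mono)
  also have "\<dots> = real (sum k s + card s)" by (simp add: sum.distrib)
  finally have "n - (CARD('x) + 1) \<le> sum k s" using s(3) by linarith
  then have "g \<in> exp_power F (n - (CARD('x) + 1))" using g exp_power_antimono by blast
  moreover have "g \<preceq> \<beta>" unfolding exp_le_def
  proof
    fix x
    have "real (lookup g x) = (\<Sum>\<alpha>\<in>s. real (k \<alpha>) * real (lookup \<alpha> x))"
      by (simp add: g_def lookup_sum)
    also have "\<dots> \<le> (\<Sum>\<alpha>\<in>s. (real n * u \<alpha>) * real (lookup \<alpha> x))"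
      using k by (intro sum_mono mult_right_mono) auto
    also have "\<dots> = real n * vec_nth y x" using s(6) by (simp add: sum_distrib_left mult.assoc)
    also have "\<dots> \<le> real (lookup \<beta> x)" by (rule b)
    finally show "lookup g x \<le> lookup \<beta> x" by simp
  qed
  ultimately show ?thesis using up_closed_le[OF up_closed_exp_power] by blast
qed

text \<open>Rounding up keeps all \<open>n\<close> factors and adds each exponent of the combination
  at most once, which \<open>M\<close> pays for independently of \<open>n\<close>.\<close>

lemma exp_power_ceiling:
  fixes F :: "('x::finite \<Rightarrow>\<^sub>0 nat) set"
  assumes y: "y \<in> convex hull (exponent_vector ` F)"
  shows "\<exists>M\<ge>0. \<forall>n. \<exists>\<beta>\<in>exp_power F n. \<forall>x. real (lookup \<beta> x) \<le> real n * vec_nth y x + M"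
proof -
  obtain s u where s: "finite s" "s \<subseteq> F" "card s \<le> CARD('x) + 1" "\<forall>\<alpha>\<in>s. 0 \<le> u \<alpha>" "sum u s = 1"
    "\<forall>x. vec_nth y x = (\<Sum>\<alpha>\<in>s. u \<alpha> * real (lookup \<alpha> x))"
    using hull_combination[OF y] .
  define M where "M = (\<Sum>\<alpha>\<in>s. real (mdeg \<alpha>))"
  have "\<exists>\<beta>\<in>exp_power F n. \<forall>x. real (lookup \<beta> x) \<le> real n * vec_nth y x + M" for n
  proof -
    define k where "k \<alpha> = nat \<lceil>real n * u \<alpha>\<rceil>" for \<alpha>
    have k: "real n * u \<alpha> \<le> real (k \<alpha>)" "real (k \<alpha>) \<le> real n * u \<alpha> + 1" if "\<alpha> \<in> s" for \<alpha>
    proof -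
      have "0 \<le> real n * u \<alpha>" using s(4) that by simp
      then show "real n * u \<alpha> \<le> real (k \<alpha>)" "real (k \<alpha>) \<le> real n * u \<alpha> + 1" by (simp_all add: k_def)
    qed
    define g where "g = (\<Sum>\<alpha>\<in>s. \<Sum>i<k \<alpha>. \<alpha>)"
    have g: "g \<in> exp_power F (sum k s)"
      unfolding g_def using s(1,2) by (intro exp_power_sum exp_power_multiple) auto
    have "real n = (\<Sum>\<alpha>\<in>s. real n * u \<alpha>)" using s(5) by (simp flip: sum_distrib_left)
    also have "\<dots> \<le> (\<Sum>\<alpha>\<in>s. real (k \<alpha>))" using k by (intro sum_mono)
    finally have "n \<le> sum k s" by (simp flip: of_nat_sum)
    then have "g \<in> exp_power F n" using g exp_power_antimono by blast
    moreover have "real (lookup g x) \<le> real n * vec_nth y x + M" for x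
    proof -
      have "lookup \<alpha> x \<le> mdeg \<alpha>" for \<alpha> :: "'x \<Rightarrow>\<^sub>0 nat" unfolding mdeg_def by (rule member_le_sum) auto
      then have M: "(\<Sum>\<alpha>\<in>s. real (lookup \<alpha> x)) \<le> M" unfolding M_def by (intro sum_mono) simp
      have "real (lookup g x) = (\<Sum>\<alpha>\<in>s. real (k \<alpha>) * real (lookup \<alpha> x))"
        by (simp add: g_def lookup_sum)
      also have "\<dots> \<le> (\<Sum>\<alpha>\<in>s. (real n * u \<alpha> + 1) * real (lookup \<alpha> x))"
        using k by (intro sum_mono mult_right_mono) auto
      also have "\<dots> = real n * vec_nth y x + (\<Sum>\<alpha>\<in>s. real (lookup \<alpha> x))"
        using s(6) by (simp add: sum_distrib_left mult.assoc distrib_right sum.distrib)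
      finally show ?thesis using M by linarith
    qed
    ultimately show ?thesis by blast
  qed
  moreover have "M \<ge> 0" by (simp add: M_def sum_nonneg)
  ultimately show ?thesis by blast
qed

definition exp_polyhedron :: "('x::finite \<Rightarrow>\<^sub>0 nat) set \<Rightarrow> (real ^ 'x) set" where
  "exp_polyhedron E = (\<Inter>T\<in>minimal_covers E. convex hull (exponent_vector ` exp_loc T E))"

text \<open>The room at \<open>j\<close> consists of the \<open>K\<close> copies to be removed and
  of \<open>CARD('x) + 1\<close> powers \<open>single j p\<close>, which replace the factors lost in
  \<open>exp_power_floor\<close> at primes containing \<open>j\<close>. At the other primes, copies
  of \<open>j\<close> cancel.\<close>

lemma symbolic_exponents_removable:
  fixes E :: "('x::finite \<Rightarrow>\<^sub>0 nat) set"
  assumes p: "common_exponent E p" and c: "c \<in> exp_polyhedron E" and a: "\<alpha> \<in> symbolic_exponents E n"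
    and le: "\<And>x. real n * vec_nth c x \<le> real (lookup \<alpha> x)"
    and j: "real n * vec_nth c j + real ((CARD('x) + 1) * p + K) \<le> real (lookup \<alpha> j)" and cj: "vec_nth c j \<ge> 0"
  shows "\<exists>\<alpha>'\<in>symbolic_exponents E n. \<alpha> = \<alpha>' + single j K"
proof -
  let ?N = "CARD('x) + 1"
  have "0 \<le> real n * vec_nth c j" using cj by simp
  then have "real (?N * p + K) \<le> real (lookup \<alpha> j)" using j by linarith
  then have big: "?N * p + K \<le> lookup \<alpha> j" by (simp only: of_nat_le_iff)
  define \<beta> where "\<beta> = \<alpha> - single j (?N * p + K)"
  have ab: "\<alpha> = \<beta> + single j (?N * p) + single j K"
    using big by (intro poly_mapping_eqI) (auto simp: \<beta>_def lookup_add lookup_minus lookup_single when_def)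
  have \<beta>: "real n * vec_nth c x \<le> real (lookup \<beta> x)" for x
    using le[of x] j big by (cases "x = j") (auto simp: \<beta>_def lookup_minus lookup_single when_def of_nat_diff)
  have "\<beta> + single j (?N * p) \<in> exp_power (exp_loc T E) n" if T: "T \<in> minimal_covers E" for T
  proof (cases "j \<in> T")
    case True
    then have "single j p \<in> exp_loc T E" using p T by (simp add: common_exponent_def)
    then have "(\<Sum>i<?N. single j p) \<in> exp_power (exp_loc T E) ?N" by (rule exp_power_multiple)
    moreover have "(\<Sum>i<?N. single j p) = single j (?N * p)"
      by (rule poly_mapping_eqI) (simp add: lookup_sum lookup_single when_def lookup_add)
    moreover have "\<beta> \<in> exp_power (exp_loc T E) (n - ?N)"
      using c T by (intro exp_power_floor[OF _ \<beta>]) (simp add: exp_polyhedron_def)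
    ultimately have "\<beta> + single j (?N * p) \<in> exp_power (exp_loc T E) (n - ?N + ?N)"
      using exp_power_add by metis
    moreover have "n \<le> n - ?N + ?N" by linarith
    ultimately show ?thesis using exp_power_antimono by blast
  next
    case False
    then have "avoids T (single j K)" by (auto simp: avoids_def lookup_single when_def)
    moreover have "\<alpha> \<in> exp_power (exp_loc T E) n" using a T by (auto simp: symbolic_exponents_def)
    ultimately show ?thesis
      using saturatedD[OF saturated_exp_power[OF saturated_exp_loc]] ab by metis
  qed
  then show ?thesis using ab unfolding symbolic_exponents_def by blast
qed

text \<open>All components must share one exponent. With \<open>M\<close> the sum of their
  constants, rounding \<open>n * v + M\<close> down entry by entry dominates the exponent found for
  each component.\<close>

lemma symbolic_exponents_near:
  fixes E :: "('x::finite \<Rightarrow>\<^sub>0 nat) set"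
  assumes v: "v \<in> exp_polyhedron E" and v0: "\<And>x. vec_nth v x \<ge> 0"
  shows "\<exists>M\<ge>0. \<forall>n. \<exists>\<beta>\<in>symbolic_exponents E n. \<forall>x. real (lookup \<beta> x) \<le> real n * vec_nth v x + M"
proof -
  have "\<forall>T\<in>minimal_covers E. \<exists>M\<ge>0. \<forall>n. \<exists>\<beta>\<in>exp_power (exp_loc T E) n. \<forall>x. real (lookup \<beta> x) \<le> real n * vec_nth v x + M"
    using v exp_power_ceiling unfolding exp_polyhedron_def by blast
  from bchoice[OF this] obtain m where m: "\<forall>T\<in>minimal_covers E. m T \<ge> 0 \<and> (\<forall>n. \<exists>\<beta>\<in>exp_power (exp_loc T E) n.
    \<forall>x. real (lookup \<beta> x) \<le> real n * vec_nth v x + m T)" ..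
  define M where "M = (\<Sum>T\<in>minimal_covers E. m T)"
  have mM: "m T \<le> M" if "T \<in> minimal_covers E" for T
    unfolding M_def using m that by (intro member_le_sum) auto
  have M0: "M \<ge> 0" unfolding M_def using m by (intro sum_nonneg) auto
  have "\<exists>\<beta>\<in>symbolic_exponents E n. \<forall>x. real (lookup \<beta> x) \<le> real n * vec_nth v x + M" for n
  proof -
    define \<beta> where "\<beta> = exp_of (\<lambda>x. nat \<lfloor>real n * vec_nth v x + M\<rfloor>)"
    have "\<beta> \<in> exp_power (exp_loc T E) n" if T: "T \<in> minimal_covers E" for T
    proof -
      obtain b where b: "b \<in> exp_power (exp_loc T E) n" "\<forall>x. real (lookup b x) \<le> real n * vec_nth v x + m T"
        using m T by blast
      have "lookup b x \<le> lookup \<beta> x" for x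
      proof -
        have "real (lookup b x) \<le> real n * vec_nth v x + M" using b(2) mM[OF T] by (meson add_left_mono order_trans)
        then show ?thesis unfolding \<beta>_def lookup_exp_of by (simp add: le_nat_floor)
      qed
      then show ?thesis using up_closed_le[OF up_closed_exp_power b(1)] by (simp add: exp_le_def)
    qed
    then have "\<beta> \<in> symbolic_exponents E n" by (simp add: symbolic_exponents_def)
    moreover have "real (lookup \<beta> x) \<le> real n * vec_nth v x + M" for x
      using v0[of x] M0 by (simp add: \<beta>_def)
    ultimately show ?thesis by blast
  qed
  then show ?thesis using M0 by blast
qed

section \<open>The symbolic polyhedron\<close>

definition coord_sum :: "(real ^ 'x::finite) \<Rightarrow> real" where
  "coord_sum v = (\<Sum>x\<in>UNIV. vec_nth v x)"

lemma linear_coord_sum: "linear coord_sum"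
  by (rule linearI) (simp_all add: coord_sum_def sum.distrib sum_distrib_left)

text \<open>The admissible \<open>t\<close> form a compact set, since coordinate \<open>x\<close>
  must stay nonnegative. The largest one works: beyond a relative interior point a longer step would
  be possible.\<close>

lemma exit_point:
  fixes S :: "(real ^ 'x::finite) set"
  assumes S: "convex S" "closed S" "\<And>z x. z \<in> S \<Longrightarrow> 0 \<le> vec_nth z x"
    and y: "y \<in> S" and t0: "0 < t0" "y + t0 *\<^sub>R d \<in> S" and d: "vec_nth d x < 0"
  obtains t where "0 < t" "y + t *\<^sub>R d \<in> S" "y + t *\<^sub>R d \<notin> rel_interior S"
proof -
  define A where "A = {t. 0 \<le> t \<and> y + t *\<^sub>R d \<in> S}"
  have "closed ((\<lambda>t. y + t *\<^sub>R d) -` S)"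
    by (rule continuous_closed_vimage[OF S(2)]) (intro continuous_intros)
  moreover have "A = {0..} \<inter> ((\<lambda>t. y + t *\<^sub>R d) -` S)" by (auto simp: A_def)
  ultimately have "closed A" by (simp add: closed_Int)
  moreover have "t \<le> vec_nth y x / - vec_nth d x" if "t \<in> A" for t
    using S(3)[of "y + t *\<^sub>R d" x] that d by (simp add: A_def field_simps)
  then have "A \<subseteq> {0..vec_nth y x / - vec_nth d x}" by (auto simp: A_def)
  then have "bounded A" using bounded_closed_interval bounded_subset by blast
  ultimately have "compact A" by (simp add: compact_eq_bounded_closed)
  moreover have "t0 \<in> A" using t0 by (simp add: A_def)
  ultimately obtain t where t: "t \<in> A" "\<And>s. s \<in> A \<Longrightarrow> s \<le> t"
    using compact_attains_sup[of A] by blast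
  have "0 < t" using t(2)[OF \<open>t0 \<in> A\<close>] t0 by simp
  moreover have "y + t *\<^sub>R d \<notin> rel_interior S"
  proof
    assume "y + t *\<^sub>R d \<in> rel_interior S"
    then obtain e where e: "e > 1" "(1 - e) *\<^sub>R y + e *\<^sub>R (y + t *\<^sub>R d) \<in> S"
      using convex_rel_interior_iff[OF S(1), of "y + t *\<^sub>R d"] y by blast
    have "(1 - e) *\<^sub>R y + e *\<^sub>R (y + t *\<^sub>R d) = y + (e * t) *\<^sub>R d" by (simp add: algebra_simps)
    then have "e * t \<in> A" using e \<open>0 < t\<close> by (simp add: A_def)
    then have "e * t \<le> t" by (rule t(2))
    then show False using e(1) \<open>0 < t\<close> by simp
  qed
  ultimately show thesis using that t(1) by (auto simp: A_def)
qed

text \<open>For a relative interior point, the exit points of a line through it lie on proper faces, which have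
  smaller dimension; a ray that does not exit has a nonnegative direction.\<close>

lemma above_hull_of_extreme_points:
  fixes S :: "(real ^ 'x::finite) set"
  assumes "convex S" "closed S" "\<And>z x. z \<in> S \<Longrightarrow> 0 \<le> vec_nth z x" "y \<in> S"
  shows "\<exists>c\<in>convex hull {v. v extreme_point_of S}. \<forall>x. vec_nth c x \<le> vec_nth y x"
  using assms
proof (induction "nat (aff_dim S + 1)" arbitrary: S y rule: less_induct)
  case less
  note S = less.prems(1-3)
  \<comment> \<open>A supporting hyperplane cuts out a proper face through \<open>q\<close>. The
    induction on the dimension applies to it, and its extreme points are extreme in
    \<open>S\<close>.\<close>
  have boundary: "\<exists>c\<in>convex hull {v. v extreme_point_of S}. \<forall>x. vec_nth c x \<le> vec_nth q x"
    if q: "q \<in> S" "q \<notin> rel_interior S" for q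
  proof -
    obtain a where a: "a \<noteq> 0" "\<And>y. y \<in> S \<Longrightarrow> a \<bullet> q \<le> a \<bullet> y" "\<And>y. y \<in> rel_interior S \<Longrightarrow> a \<bullet> q < a \<bullet> y"
      using supporting_hyperplane_rel_boundary[OF S(1) q] by metis
    define F where "F = S \<inter> {z. a \<bullet> z = a \<bullet> q}"
    have F: "F face_of S" unfolding F_def by (rule face_of_Int_supporting_hyperplane_ge[OF S(1)]) (rule a(2))
    have "rel_interior S \<noteq> {}" using rel_interior_eq_empty[OF S(1)] q by blast
    then obtain z where z: "z \<in> rel_interior S" by blast
    then have "z \<in> S" using rel_interior_subset by blast
    moreover have "z \<notin> F" using a(3)[OF z] by (simp add: F_def)
    ultimately have "F \<noteq> S" by blast
    then have lt: "aff_dim F < aff_dim S" by (rule face_of_aff_dim_lt[OF S(1) F])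
    moreover have "aff_dim F \<ge> -1" by (rule aff_dim_geq)
    ultimately have "nat (aff_dim F + 1) < nat (aff_dim S + 1)" by linarith
    moreover have "convex F" using F by (rule face_of_imp_convex)
    moreover have "closed F" using face_of_imp_closed[OF S(1,2) F] .
    moreover have "\<And>z x. z \<in> F \<Longrightarrow> 0 \<le> vec_nth z x" using S(3) by (simp add: F_def)
    moreover have "q \<in> F" using q by (simp add: F_def)
    ultimately obtain c where c: "c \<in> convex hull {v. v extreme_point_of F}" "\<forall>x. vec_nth c x \<le> vec_nth q x"
      using less.hyps[of F q] by blast
    have "{v. v extreme_point_of F} \<subseteq> {v. v extreme_point_of S}" using extreme_point_of_face[OF F] by auto
    then show ?thesis using c hull_mono by blast
  qed
  show ?case
  proof (cases "y \<in> rel_interior S")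
    case False
    then show ?thesis using boundary less.prems(4) by blast
  next
    case ri: True
    show ?thesis
    proof (cases "S = {y}")
      case True
      then have "y extreme_point_of S" by (simp add: extreme_point_of_def)
      then show ?thesis by (intro bexI[of _ y]) (auto intro: hull_inc)
    next
      case False
      then obtain z0 where z0: "z0 \<in> S" "z0 \<noteq> y" using less.prems(4) by blast
      obtain e where e: "e > 1" "(1 - e) *\<^sub>R z0 + e *\<^sub>R y \<in> S"
        using ri convex_rel_interior_iff[OF S(1), of y] z0(1) by blast
      \<comment> \<open>\<open>y\<close> can be moved both ways on the line through
        \<open>z0\<close>; the direction is oriented to have a negative coordinate, as
        \<open>exit_point\<close> requires.\<close>
      have two: "\<exists>d t t'. d \<noteq> 0 \<and> 0 < t \<and> 0 < t' \<and> y + t *\<^sub>R d \<in> S \<and> y + t' *\<^sub>R (- d) \<in> S \<and> (\<exists>x. vec_nth d x < 0)"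
      proof -
        have p1: "y + 1 *\<^sub>R (z0 - y) \<in> S" "y + 1 *\<^sub>R (- (y - z0)) \<in> S" using z0 by simp_all
        have "(1 - e) *\<^sub>R z0 + e *\<^sub>R y = y + (e - 1) *\<^sub>R (y - z0)" by (simp add: algebra_simps)
        then have p2: "y + (e - 1) *\<^sub>R (- (z0 - y)) \<in> S" "y + (e - 1) *\<^sub>R (y - z0) \<in> S" using e(2) by simp_all
        obtain x where "vec_nth (z0 - y) x \<noteq> 0" using z0(2) by (metis eq_iff_diff_eq_0 Finite_Cartesian_Product.vec_eq_iff zero_index)
        then consider "vec_nth (z0 - y) x < 0" | "vec_nth (y - z0) x < 0" by (auto simp: neq_iff)
        then show ?thesis
        proof cases
          case 1
          then show ?thesis using p1(1) p2(1) e(1) z0(2)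
            by (intro exI[of _ "z0 - y"] exI[of _ 1] exI[of _ "e - 1"]) auto
        next
          case 2
          then show ?thesis using p1(2) p2(2) e(1) z0(2)
            by (intro exI[of _ "y - z0"] exI[of _ "e - 1"] exI[of _ 1]) auto
        qed
      qed
      then obtain d t0 t1 x where d: "0 < t0" "0 < t1" "y + t0 *\<^sub>R d \<in> S" "y + t1 *\<^sub>R (- d) \<in> S" "vec_nth d x < 0"
        by blast
      obtain t where t: "0 < t" "y + t *\<^sub>R d \<in> S" "y + t *\<^sub>R d \<notin> rel_interior S"
        using exit_point[OF S less.prems(4) d(1,3,5)] by blast
      obtain c where c: "c \<in> convex hull {v. v extreme_point_of S}" "\<forall>x. vec_nth c x \<le> vec_nth (y + t *\<^sub>R d) x"
        using boundary[OF t(2,3)] by blast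
      show ?thesis
      proof (cases "\<exists>x. vec_nth (- d) x < 0")
        case False
        \<comment> \<open>Here \<open>d\<close> is nonpositive, so a point below the exit point is
          already below \<open>y\<close>.\<close>
        have "vec_nth c x \<le> vec_nth y x" for x
        proof -
          have "vec_nth d x \<le> 0" using False by (auto simp: not_less)
          then have "t * vec_nth d x \<le> 0" using t(1) by (simp add: mult_le_0_iff)
          then show ?thesis using c(2)[rule_format, of x] by simp
        qed
        then show ?thesis using c(1) by blast
      next
        case True
        then obtain x' where x': "vec_nth (- d) x' < 0" by blast
        obtain s where s: "0 < s" "y + s *\<^sub>R (- d) \<in> S" "y + s *\<^sub>R (- d) \<notin> rel_interior S"
          using exit_point[OF S less.prems(4) d(2,4) x'] by blast
        obtain c' where c': "c' \<in> convex hull {v. v extreme_point_of S}" "\<forall>x. vec_nth c' x \<le> vec_nth (y + s *\<^sub>R (- d)) x"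
          using boundary[OF s(2,3)] by blast
        \<comment> \<open>The weight at which the displacements \<open>t\<close> and
          \<open>-s\<close> along \<open>d\<close> cancel.\<close>
        define u where "u = t / (s + t)"
        have u: "0 \<le> u" "u \<le> 1" "(1 - u) * t - u * s = 0" using s(1) t(1) by (auto simp: u_def field_simps)
        have "(1 - u) *\<^sub>R c + u *\<^sub>R c' \<in> convex hull {v. v extreme_point_of S}"
          using c(1) c'(1) u by (intro convexD_alt convex_convex_hull)
        moreover have "vec_nth ((1 - u) *\<^sub>R c + u *\<^sub>R c') x \<le> vec_nth y x" for x
        proof -
          have "(1 - u) * vec_nth c x \<le> (1 - u) * (vec_nth y x + t * vec_nth d x)"
            using c(2)[rule_format, of x] u by (intro mult_left_mono) auto
          moreover have "u * vec_nth c' x \<le> u * (vec_nth y x - s * vec_nth d x)"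
            using c'(2)[rule_format, of x] u by (intro mult_left_mono) auto
          moreover have "(1 - u) * (vec_nth y x + t * vec_nth d x) + u * (vec_nth y x - s * vec_nth d x)
             = vec_nth y x + ((1 - u) * t - u * s) * vec_nth d x" by (simp add: algebra_simps)
          ultimately show ?thesis using u(3) by simp
        qed
        ultimately show ?thesis by blast
      qed
    qed
  qed
qed

section \<open>Newton polyhedra as polytope plus orthant\<close>

text \<open>Adding an integer multiple of a unit vector maps exponents of \<open>F\<close> into
  \<open>F\<close>, hence the hull into itself. A real step lies on the segment to such a translate,
  and a general increase is made one coordinate at a time.\<close>

lemma hull_up_closed:
  fixes F :: "('x::finite \<Rightarrow>\<^sub>0 nat) set"
  assumes F: "up_closed F" and y: "y \<in> convex hull (exponent_vector ` F)" and le: "\<And>x. vec_nth y x \<le> vec_nth z x"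
  shows "z \<in> convex hull (exponent_vector ` F)"
proof -
  let ?C = "convex hull (exponent_vector ` F)"
  have step: "u + axis x t \<in> ?C" if u: "u \<in> ?C" and t: "0 \<le> t" for u x t
  proof -
    obtain N :: nat where N: "t \<le> real N" "0 < N" using real_arch_simple[of "max t 1"] by auto
    have "(\<lambda>v. axis x (real N) + v) ` ?C = convex hull ((\<lambda>v. axis x (real N) + v) ` (exponent_vector ` F))"
      by (rule convex_hull_translation[symmetric])
    also have "\<dots> \<subseteq> ?C"
    proof (rule hull_mono, clarify)
      fix \<alpha> assume "\<alpha> \<in> F"
      then have "\<alpha> + single x N \<in> F" using F by (simp add: up_closed_def)
      moreover have "axis x (real N) + exponent_vector \<alpha> = exponent_vector (\<alpha> + single x N)"
        by (simp add: Finite_Cartesian_Product.vec_eq_iff axis_def lookup_add lookup_single when_def)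
      ultimately show "axis x (real N) + exponent_vector \<alpha> \<in> exponent_vector ` F" by blast
    qed
    finally have "axis x (real N) + u \<in> ?C" using u by blast
    then have "(1 - t / real N) *\<^sub>R u + (t / real N) *\<^sub>R (axis x (real N) + u) \<in> ?C"
      using u t N by (intro convexD_alt convex_convex_hull) auto
    moreover have "(1 - t / real N) *\<^sub>R u + (t / real N) *\<^sub>R (axis x (real N) + u) = u + axis x t"
      using N(2) by (simp add: Finite_Cartesian_Product.vec_eq_iff axis_def algebra_simps)
    ultimately show ?thesis by simp
  qed
  have "y + (\<Sum>x\<in>A. axis x (vec_nth z x - vec_nth y x)) \<in> ?C" for A
  proof (induction A rule: finite_induct[OF finite])
    case (2 x A)
    then show ?case using step[of "y + (\<Sum>x\<in>A. axis x (vec_nth z x - vec_nth y x))" "vec_nth z x - vec_nth y x" x] le[of x]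
      by (simp add: ac_simps)
  qed (use y in simp)
  moreover have "y + (\<Sum>x\<in>UNIV. axis x (vec_nth z x - vec_nth y x)) = z"
    by (simp add: Finite_Cartesian_Product.vec_eq_iff axis_def if_distrib[of "\<lambda>f. f _"] cong: if_cong)
  ultimately show ?thesis by metis
qed

lemma hull_finite_description:
  fixes F :: "('x::finite \<Rightarrow>\<^sub>0 nat) set"
  assumes F: "up_closed F"
  obtains G where "finite G" "G \<subseteq> F"
    "convex hull (exponent_vector ` F) = {z. \<exists>c\<in>convex hull (exponent_vector ` G). \<forall>x. vec_nth c x \<le> vec_nth z x}"
proof -
  obtain G where G: "G \<subseteq> F" "finite G" "\<forall>\<alpha>\<in>F. \<exists>\<beta>\<in>G. \<beta> \<preceq> \<alpha>" using dickson[of F] by blast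
  let ?R = "{z. \<exists>c\<in>convex hull (exponent_vector ` G). \<forall>x. vec_nth c x \<le> vec_nth z x}"
  have "exponent_vector ` F \<subseteq> ?R"
  proof clarify
    fix \<alpha> assume "\<alpha> \<in> F"
    then obtain \<beta> where "\<beta> \<in> G" "\<beta> \<preceq> \<alpha>" using G(3) by blast
    then show "\<exists>c\<in>convex hull exponent_vector ` G. \<forall>x. vec_nth c x \<le> vec_nth (exponent_vector \<alpha>) x"
      by (intro bexI[of _ "exponent_vector \<beta>"]) (auto simp: exp_le_def intro: hull_inc)
  qed
  moreover have "convex ?R"
  proof (rule convexI)
    fix z z' u v assume z: "z \<in> ?R" "z' \<in> ?R" and uv: "0 \<le> u" "0 \<le> v" "u + v = (1::real)"
    obtain c c' where c: "c \<in> convex hull (exponent_vector ` G)" "\<forall>x. vec_nth c x \<le> vec_nth z x"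
      "c' \<in> convex hull (exponent_vector ` G)" "\<forall>x. vec_nth c' x \<le> vec_nth z' x" using z by blast
    have "u *\<^sub>R c + v *\<^sub>R c' \<in> convex hull (exponent_vector ` G)" using c uv by (intro convexD[OF convex_convex_hull])
    moreover have "\<forall>x. vec_nth (u *\<^sub>R c + v *\<^sub>R c') x \<le> vec_nth (u *\<^sub>R z + v *\<^sub>R z') x"
      using c uv by (auto intro!: add_mono mult_left_mono)
    ultimately show "u *\<^sub>R z + v *\<^sub>R z' \<in> ?R" by blast
  qed
  ultimately have "convex hull (exponent_vector ` F) \<subseteq> ?R" by (rule hull_minimal)
  moreover have "?R \<subseteq> convex hull (exponent_vector ` F)"
  proof
    fix z assume "z \<in> ?R"
    then obtain c where c: "c \<in> convex hull (exponent_vector ` G)" "\<forall>x. vec_nth c x \<le> vec_nth z x" by blast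
    have "convex hull (exponent_vector ` G) \<subseteq> convex hull (exponent_vector ` F)" using G(1) by (intro hull_mono image_mono)
    then show "z \<in> convex hull (exponent_vector ` F)" using hull_up_closed[OF F] c by blast
  qed
  ultimately show thesis using that G by blast
qed

text \<open>The hull of an infinite set may fail to be closed; this one is a compact hull of
  finitely many generators plus the closed orthant.\<close>

lemma closed_exponent_hull:
  fixes F :: "('x::finite \<Rightarrow>\<^sub>0 nat) set"
  assumes F: "up_closed F"
  shows "closed (convex hull (exponent_vector ` F))"
proof -
  obtain G where G: "finite G" "convex hull (exponent_vector ` F) =
      {z. \<exists>c\<in>convex hull (exponent_vector ` G). \<forall>x. vec_nth c x \<le> vec_nth z x}"
    by (rule hull_finite_description[OF F])
  let ?K = "convex hull (exponent_vector ` G)" and ?O = "{w :: real ^ 'x. \<forall>x. 0 \<le> vec_nth w x}"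
  have "compact ?K" using G(1) by (simp add: finite_imp_compact_convex_hull)
  moreover have "closed ?O" unfolding Collect_all_eq by (intro closed_INT ballI closed_Collect_le continuous_intros)
  ultimately have "closed (\<Union>c\<in>?K. \<Union>w\<in>?O. {c + w})" by (rule compact_closed_sums)
  moreover have "(\<Union>c\<in>?K. \<Union>w\<in>?O. {c + w}) = {z. \<exists>c\<in>?K. \<forall>x. vec_nth c x \<le> vec_nth z x}"
  proof (intro equalityI subsetI)
    fix z assume "z \<in> (\<Union>c\<in>?K. \<Union>w\<in>?O. {c + w})"
    then obtain c w where "c \<in> ?K" "\<forall>x. 0 \<le> vec_nth w x" "z = c + w" by blast
    then show "z \<in> {z. \<exists>c\<in>?K. \<forall>x. vec_nth c x \<le> vec_nth z x}" by (auto intro!: bexI[of _ c])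
  next
    fix z assume "z \<in> {z. \<exists>c\<in>?K. \<forall>x. vec_nth c x \<le> vec_nth z x}"
    then obtain c where "c \<in> ?K" "z - c \<in> ?O" by auto
    then show "z \<in> (\<Union>c\<in>?K. \<Union>w\<in>?O. {c + w})" by (intro UN_I[of c] UN_I[of "z - c"]) auto
  qed
  ultimately show ?thesis using G(2) by simp
qed

lemma exp_polyhedron_basic:
  fixes E :: "('x::finite \<Rightarrow>\<^sub>0 nat) set"
  assumes E: "up_closed E" "E \<noteq> {}" "0 \<notin> E"
  shows "convex (exp_polyhedron E)" "closed (exp_polyhedron E)" "exp_polyhedron E \<noteq> {}"
    "z \<in> exp_polyhedron E \<Longrightarrow> 0 \<le> vec_nth z x"
    "y \<in> exp_polyhedron E \<Longrightarrow> (\<And>x. vec_nth y x \<le> vec_nth z x) \<Longrightarrow> z \<in> exp_polyhedron E"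
proof -
  show "convex (exp_polyhedron E)" unfolding exp_polyhedron_def by (intro convex_INT convex_convex_hull)
  show "closed (exp_polyhedron E)" unfolding exp_polyhedron_def
    by (intro closed_INT ballI closed_exponent_hull up_closed_exp_loc E(1))
  obtain e where "e \<in> E" using E(2) by blast
  then have "exponent_vector e \<in> exp_polyhedron E"
    unfolding exp_polyhedron_def using exp_loc_superset by (auto intro!: hull_inc)
  then show "exp_polyhedron E \<noteq> {}" by blast
  show "0 \<le> vec_nth z x" if "z \<in> exp_polyhedron E"
  proof -
    obtain T where "T \<in> minimal_covers E" using minimal_cover_exists[OF E(3)] by blast
    then have "z \<in> convex hull (exponent_vector ` exp_loc T E)" using that by (simp add: exp_polyhedron_def)
    moreover have "convex hull (exponent_vector ` exp_loc T E) \<subseteq> {w. 0 \<le> vec_nth w x}"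
      by (rule hull_minimal) (auto simp: convex_def)
    ultimately show ?thesis by blast
  qed
  show "z \<in> exp_polyhedron E" if "y \<in> exp_polyhedron E" "\<And>x. vec_nth y x \<le> vec_nth z x"
    using that hull_up_closed[OF up_closed_exp_loc[OF E(1)]] unfolding exp_polyhedron_def by blast
qed

text \<open>An entry of an extreme point cannot exceed all entries of the generators, so it suffices to look at
  the bounded polyhedron cut out by a large box.\<close>

lemma finite_extreme_points:
  fixes E :: "('x::finite \<Rightarrow>\<^sub>0 nat) set"
  assumes E: "up_closed E" "E \<noteq> {}" "0 \<notin> E"
  shows "finite {v. v extreme_point_of exp_polyhedron E}"
proof -
  let ?P = "exp_polyhedron E"
  let ?H = "\<lambda>T. convex hull (exponent_vector ` exp_loc T E)"
  note P = exp_polyhedron_basic[OF E]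
  have "\<exists>G. finite G \<and> ?H T = {z. \<exists>c\<in>convex hull (exponent_vector ` G). \<forall>x. vec_nth c x \<le> vec_nth z x}" for T
    by (rule hull_finite_description[OF up_closed_exp_loc[OF E(1), of T]]) (intro exI conjI)
  then have "\<forall>T. \<exists>G. finite G \<and> ?H T = {z. \<exists>c\<in>convex hull (exponent_vector ` G). \<forall>x. vec_nth c x \<le> vec_nth z x}" ..
  from choice[OF this] obtain G where
    GG: "\<forall>T. finite (G T) \<and> ?H T = {z. \<exists>c\<in>convex hull (exponent_vector ` G T). \<forall>x. vec_nth c x \<le> vec_nth z x}" ..
  have G: "finite (G T)" "?H T = {z. \<exists>c\<in>convex hull (exponent_vector ` G T). \<forall>x. vec_nth c x \<le> vec_nth z x}" for T
    using GG by simp_all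
  \<comment> \<open>Bounds every entry of every generator, for all sets \<open>T\<close> at
    once.\<close>
  define B where "B = real (\<Sum>T\<in>UNIV. \<Sum>\<alpha>\<in>G T. mdeg \<alpha>)"
  define C :: "(real ^ 'x) set" where "C = cbox 0 (\<chi> x. B)"
  have GB: "convex hull (exponent_vector ` G T) \<subseteq> C" for T
  proof (rule hull_minimal)
    have "real (lookup \<alpha> x) \<le> B" if "\<alpha> \<in> G T" for \<alpha> x
    proof -
      have "lookup \<alpha> x \<le> mdeg \<alpha>" unfolding mdeg_def by (rule member_le_sum) auto
      also have "\<dots> \<le> (\<Sum>\<alpha>\<in>G T. mdeg \<alpha>)" by (rule member_le_sum) (use that G in auto)
      also have "\<dots> \<le> (\<Sum>T\<in>UNIV. \<Sum>\<alpha>\<in>G T. mdeg \<alpha>)" by (rule member_le_sum[of T UNIV "\<lambda>T. \<Sum>\<alpha>\<in>G T. mdeg \<alpha>"]) auto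
      finally show ?thesis unfolding B_def by (simp only: of_nat_le_iff)
    qed
    then show "exponent_vector ` G T \<subseteq> C" by (auto simp: C_def mem_box_cart)
  qed (simp add: C_def)
  have "v \<in> C" if v: "v extreme_point_of ?P" for v
  proof -
    have vP: "v \<in> ?P" using v by (simp add: extreme_point_of_def)
    have "vec_nth v j \<le> B" for j
    proof (rule ccontr)
      assume j: "\<not> vec_nth v j \<le> B"
      \<comment> \<open>The points of the generator hulls have entries at most \<open>B\<close>, so
        lowering entry \<open>j\<close> of \<open>v\<close> to \<open>B\<close> stays in the
        polyhedron; raising it is always allowed, and \<open>v\<close> would be a midpoint.\<close>
      define a where "a = axis j (vec_nth v j - B)"
      have a: "vec_nth a x = (if x = j then vec_nth v j - B else 0)" for x by (simp add: a_def axis_def)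
      have "v - a \<in> ?H T" if "T \<in> minimal_covers E" for T
      proof -
        have "v \<in> ?H T" using vP that by (simp add: exp_polyhedron_def)
        then obtain c where c: "c \<in> convex hull (exponent_vector ` G T)" "\<forall>x. vec_nth c x \<le> vec_nth v x"
          unfolding G(2) by blast
        have "vec_nth c j \<le> B" using c(1) GB[of T] by (auto simp: C_def mem_box_cart)
        then have "\<forall>x. vec_nth c x \<le> vec_nth (v - a) x" using c(2) by (simp add: a)
        then show ?thesis unfolding G(2) using c(1) by blast
      qed
      then have "v - a \<in> ?P" by (simp add: exp_polyhedron_def)
      moreover have "v + a \<in> ?P" by (rule P(5)[OF vP]) (use j in \<open>simp add: a\<close>)
      moreover have "v - a \<noteq> v + a"
      proof
        assume "v - a = v + a"
        then have "vec_nth (v - a) j = vec_nth (v + a) j" by (rule arg_cong)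
        then show False using j by (simp add: a)
      qed
      then have "v \<in> open_segment (v - a) (v + a)"
        unfolding in_segment by (intro conjI exI[of _ "1 / 2"]) (auto simp: algebra_simps simp flip: scaleR_2)
      ultimately show False using v unfolding extreme_point_of_def by blast
    qed
    then show ?thesis using P(4)[OF vP] by (simp add: C_def mem_box_cart)
  qed
  then have "{v. v extreme_point_of ?P} \<subseteq> {v. v extreme_point_of (?P \<inter> C)}"
    by (auto simp: extreme_point_of_def)
  moreover have "polyhedron (?P \<inter> C)"
  proof -
    obtain V where V: "finite V" "C = convex hull V"
      using polytope_interval[of 0 "\<chi> x. B"] by (auto simp: polytope_def C_def)
    \<comment> \<open>Inside the box the orthant may be replaced by \<open>C\<close>, which gives a
      Minkowski sum of two polytopes.\<close>
    have "?H T \<inter> C = (convex hull (exponent_vector ` G T) + C) \<inter> C" for T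
    proof (intro equalityI subsetI)
      fix z assume z: "z \<in> ?H T \<inter> C"
      then obtain c where c: "c \<in> convex hull (exponent_vector ` G T)" "\<forall>x. vec_nth c x \<le> vec_nth z x" unfolding G(2) by blast
      have "0 \<le> vec_nth c x" for x using GB[of T] c(1) by (auto simp: C_def mem_box_cart)
      moreover have "vec_nth z x \<le> B" for x using z by (simp add: C_def mem_box_cart)
      ultimately have "vec_nth z x - vec_nth c x \<le> B" for x by (smt (verit))
      then have "z - c \<in> C" using c(2) by (simp add: C_def mem_box_cart)
      then show "z \<in> (convex hull (exponent_vector ` G T) + C) \<inter> C" using c(1) z set_plus_intro[of c _ "z - c" C] by simp
    next
      fix z assume z: "z \<in> (convex hull (exponent_vector ` G T) + C) \<inter> C"
      then obtain c w where c: "c \<in> convex hull (exponent_vector ` G T)" "w \<in> C" "z = c + w" by (auto elim: set_plus_elim)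
      then have "\<forall>x. vec_nth c x \<le> vec_nth z x" by (simp add: C_def mem_box_cart)
      then show "z \<in> ?H T \<inter> C" unfolding G(2) using c(1) z by blast
    qed
    then have "polyhedron (?H T \<inter> C)" for T
      unfolding V(2) convex_hull_set_plus[symmetric]
      by (simp add: V(1) G(1) finite_set_plus polyhedron_convex_hull)
    moreover have "polyhedron C" by (simp add: C_def)
    ultimately have "polyhedron (\<Inter> (insert C ((\<lambda>T. ?H T \<inter> C) ` minimal_covers E)))"
      by (intro polyhedron_Inter) auto
    moreover have "?P \<inter> C = \<Inter> (insert C ((\<lambda>T. ?H T \<inter> C) ` minimal_covers E))" by (auto simp: exp_polyhedron_def)
    ultimately show ?thesis by (simp only:)
  qed
  ultimately show ?thesis using finite_polyhedron_extreme_points finite_subset by blast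
qed

section \<open>Vertices and the maximal coordinate sum\<close>

definition exp_delta :: "('x::finite \<Rightarrow>\<^sub>0 nat) set \<Rightarrow> real" where
  "exp_delta E = Max {coord_sum v | v. v extreme_point_of exp_polyhedron E}"

text \<open>\<open>Max\<close> is taken over a nonempty finite set: a vertex exists because every
  point lies above the hull of the vertices.\<close>

lemma exp_delta_attained:
  fixes E :: "('x::finite \<Rightarrow>\<^sub>0 nat) set"
  assumes E: "up_closed E" "E \<noteq> {}" "0 \<notin> E"
  obtains v where "v extreme_point_of exp_polyhedron E" "coord_sum v = exp_delta E"
    "\<And>w. w extreme_point_of exp_polyhedron E \<Longrightarrow> coord_sum w \<le> exp_delta E"
proof -
  note P = exp_polyhedron_basic[OF E]
  let ?S = "{coord_sum v | v. v extreme_point_of exp_polyhedron E}"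
  have fin: "finite ?S" using finite_extreme_points[OF E] by simp
  obtain y where "y \<in> exp_polyhedron E" using P(3) by blast
  from above_hull_of_extreme_points[OF P(1,2,4) this]
  have "convex hull {v. v extreme_point_of exp_polyhedron E} \<noteq> {}" by blast
  then have "{v. v extreme_point_of exp_polyhedron E} \<noteq> {}" by (simp only: convex_hull_eq_empty) simp
  then have "?S \<noteq> {}" by blast
  then have "Max ?S \<in> ?S" by (rule Max_in[OF fin])
  then obtain v where v: "v extreme_point_of exp_polyhedron E" "coord_sum v = exp_delta E" by (auto simp: exp_delta_def)
  have "coord_sum w \<le> exp_delta E" if "w extreme_point_of exp_polyhedron E" for w
    unfolding exp_delta_def by (rule Max_ge[OF fin]) (use that in blast)
  then show thesis using that v by blast
qed

lemma exp_polyhedron_below: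
  fixes E :: "('x::finite \<Rightarrow>\<^sub>0 nat) set"
  assumes E: "up_closed E" "E \<noteq> {}" "0 \<notin> E" and y: "y \<in> exp_polyhedron E"
  shows "\<exists>c\<in>exp_polyhedron E. (\<forall>x. vec_nth c x \<le> vec_nth y x) \<and> coord_sum c \<le> exp_delta E"
proof -
  note P = exp_polyhedron_basic[OF E]
  let ?V = "{v. v extreme_point_of exp_polyhedron E}"
  obtain c where c: "c \<in> convex hull ?V" "\<forall>x. vec_nth c x \<le> vec_nth y x"
    using above_hull_of_extreme_points[OF P(1,2,4) y] by blast
  have "convex hull ?V \<subseteq> exp_polyhedron E"
    by (rule hull_minimal) (auto simp: extreme_point_of_def P(1))
  moreover have "convex hull ?V \<subseteq> {z. coord_sum z \<le> exp_delta E}"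
  proof (rule hull_minimal)
    show "?V \<subseteq> {z. coord_sum z \<le> exp_delta E}" using exp_delta_attained[OF E] by auto
    have "convex (coord_sum -` {..exp_delta E})" by (rule convex_linear_vimage[OF linear_coord_sum]) simp
    then show "convex {z. coord_sum z \<le> exp_delta E}" by (simp add: vimage_def)
  qed
  ultimately show ?thesis using c by blast
qed

text \<open>If a point of the polyhedron is \<le> \<open>v\<close>, its reflection at
  \<open>v\<close> is \<ge> \<open>v\<close>, hence also in the polyhedron, and extremality makes
  the point equal to \<open>v\<close>. Compactness turns this into an estimate with a tolerance
  \<open>h\<close>.\<close>

lemma extreme_point_rigid:
  fixes E :: "('x::finite \<Rightarrow>\<^sub>0 nat) set"
  assumes E: "up_closed E" "E \<noteq> {}" "0 \<notin> E" and v: "v extreme_point_of exp_polyhedron E" and e: "0 < e"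
  shows "\<exists>h>0. \<forall>y\<in>exp_polyhedron E. (\<forall>x. vec_nth y x \<le> vec_nth v x + h) \<longrightarrow> coord_sum v - e \<le> coord_sum y"
proof -
  note P = exp_polyhedron_basic[OF E]
  have vP: "v \<in> exp_polyhedron E" using v by (simp add: extreme_point_of_def)
  define K where "K = exp_polyhedron E \<inter> {y. \<forall>x. vec_nth y x \<le> vec_nth v x + 1} \<inter> {y. coord_sum y \<le> coord_sum v - e}"
  \<comment> \<open>The total excess of \<open>y\<close> over \<open>v\<close>; it vanishes exactly
    for \<open>y\<close> \<le> \<open>v\<close>.\<close>
  define f where "f y = (\<Sum>x\<in>UNIV. max 0 (vec_nth y x - vec_nth v x))" for y :: "real ^ 'x"
  have fpos: "0 < f y" if y: "y \<in> K" for y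
  proof (rule ccontr)
    assume "\<not> 0 < f y"
    moreover have "0 \<le> f y" unfolding f_def by (intro sum_nonneg) auto
    ultimately have "f y = 0" by simp
    then have "\<forall>x. max 0 (vec_nth y x - vec_nth v x) = 0"
      unfolding f_def by (subst (asm) sum_nonneg_eq_0_iff) auto
    then have le: "vec_nth y x \<le> vec_nth v x" for x by (metis diff_le_0_iff_le max.cobounded2)
    have yP: "y \<in> exp_polyhedron E" "coord_sum y < coord_sum v" using y e by (auto simp: K_def)
    define z where "z = v + (v - y)"
    have z: "z \<in> exp_polyhedron E" by (rule P(5)[OF vP]) (use le in \<open>simp add: z_def\<close>)
    have ne: "y \<noteq> z"
    proof
      assume "y = z"
      then have "2 *\<^sub>R (v - y) = 0" by (simp add: z_def scaleR_2 algebra_simps)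
      then show False using yP(2) by simp
    qed
    have "v = (1 - 1 / 2) *\<^sub>R y + (1 / 2) *\<^sub>R z" by (simp add: z_def algebra_simps flip: scaleR_2)
    then have "v \<in> open_segment y z" unfolding in_segment using ne by (intro conjI exI[of _ "1 / 2"]) auto
    then show False using v yP(1) z unfolding extreme_point_of_def by blast
  qed
  have "compact K"
  proof -
    have "closed {y :: real ^ 'x. \<forall>x. vec_nth y x \<le> vec_nth v x + 1}"
      unfolding Collect_all_eq by (intro closed_INT ballI closed_Collect_le continuous_intros)
    moreover have "closed {y :: real ^ 'x. coord_sum y \<le> coord_sum v - e}"
      unfolding coord_sum_def by (intro closed_Collect_le continuous_intros)
    ultimately have "closed K" unfolding K_def using P(2) by (intro closed_Int)
    moreover have "K \<subseteq> cbox 0 (v + (\<chi> x. 1))"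
      using P(4) by (auto simp: K_def mem_box_cart)
    then have "bounded K" using bounded_cbox bounded_subset by blast
    ultimately show ?thesis by (simp add: compact_eq_bounded_closed)
  qed
  moreover have "continuous_on K f" unfolding f_def by (intro continuous_intros)
  ultimately have "\<exists>m>0. \<forall>y\<in>K. m \<le> f y"
    using continuous_attains_inf[of K f] fpos by (cases "K = {}") (auto intro: exI[of _ 1])
  then obtain m where m: "m > 0" "\<And>y. y \<in> K \<Longrightarrow> m \<le> f y" by blast
  \<comment> \<open>The 1 keeps \<open>y\<close> inside \<open>K\<close>; the 2 makes the total
    excess, at most \<open>CARD('x) * h\<close>, strictly smaller than \<open>m\<close>.\<close>
  define h where "h = min 1 (m / (2 * real CARD('x)))"
  have h: "h > 0" "h \<le> 1" "real CARD('x) * h < m"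
    using m(1) by (auto simp: h_def min_def field_simps split: if_splits)
  have "coord_sum v - e \<le> coord_sum y" if y: "y \<in> exp_polyhedron E" "\<forall>x. vec_nth y x \<le> vec_nth v x + h" for y
  proof (rule ccontr)
    assume "\<not> coord_sum v - e \<le> coord_sum y"
    moreover have "vec_nth y x \<le> vec_nth v x + 1" for x using y(2)[rule_format, of x] h(2) by linarith
    ultimately have "y \<in> K" using y by (simp add: K_def)
    then have "m \<le> f y" by (rule m(2))
    also have "f y \<le> (\<Sum>x\<in>(UNIV :: 'x set). h)"
      unfolding f_def
    proof (rule sum_mono)
      fix x show "max 0 (vec_nth y x - vec_nth v x) \<le> h" using y(2)[rule_format, of x] h(1) by (auto simp: algebra_simps)
    qed
    finally show False using h(3) by simp
  qed
  then show ?thesis using h(1) by blast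
qed

section \<open>Koszul complexes of monomial ideals\<close>

text \<open>An arbitrary linear order on the variables, from which the Koszul signs are read
  off.\<close>

definition var_index :: "'x::finite \<Rightarrow> nat" where
  "var_index = to_nat_on UNIV"

lemma var_index_neq: "k \<noteq> l \<Longrightarrow> var_index k < var_index l \<or> var_index l < (var_index k :: nat)" for k l :: "'x::finite"
proof -
  have "inj (var_index :: 'x \<Rightarrow> nat)" unfolding var_index_def by (rule inj_on_to_nat_on) (rule countable_finite, simp)
  then show "k \<noteq> l \<Longrightarrow> var_index k < var_index l \<or> var_index l < (var_index k :: nat)" by (metis injD nat_neq_iff)
qed

text \<open>The sign of moving basis element \<open>k\<close> past the smaller elements of
  \<open>\<tau>\<close>. It is polymorphic to serve both polynomials and their coefficients;
  \<open>ksgn_cases\<close> compares the two.\<close>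

definition ksgn :: "'x::finite \<Rightarrow> 'x set \<Rightarrow> 'a::comm_ring_1" where
  "ksgn k \<tau> = (- 1) ^ card {l \<in> \<tau>. var_index l < var_index k}"

lemma ksgn_cases: "ksgn k \<tau> = (1 :: 'a::comm_ring_1) \<and> ksgn k \<tau> = (1 :: 'b::comm_ring_1) \<or> ksgn k \<tau> = (- 1 :: 'a::comm_ring_1) \<and> ksgn k \<tau> = (- 1 :: 'b)"
  unfolding ksgn_def by (cases "even (card {l \<in> \<tau>. var_index l < var_index k})") simp_all

lemma ksgn_sq: "ksgn k \<tau> * ksgn k \<tau> = (1 :: 'a::comm_ring_1)"
  using ksgn_cases[of k \<tau>, where 'a = 'a and 'b = 'a] by auto

lemma ksgn_insert:
  assumes "l \<notin> \<tau>"
  shows "ksgn k (insert l \<tau>) = (if var_index l < var_index k then - ksgn k \<tau> else ksgn k \<tau> :: 'a::comm_ring_1)"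
proof (cases "var_index l < var_index k")
  case True
  have "{i \<in> insert l \<tau>. var_index i < var_index k} = insert l {i \<in> \<tau>. var_index i < var_index k}" using True by auto
  then show ?thesis using assms True by (simp add: ksgn_def)
next
  case False
  then have "{i \<in> insert l \<tau>. var_index i < var_index k} = {i \<in> \<tau>. var_index i < var_index k}" by auto
  then show ?thesis using False by (simp add: ksgn_def)
qed

text \<open>Either inserting \<open>l\<close> changes the sign at \<open>k\<close>, or inserting
  \<open>k\<close> changes the sign at \<open>l\<close>, but never both.\<close>

lemma ksgn_swap:
  assumes "k \<noteq> l" "k \<notin> \<tau>" "l \<notin> \<tau>"
  shows "ksgn k (insert l \<tau>) * ksgn l (insert k \<tau>) = - (ksgn k \<tau> * ksgn l \<tau> :: 'a::comm_ring_1)"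
    and "ksgn k \<tau> * ksgn l (insert k \<tau>) = - (ksgn l \<tau> * ksgn k (insert l \<tau>) :: 'a::comm_ring_1)"
  using var_index_neq[OF assms(1)] assms by (auto simp: ksgn_insert)

lemma lookup_ksgn_mult: "lookup (ksgn k \<tau> * p) \<gamma> = ksgn k \<tau> * lookup (p :: ('x, 'k::field) mpoly) \<gamma>"
  using ksgn_cases[of k \<tau>, where 'a = "('x, 'k) mpoly" and 'b = 'k] by auto

text \<open>An element of the Koszul complex is the family of its coefficients at the basis elements \<open>e\<^sub>\<tau>\<close>,
  for all sets \<open>\<tau>\<close> of variables simultaneously.\<close>

definition koszul :: "('x set \<Rightarrow> ('x::finite, 'k::field) mpoly) \<Rightarrow> 'x set \<Rightarrow> ('x, 'k) mpoly" where
  "koszul g \<tau> = (\<Sum>k\<in>-\<tau>. ksgn k \<tau> * (monomial (single k 1) * g (insert k \<tau>)))"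

lemma lookup_var_mult:
  "lookup (monomial (single k 1) * p) \<gamma> =
    (if lookup \<gamma> k = 0 then 0 else lookup (p :: ('x, 'k::field) mpoly) (\<gamma> - single k 1))"
proof (cases "lookup \<gamma> k = 0")
  case True
  then have "\<not> single k 1 \<preceq> \<gamma>" unfolding exp_le_def not_all by (intro exI[of _ k]) simp
  then show ?thesis using lookup_single_mult_eq_0 True by metis
next
  case False
  then show ?thesis
    using lookup_single_mult[of "single k 1" 1 p "\<gamma> - single k 1"] minus_single_add[OF False]
    by simp
qed

lemma lookup_koszul:
  "lookup (koszul g \<tau>) \<gamma> = (\<Sum>k\<in>-\<tau>. ksgn k \<tau> *
    (if lookup \<gamma> k = 0 then 0 else lookup (g (insert k \<tau>)) (\<gamma> - single k 1)))"
  unfolding koszul_def lookup_sum lookup_ksgn_mult lookup_var_mult ..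

lemma koszul_sum:
  "koszul (\<lambda>\<sigma>. \<Sum>m\<in>M. c m * g m \<sigma>) \<tau> = (\<Sum>m\<in>M. c m * koszul (g m) \<tau>)"
  unfolding koszul_def sum_distrib_left sum.swap[of _ M] by (simp add: ac_simps)

lemma koszul_diff: "koszul (\<lambda>\<sigma>. f \<sigma> - g \<sigma>) \<tau> = koszul f \<tau> - koszul g \<tau>"
  unfolding koszul_def by (simp add: right_diff_distrib sum_subtractf)

text \<open>Terms cancel in pairs; the induction avoids division by 2 and so covers every
  characteristic.\<close>

lemma sum_antisym:
  fixes F :: "'a \<Rightarrow> 'a \<Rightarrow> 'b::ab_group_add"
  assumes "finite A" "\<And>k l. k \<in> A \<Longrightarrow> l \<in> A \<Longrightarrow> k \<noteq> l \<Longrightarrow> F k l = - F l k"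
  shows "(\<Sum>k\<in>A. \<Sum>l\<in>A - {k}. F k l) = 0"
  using assms
proof (induction A rule: finite_induct)
  case (insert a A)
  have "(\<Sum>l\<in>insert a A - {k}. F k l) = F k a + (\<Sum>l\<in>A - {k}. F k l)" if "k \<in> A" for k
  proof -
    have "insert a A - {k} = insert a (A - {k})" using that insert.hyps by auto
    then show ?thesis using insert.hyps by simp
  qed
  then have "(\<Sum>k\<in>A. \<Sum>l\<in>insert a A - {k}. F k l) = (\<Sum>k\<in>A. F k a) + (\<Sum>k\<in>A. \<Sum>l\<in>A - {k}. F k l)"
    by (simp add: sum.distrib)
  moreover have "(\<Sum>k\<in>A. \<Sum>l\<in>A - {k}. F k l) = 0" by (rule insert.IH) (rule insert.prems; simp)
  ultimately have "(\<Sum>k\<in>A. \<Sum>l\<in>insert a A - {k}. F k l) = (\<Sum>k\<in>A. F k a)" by simp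
  moreover have "(\<Sum>l\<in>insert a A - {a}. F a l) = (\<Sum>l\<in>A. F a l)" using insert.hyps by simp
  moreover have "(\<Sum>l\<in>A. F a l) = (\<Sum>l\<in>A. - F l a)"
  proof (rule sum.cong[OF refl])
    fix l assume "l \<in> A"
    then show "F a l = - F l a" using insert.hyps by (intro insert.prems) auto
  qed
  ultimately have "(\<Sum>k\<in>insert a A. \<Sum>l\<in>insert a A - {k}. F k l) = (\<Sum>l\<in>A. - F l a) + (\<Sum>k\<in>A. F k a)"
    using insert.hyps by (simp only: sum.insert not_False_eq_True)
  also have "\<dots> = 0" by (simp add: sum_negf)
  finally show ?case .
qed simp

lemma koszul_koszul: "koszul (koszul g) \<tau> = 0"
proof -
  define F where "F k l = ksgn k \<tau> * (monomial (single k 1) *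
    (ksgn l (insert k \<tau>) * (monomial (single l 1) * g (insert l (insert k \<tau>)))))" for k l
  have "koszul (koszul g) \<tau> = (\<Sum>k\<in>-\<tau>. \<Sum>l\<in>-\<tau> - {k}. F k l)"
    unfolding koszul_def F_def sum_distrib_left
    by (intro sum.cong refl) auto
  also have "\<dots> = 0"
  proof (rule sum_antisym)
    fix k l assume kl: "k \<in> -\<tau>" "l \<in> -\<tau>" "k \<noteq> l"
    have F: "F k l = (ksgn k \<tau> * ksgn l (insert k \<tau>)) * (monomial (single k 1) *
      (monomial (single l 1) * g (insert l (insert k \<tau>))))" for k l
      by (simp add: F_def ac_simps)
    show "F k l = - F l k"
      unfolding F ksgn_swap(2)[of k l \<tau>, OF kl(3) kl(1)[unfolded Compl_iff] kl(2)[unfolded Compl_iff]]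
      by (simp add: insert_commute[of k l] mult.left_commute[of "monomial (single k 1)"])
  qed simp
  finally show ?thesis .
qed

text \<open>In multidegree \<open>\<alpha>\<close> the homotopy divides by the variable \<open>J \<alpha>\<close> and multiplies with its basis
  element; it contracts the strands that are cones with apex \<open>J \<alpha>\<close>.\<close>

definition koszul_homotopy ::
    "(('x \<Rightarrow>\<^sub>0 nat) \<Rightarrow> 'x) \<Rightarrow> ('x set \<Rightarrow> ('x::finite, 'k::field) mpoly) \<Rightarrow> 'x set \<Rightarrow> ('x, 'k) mpoly" where
  "koszul_homotopy J g \<sigma> = (\<Sum>j\<in>\<sigma>. ksgn j (\<sigma> - {j}) *
     poly_filter (\<lambda>\<beta>. J (\<beta> + exp_set \<sigma>) = j) (Poly_Mapping.map_key (\<lambda>\<beta>. \<beta> + single j 1) (g (\<sigma> - {j}))))"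

text \<open>The summand for \<open>j\<close> is restricted to multidegrees with apex
  \<open>j\<close>, so at most one summand contributes to a given coefficient.\<close>

lemma lookup_koszul_homotopy:
  assumes "j = J (\<beta> + exp_set \<sigma>)"
  shows "lookup (koszul_homotopy J g \<sigma>) \<beta> =
    (if j \<in> \<sigma> then ksgn j (\<sigma> - {j}) * lookup (g (\<sigma> - {j})) (\<beta> + single j 1) else 0)"
proof -
  have inj: "inj (\<lambda>\<beta>. \<beta> + single i (1::nat))" for i :: 'x by (rule injI) simp
  have "lookup (koszul_homotopy J g \<sigma>) \<beta> = (\<Sum>i\<in>\<sigma>. if j = i then
      ksgn j (\<sigma> - {j}) * lookup (g (\<sigma> - {j})) (\<beta> + single j 1) else 0)"
    unfolding koszul_homotopy_def lookup_sum lookup_ksgn_mult lookup_poly_filter map_key.rep_eq[OF inj] assms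
    by (intro sum.cong refl) auto
  then show ?thesis by simp
qed

lemma exp_set_insert_minus:
  assumes "k \<notin> \<tau>" "lookup \<gamma> k \<noteq> 0"
  shows "\<gamma> - single k 1 + exp_set (insert k \<tau>) = \<gamma> + exp_set \<tau>"
proof -
  have "\<gamma> - single k 1 + exp_set (insert k \<tau>) = (\<gamma> - single k 1 + single k 1) + exp_set \<tau>"
    unfolding exp_set_insert[OF assms(1)] by (simp add: ac_simps)
  then show ?thesis using minus_single_add[OF assms(2)] by simp
qed

text \<open>In each multidegree the homotopy \<open>h\<close> satisfies
  \<open>d h + h d = id\<close>, so \<open>d h\<close> is the identity on cycles. The second
  assumption says that division by the apex variable loses no term it is applied to.\<close>

lemma koszul_homotopy_cycle:
  fixes g :: "'x set \<Rightarrow> ('x::finite, 'k::field) mpoly"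
  assumes cyc: "\<And>\<tau>. koszul g \<tau> = 0"
    and J: "\<And>\<tau> \<gamma>. \<gamma> \<in> keys (g \<tau>) \<Longrightarrow> J (\<gamma> + exp_set \<tau>) \<notin> \<tau> \<Longrightarrow> lookup \<gamma> (J (\<gamma> + exp_set \<tau>)) \<noteq> 0"
  shows "koszul (koszul_homotopy J g) \<tau> = g \<tau>"
proof (rule poly_mapping_eqI)
  fix \<gamma>
  define j where "j = J (\<gamma> + exp_set \<tau>)"
  let ?c = "\<lambda>\<rho> k. if lookup \<gamma> k = 0 then 0 else
     lookup (g \<rho>) (\<gamma> - single k 1 + single j 1)"
  have L: "lookup (koszul (koszul_homotopy J g) \<tau>) \<gamma> = (\<Sum>k\<in>-\<tau>. ksgn k \<tau> *
     (if j \<in> insert k \<tau> then ksgn j (insert k \<tau> - {j}) * ?c (insert k \<tau> - {j}) k else 0))"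
    unfolding lookup_koszul
  proof (intro sum.cong refl arg_cong2[where f = "(*)"])
    fix k assume k: "k \<in> -\<tau>"
    show "(if lookup \<gamma> k = 0 then 0 else lookup (koszul_homotopy J g (insert k \<tau>)) (\<gamma> - single k 1))
      = (if j \<in> insert k \<tau> then ksgn j (insert k \<tau> - {j}) * ?c (insert k \<tau> - {j}) k else 0)"
    proof (cases "lookup \<gamma> k = 0")
      case False
      then have "j = J (\<gamma> - single k 1 + exp_set (insert k \<tau>))"
        using exp_set_insert_minus[of k \<tau> \<gamma>] k by (simp add: j_def)
      then show ?thesis using lookup_koszul_homotopy[of j J "\<gamma> - single k 1" "insert k \<tau>" g] False by simp
    qed simp
  qed
  show "lookup (koszul (koszul_homotopy J g) \<tau>) \<gamma> = lookup (g \<tau>) \<gamma>"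
  proof (cases "j \<in> \<tau>")
    case False
    \<comment> \<open>For \<open>k\<close> other than \<open>j\<close> the enlarged set still misses
      \<open>j\<close>, and the homotopy vanishes there; only \<open>k = j\<close> contributes, with
      a squared sign.\<close>
    have "(\<Sum>k\<in>-\<tau>. ksgn k \<tau> * (if j \<in> insert k \<tau> then ksgn j (insert k \<tau> - {j}) * ?c (insert k \<tau> - {j}) k else 0))
      = (\<Sum>k\<in>-\<tau>. if j = k then ksgn j \<tau> * (ksgn j \<tau> * ?c \<tau> j) else 0)"
      using False by (intro sum.cong refl) auto
    also have "\<dots> = ksgn j \<tau> * (ksgn j \<tau> * ?c \<tau> j)" using False by simp
    also have "\<dots> = ?c \<tau> j" by (simp add: ksgn_sq flip: mult.assoc)
    also have "\<dots> = lookup (g \<tau>) \<gamma>"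
    proof (cases "lookup \<gamma> j = 0")
      case True
      then have "\<gamma> \<notin> keys (g \<tau>)" using J[of \<gamma> \<tau>] False unfolding j_def by blast
      then show ?thesis using True by (simp add: in_keys_iff)
    next
      case False
      then show ?thesis using minus_single_add[OF False] by simp
    qed
    finally show ?thesis unfolding L .
  next
    case True
    \<comment> \<open>Now every \<open>k\<close> contributes; the sum is evaluated by the cycle
      condition at \<open>\<rho>\<close>, in the degree raised by \<open>j\<close>.\<close>
    define \<rho> where "\<rho> = \<tau> - {j}"
    have \<tau>: "\<tau> = insert j \<rho>" "j \<notin> \<rho>" using True by (auto simp: \<rho>_def)
    have "0 = lookup (koszul g \<rho>) (\<gamma> + single j 1)" using cyc[of \<rho>] by simp
    also have "\<dots> = (\<Sum>k\<in>insert j (-\<tau>). ksgn k \<rho> * (if lookup (\<gamma> + single j 1) k = 0 then 0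
        else lookup (g (insert k \<rho>)) (\<gamma> + single j 1 - single k 1)))"
      unfolding lookup_koszul by (intro sum.cong refl) (use \<tau> in auto)
    also have "\<dots> = ksgn j \<rho> * lookup (g \<tau>) \<gamma> + (\<Sum>k\<in>-\<tau>. ksgn k \<rho> * ?c (insert k \<rho>) k)"
    proof (subst sum.insert)
      have "?c (insert k \<rho>) k = (if lookup (\<gamma> + single j 1) k = 0 then 0
        else lookup (g (insert k \<rho>)) (\<gamma> + single j 1 - single k 1))" if "k \<in> -\<tau>" for k
      proof -
        have "k \<noteq> j" using that True by auto
        then have "lookup (\<gamma> + single j 1) k = lookup \<gamma> k" by (simp add: lookup_add lookup_single)
        moreover have "\<gamma> + single j 1 - single k 1 = \<gamma> - single k 1 + single j 1"
          using \<open>k \<noteq> j\<close> by (intro poly_mapping_eqI) (auto simp: lookup_add lookup_minus lookup_single when_def)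
        ultimately show ?thesis by simp
      qed
      then show "ksgn j \<rho> * (if lookup (\<gamma> + single j 1) j = 0 then 0
          else lookup (g (insert j \<rho>)) (\<gamma> + single j 1 - single j 1)) +
        (\<Sum>k\<in>-\<tau>. ksgn k \<rho> * (if lookup (\<gamma> + single j 1) k = 0 then 0
          else lookup (g (insert k \<rho>)) (\<gamma> + single j 1 - single k 1))) =
        ksgn j \<rho> * lookup (g \<tau>) \<gamma> + (\<Sum>k\<in>-\<tau>. ksgn k \<rho> * ?c (insert k \<rho>) k)"
        by (simp add: lookup_add flip: \<tau>(1))
    qed (use True in auto)
    finally have S: "(\<Sum>k\<in>-\<tau>. ksgn k \<rho> * ?c (insert k \<rho>) k) = - (ksgn j \<rho> * lookup (g \<tau>) \<gamma>)"
      by (simp add: eq_neg_iff_add_eq_0 add.commute)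
    have "(\<Sum>k\<in>-\<tau>. ksgn k \<tau> * (if j \<in> insert k \<tau> then ksgn j (insert k \<tau> - {j}) * ?c (insert k \<tau> - {j}) k else 0))
      = (\<Sum>k\<in>-\<tau>. - ksgn j \<rho> * (ksgn k \<rho> * ?c (insert k \<rho>) k))"
    proof (intro sum.cong refl)
      fix k assume k: "k \<in> -\<tau>"
      then have k': "k \<noteq> j" "k \<notin> \<rho>" "insert k \<tau> - {j} = insert k \<rho>" using \<tau> by auto
      have "ksgn k \<tau> * (ksgn j (insert k \<rho>) * c) = - ksgn j \<rho> * (ksgn k \<rho> * c)" for c :: 'k
        using ksgn_swap(1)[OF k'(1,2) \<tau>(2), where 'a = 'k] unfolding \<tau>(1)[symmetric]
        by (metis (no_types, opaque_lifting) mult.assoc mult.commute mult_minus_left)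
      then show "ksgn k \<tau> * (if j \<in> insert k \<tau> then ksgn j (insert k \<tau> - {j}) * ?c (insert k \<tau> - {j}) k else 0)
        = - ksgn j \<rho> * (ksgn k \<rho> * ?c (insert k \<rho>) k)" unfolding k'(3) using True by simp
    qed
    also have "\<dots> = (- ksgn j \<rho>) * (- (ksgn j \<rho> * lookup (g \<tau>) \<gamma>))"
      unfolding sum_distrib_left[symmetric] S ..
    also have "\<dots> = lookup (g \<tau>) \<gamma>" by (simp add: ksgn_sq flip: mult.assoc)
    finally show ?thesis unfolding L .
  qed
qed

text \<open>Three features of the preimage are recorded for \<open>resolution_degree_bound\<close>:
  it stays in the ideal, it vanishes at the empty set, and it creates no new multidegrees.\<close>

lemma koszul_exact:
  fixes g :: "'x set \<Rightarrow> ('x::finite, 'k::field) mpoly"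
  assumes cyc: "\<And>\<tau>. koszul g \<tau> = 0" and S: "\<And>\<tau>. g \<tau> \<in> exp_span S"
    and cone: "\<And>\<tau> \<gamma>. \<gamma> \<in> keys (g \<tau>) \<Longrightarrow> \<exists>j. cone_at S (\<gamma> + exp_set \<tau>) j"
  shows "\<exists>w. (\<forall>\<tau>. koszul w \<tau> = g \<tau>) \<and> (\<forall>\<tau>. w \<tau> \<in> exp_span S) \<and> w {} = 0 \<and>
    (\<forall>\<sigma>. \<forall>\<beta>\<in>keys (w \<sigma>). \<exists>\<tau>. \<exists>\<gamma>\<in>keys (g \<tau>). \<beta> + exp_set \<sigma> = \<gamma> + exp_set \<tau>)"
proof -
  define J where "J a = (SOME j. cone_at S a j)" for a
  have J: "cone_at S (\<gamma> + exp_set \<tau>) (J (\<gamma> + exp_set \<tau>))" if "\<gamma> \<in> keys (g \<tau>)" for \<gamma> \<tau>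
    unfolding J_def using cone[OF that] by (rule someI_ex)
  have J': "\<exists>\<gamma>'\<in>S. \<gamma> = \<gamma>' + single (J (\<gamma> + exp_set \<tau>)) 1"
    if "\<gamma> \<in> keys (g \<tau>)" "J (\<gamma> + exp_set \<tau>) \<notin> \<tau>" for \<gamma> \<tau>
  proof -
    have "\<gamma> \<in> S" using S[of \<tau>] that(1) by (auto simp: exp_span_def)
    then show ?thesis using J[OF that(1)] that(2) unfolding cone_at_def by blast
  qed
  let ?w = "koszul_homotopy J g"
  have "koszul ?w \<tau> = g \<tau>" for \<tau>
  proof (rule koszul_homotopy_cycle[OF cyc])
    fix \<tau> \<gamma> assume "\<gamma> \<in> keys (g \<tau>)" "J (\<gamma> + exp_set \<tau>) \<notin> \<tau>"
    from J'[OF this] obtain \<gamma>' where "\<gamma> = \<gamma>' + single (J (\<gamma> + exp_set \<tau>)) 1" by blast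
    then have "lookup \<gamma> (J (\<gamma> + exp_set \<tau>)) = lookup \<gamma>' (J (\<gamma> + exp_set \<tau>)) + 1"
      by (metis lookup_add lookup_single_eq)
    then show "lookup \<gamma> (J (\<gamma> + exp_set \<tau>)) \<noteq> 0" by simp
  qed
  moreover have key: "\<beta> \<in> S \<and> (\<exists>\<tau>. \<exists>\<gamma>\<in>keys (g \<tau>). \<beta> + exp_set \<sigma> = \<gamma> + exp_set \<tau>)"
    if b: "\<beta> \<in> keys (?w \<sigma>)" for \<beta> \<sigma>
  proof -
    define j where "j = J (\<beta> + exp_set \<sigma>)"
    define \<gamma> where "\<gamma> = \<beta> + single j 1"
    have *: "j \<in> \<sigma>" "\<gamma> \<in> keys (g (\<sigma> - {j}))"
      using b lookup_koszul_homotopy[of j J \<beta> \<sigma> g, OF j_def] by (auto simp: in_keys_iff \<gamma>_def split: if_splits)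
    have eq: "\<gamma> + exp_set (\<sigma> - {j}) = \<beta> + exp_set \<sigma>"
      using exp_set_insert[of j "\<sigma> - {j}"] *(1) by (simp add: \<gamma>_def insert_absorb ac_simps)
    have "\<exists>\<gamma>'\<in>S. \<gamma> = \<gamma>' + single j 1"
      using J'[OF *(2)] unfolding eq j_def[symmetric] by simp
    then have "\<beta> \<in> S" by (auto simp: \<gamma>_def)
    then show ?thesis using *(2) eq by metis
  qed
  moreover have "?w {} = 0" by (simp add: koszul_homotopy_def)
  moreover have "?w \<sigma> \<in> exp_span S" for \<sigma> using key by (auto simp: exp_span_def)
  ultimately show ?thesis by blast
qed

text \<open>For the whole ring the complex is the full simplex on the support of
  \<open>\<alpha>\<close>, so any variable dividing \<open>\<alpha>\<close> is an apex. Hence the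
  Koszul complex of the ring is exact outside multidegree 0.\<close>

lemma cone_at_UNIV:
  assumes "\<alpha> \<noteq> 0" shows "\<exists>j. cone_at UNIV \<alpha> j"
proof -
  obtain x where x: "lookup \<alpha> x \<noteq> 0" using exp_nonzero_ex[OF assms] by blast
  have "\<exists>\<gamma>'. \<gamma> = \<gamma>' + single x 1" if "\<gamma> + exp_set \<tau> = \<alpha>" "x \<notin> \<tau>" for \<gamma> \<tau>
  proof -
    have "lookup \<gamma> x \<noteq> 0" using x that by (metis add.right_neutral lookup_add lookup_exp_set)
    then show ?thesis using minus_single_add by metis
  qed
  then show ?thesis unfolding cone_at_def by blast
qed

lemma variables_ideal_eq: "variables_ideal = (exp_span {\<alpha>. \<alpha> \<noteq> 0} :: ('x::finite, 'k::field) mpoly set)"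
proof -
  have "{monomial (single x 1) :: ('x, 'k) mpoly | x. True} = monomial ` range (\<lambda>x. single x 1)"
    by auto
  then have "variables_ideal = (exp_span {\<alpha>. \<exists>\<beta>\<in>range (\<lambda>x. single x 1). \<beta> \<preceq> \<alpha>} :: ('x, 'k) mpoly set)"
    unfolding variables_ideal_def by (simp only: ideal_gen_monomials)
  moreover have "(\<exists>\<beta>\<in>range (\<lambda>x. single x 1). \<beta> \<preceq> \<alpha>) \<longleftrightarrow> \<alpha> \<noteq> 0" for \<alpha> :: "'x \<Rightarrow>\<^sub>0 nat"
  proof
    assume "\<exists>\<beta>\<in>range (\<lambda>x. single x 1). \<beta> \<preceq> \<alpha>"
    then obtain x where "single x 1 \<preceq> \<alpha>" by blast
    then have "1 \<le> lookup \<alpha> x" unfolding exp_le_def by (metis lookup_single_eq)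
    then show "\<alpha> \<noteq> 0" by auto
  next
    assume "\<alpha> \<noteq> 0"
    then obtain x where "lookup \<alpha> x \<noteq> 0" using exp_nonzero_ex by blast
    then have "single x 1 \<preceq> \<alpha>" by (auto simp: exp_le_def lookup_single when_def)
    then show "\<exists>\<beta>\<in>range (\<lambda>x. single x 1). \<beta> \<preceq> \<alpha>" by blast
  qed
  ultimately show ?thesis by simp
qed

lemma is_ideal_variables: "is_ideal (variables_ideal :: ('x::finite, 'k::field) mpoly set)"
  by (simp add: variables_ideal_def is_ideal_gen)

lemma in_variables_ideal: "f \<in> variables_ideal \<longleftrightarrow> lookup (f :: ('x::finite, 'k::field) mpoly) 0 = 0"
  by (auto simp: variables_ideal_eq exp_span_def in_keys_iff)

lemma lookup_koszul_0: "lookup (koszul g \<tau>) 0 = 0"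
  by (simp add: lookup_koszul)

text \<open>Comparison of a minimal resolution with the Koszul complex: a basis element \<open>m0\<close> of \<open>F\<^sub>i\<close> is
  lifted along the double complex \<open>K \<otimes> F\<close> to a Koszul cycle of the resolved ideal in the same degree.
  If this cycle is a boundary, descending again shows that the basis element lies in the ideal
  of the variables times \<open>F\<^sub>i\<close>. The entry \<open>\<Phi> q l m\<close> is the coefficient of the basis element \<open>l\<close> in the
  image of the basis element \<open>m\<close> of \<open>F\<^sub>q\<close>, and \<open>r q\<close> is the rank of the target of \<open>\<Phi> q\<close>.\<close>

lemma resolution_degree_bound:
  fixes \<Phi> :: "nat \<Rightarrow> nat \<Rightarrow> nat \<Rightarrow> ('x::finite, 'k::field) mpoly" and d :: "nat \<Rightarrow> nat \<Rightarrow> int"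
  assumes S: "up_closed S"
    and r: "r 0 = 1" "\<And>q. r (Suc q) = n q"
    and hom0: "\<And>m. m < n 0 \<Longrightarrow> homogeneous (d 0 m) (\<Phi> 0 0 m)"
    and hom: "\<And>q l m. l < n q \<Longrightarrow> m < n (Suc q) \<Longrightarrow> homogeneous (d (Suc q) m - d q l) (\<Phi> (Suc q) l m)"
    and minim: "\<And>q l m. l < n q \<Longrightarrow> m < n (Suc q) \<Longrightarrow> \<Phi> (Suc q) l m \<in> variables_ideal"
    and im0: "\<And>m. m < n 0 \<Longrightarrow> \<Phi> 0 0 m \<in> exp_span S"
    and im1: "\<And>f. f \<in> exp_span S \<Longrightarrow> \<exists>w. f = (\<Sum>m<n 0. \<Phi> 0 0 m * w m)"
    and complex: "\<And>q l m'. l < r q \<Longrightarrow> m' < n (Suc q) \<Longrightarrow> (\<Sum>m<n q. \<Phi> q l m * \<Phi> (Suc q) m m') = 0"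
    and exact: "\<And>q v. (\<And>l. l < r q \<Longrightarrow> (\<Sum>m<n q. \<Phi> q l m * v m) = 0) \<Longrightarrow>
      \<exists>w. \<forall>m<n q. v m = (\<Sum>m'<n (Suc q). \<Phi> (Suc q) m m' * w m')"
    and m0: "m0 < n i"
    and cone: "\<And>\<alpha>. \<alpha> \<in> S \<Longrightarrow> int (mdeg \<alpha>) = d i m0 \<Longrightarrow> \<exists>j. cone_at S \<alpha> j"
  shows False
proof -
  define D where "D = d i m0"
  \<comment> \<open>The basis element \<open>m0\<close> at the empty set, the starting corner of the
    double complex.\<close>
  define z0 where "z0 \<tau> m = (if \<tau> = {} \<and> m = m0 then 1 else 0 :: ('x, 'k) mpoly)" for \<tau> :: "'x set" and m :: nat
  have hom_sum: "int (mdeg (\<gamma> + exp_set \<tau>)) + e = D"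
    if g: "\<gamma> \<in> keys (\<Sum>m<N. A m * z m)" and A: "\<And>m. m < N \<Longrightarrow> homogeneous (f m - e) (A m)"
      and z: "\<And>m \<beta>. m < N \<Longrightarrow> \<beta> \<in> keys (z m) \<Longrightarrow> int (mdeg (\<beta> + exp_set \<tau>)) + f m = D"
    for \<gamma> \<tau> e f N and A z :: "nat \<Rightarrow> ('x, 'k) mpoly"
  proof -
    obtain m where m: "m < N" "\<gamma> \<in> keys (A m * z m)" using g keys_sum[of "\<lambda>m. A m * z m" "{..<N}"] by auto
    obtain \<alpha> \<beta> where ab: "\<gamma> = \<alpha> + \<beta>" "\<alpha> \<in> keys (A m)" "\<beta> \<in> keys (z m)"
      using m(2) keys_mult[of "A m" "z m"] by blast
    have "int (mdeg \<alpha>) = f m - e" using A[OF m(1)] ab(2) by (simp add: homogeneous_def)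
    then show ?thesis using z[OF m(1) ab(3)] by (simp add: ab(1) mdeg_add)
  qed
  \<comment> \<open>The state after \<open>p\<close> liftings: columns \<open>i - p\<close> to
    \<open>i\<close> satisfy the zigzag relation, vanish at the empty set before column
    \<open>i\<close>, and have total degree \<open>D\<close>, where \<open>\<tau>\<close> counts
    with its cardinality.\<close>
  define good where "good p Z \<longleftrightarrow> Z i = z0 \<and>
      (\<forall>q. i - p \<le> q \<and> q < i \<longrightarrow> (\<forall>\<tau>. \<forall>l<n q. koszul (\<lambda>\<sigma>. Z q \<sigma> l) \<tau> = (\<Sum>m<n (Suc q). \<Phi> (Suc q) l m * Z (Suc q) \<tau> m))) \<and>
      (\<forall>q. i - p \<le> q \<and> q < i \<longrightarrow> (\<forall>l<n q. Z q {} l = 0)) \<and>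
      (\<forall>q. i - p \<le> q \<and> q \<le> i \<longrightarrow> (\<forall>\<tau>. \<forall>m<n q. \<forall>\<gamma>\<in>keys (Z q \<tau> m). int (mdeg (\<gamma> + exp_set \<tau>)) + d q m = D))"
    for p :: nat and Z :: "nat \<Rightarrow> 'x set \<Rightarrow> nat \<Rightarrow> ('x, 'k) mpoly"
  have cycle: "koszul (\<lambda>\<sigma>. \<Sum>m<n q. \<Phi> q l m * Z q \<sigma> m) \<tau> = 0"
    if Z: "good p Z" and q: "i - p \<le> q" "q \<le> i" and l: "l < r q" for p Z q l \<tau>
  proof -
    have "(\<Sum>m<n q. \<Phi> q l m * koszul (\<lambda>\<sigma>. Z q \<sigma> m) \<tau>) = 0"
    proof (cases "q = i")
      case True
      have "koszul (\<lambda>\<sigma>. Z q \<sigma> m) \<tau> = 0" for m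
        using Z True by (simp add: good_def koszul_def z0_def)
      then show ?thesis by simp
    next
      case False
      then have "koszul (\<lambda>\<sigma>. Z q \<sigma> m) \<tau> = (\<Sum>m'<n (Suc q). \<Phi> (Suc q) m m' * Z (Suc q) \<tau> m')" if "m < n q" for m
        using Z q that by (simp add: good_def)
      then have "(\<Sum>m<n q. \<Phi> q l m * koszul (\<lambda>\<sigma>. Z q \<sigma> m) \<tau>)
        = (\<Sum>m<n q. \<Sum>m'<n (Suc q). (\<Phi> q l m * \<Phi> (Suc q) m m') * Z (Suc q) \<tau> m')"
        by (simp add: sum_distrib_left mult.assoc)
      also have "\<dots> = (\<Sum>m'<n (Suc q). (\<Sum>m<n q. \<Phi> q l m * \<Phi> (Suc q) m m') * Z (Suc q) \<tau> m')"
        by (subst sum.swap) (simp add: sum_distrib_right)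
      also have "\<dots> = 0" using complex[OF l] by simp
      finally show ?thesis .
    qed
    then show ?thesis by (simp only: koszul_sum)
  qed
  have "\<exists>Z. good p Z" if "p \<le> i" for p
    using that
  proof (induction p)
    case 0
    have "good 0 (\<lambda>_. z0)" by (auto simp: good_def z0_def D_def split: if_splits)
    then show ?case by blast
  next
    case (Suc p)
    then obtain Z where Z: "good p Z" by auto
    define q where "q = i - Suc p"
    have q: "Suc q = i - p" "q < i" using Suc.prems by (auto simp: q_def)
    define u where "u \<tau> l = (\<Sum>m<n (Suc q). \<Phi> (Suc q) l m * Z (Suc q) \<tau> m)" for \<tau> l
    have udeg: "int (mdeg (\<gamma> + exp_set \<tau>)) + d q l = D" if "l < n q" "\<gamma> \<in> keys (u \<tau> l)" for \<gamma> \<tau> l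
      using that(2) unfolding u_def
    proof (rule hom_sum)
      show "homogeneous (d (Suc q) m - d q l) (\<Phi> (Suc q) l m)" if "m < n (Suc q)" for m
        by (rule hom) (use that \<open>l < n q\<close> in auto)
      show "int (mdeg (\<beta> + exp_set \<tau>)) + d (Suc q) m = D" if "m < n (Suc q)" "\<beta> \<in> keys (Z (Suc q) \<tau> m)" for m \<beta>
        using Z that q by (auto simp: good_def)
    qed
    have "\<exists>w. (\<forall>\<tau>. koszul w \<tau> = u \<tau> l) \<and> w {} = 0 \<and> (\<forall>\<tau>. \<forall>\<gamma>\<in>keys (w \<tau>). int (mdeg (\<gamma> + exp_set \<tau>)) + d q l = D)"
      if l: "l < n q" for l
    proof -
      have "koszul (\<lambda>\<sigma>. u \<sigma> l) \<tau> = 0" for \<tau>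
      proof -
        have "l < r (Suc q)" using r(2) l by simp
        then show ?thesis unfolding u_def by (intro cycle[OF Z]) (use q in auto)
      qed
      \<comment> \<open>Multidegree 0 must be excluded. At the empty set the first lifting meets
        entries of a minimal matrix, which have no constant term; later ones meet a \<open>Z\<close>
        that vanishes there.\<close>
      moreover have "\<exists>j. cone_at UNIV (\<gamma> + exp_set \<tau>) j" if g: "\<gamma> \<in> keys (u \<tau> l)" for \<gamma> \<tau>
      proof (rule cone_at_UNIV)
        show "\<gamma> + exp_set \<tau> \<noteq> 0"
        proof (cases "\<tau> = {}")
          case False
          then obtain x where "x \<in> \<tau>" by blast
          then have "lookup (\<gamma> + exp_set \<tau>) x \<noteq> 0" by (simp add: lookup_add)
          then show ?thesis by auto
        next
          case True
          have "\<gamma> \<noteq> 0"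
          proof (cases "Suc q = i")
            case i: True
            have "u \<tau> l = (\<Sum>m<n i. \<Phi> i l m * (if m = m0 then 1 else 0))"
              unfolding u_def i using Z True by (intro sum.cong) (auto simp: good_def z0_def)
            also have "\<dots> = \<Phi> i l m0" using m0 by (simp add: if_distrib cong: if_cong)
            finally have "u \<tau> l \<in> variables_ideal" using minim[OF l, of m0] m0 i by simp
            then show ?thesis using g by (auto simp: in_variables_ideal in_keys_iff)
          next
            case False
            then have "u \<tau> l = 0" unfolding u_def using Z True q by (intro sum.neutral) (auto simp: good_def)
            then show ?thesis using g by simp
          qed
          then show ?thesis using True by simp
        qed
      qed
      ultimately obtain w where w: "\<forall>\<tau>. koszul w \<tau> = u \<tau> l" "w {} = 0"
        "\<forall>\<sigma>. \<forall>\<beta>\<in>keys (w \<sigma>). \<exists>\<tau>. \<exists>\<gamma>\<in>keys (u \<tau> l). \<beta> + exp_set \<sigma> = \<gamma> + exp_set \<tau>"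
        using koszul_exact[of "\<lambda>\<sigma>. u \<sigma> l" UNIV] by (auto simp: exp_span_def)
      then have "int (mdeg (\<gamma> + exp_set \<tau>)) + d q l = D" if "\<gamma> \<in> keys (w \<tau>)" for \<gamma> \<tau>
        using udeg[OF l] that by metis
      then show ?thesis using w by blast
    qed
    then obtain w where w: "\<And>l \<tau>. l < n q \<Longrightarrow> koszul (w l) \<tau> = u \<tau> l" "\<And>l. l < n q \<Longrightarrow> w l {} = 0"
      "\<And>l \<tau> \<gamma>. l < n q \<Longrightarrow> \<gamma> \<in> keys (w l \<tau>) \<Longrightarrow> int (mdeg (\<gamma> + exp_set \<tau>)) + d q l = D" by metis
    define Z' where "Z' = Z(q := (\<lambda>\<sigma> l. w l \<sigma>))"
    have cases_q: "q' = q \<or> i - p \<le> q' \<and> q' \<noteq> q" if "i - Suc p \<le> q'" for q' using that by (auto simp: q_def)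
    have "good (Suc p) Z'"
      unfolding good_def
    proof (intro conjI allI impI ballI; (elim conjE)?)
      show "Z' i = z0" using Z q by (simp add: Z'_def good_def)
    next
      fix q' \<tau> l assume q': "i - Suc p \<le> q'" "q' < i" and l: "l < n q'"
      show "koszul (\<lambda>\<sigma>. Z' q' \<sigma> l) \<tau> = (\<Sum>m<n (Suc q'). \<Phi> (Suc q') l m * Z' (Suc q') \<tau> m)"
        using cases_q[OF q'(1)]
      proof
        assume "q' = q"
        then show ?thesis using w(1) l by (simp add: Z'_def u_def)
      next
        assume *: "i - p \<le> q' \<and> q' \<noteq> q"
        then have "Suc q' \<noteq> q" using q by linarith
        then show ?thesis using Z * q' l by (simp add: Z'_def good_def)
      qed
    next
      fix q' l assume q': "i - Suc p \<le> q'" "q' < i" and l: "l < n q'"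
      show "Z' q' {} l = 0" using cases_q[OF q'(1)] Z q' l w(2) by (auto simp: Z'_def good_def)
    next
      fix q' \<tau> l \<gamma> assume q': "i - Suc p \<le> q'" "q' \<le> i" and l: "l < n q'" "\<gamma> \<in> keys (Z' q' \<tau> l)"
      show "int (mdeg (\<gamma> + exp_set \<tau>)) + d q' l = D" using cases_q[OF q'(1)] Z q' l w(3) by (auto simp: Z'_def good_def)
    qed
    then show ?case by blast
  qed
  then obtain Z where Z: "good i Z" by blast
  have Zi: "Z i = z0" and Zk: "\<And>q l \<tau>. q < i \<Longrightarrow> l < n q \<Longrightarrow> koszul (\<lambda>\<sigma>. Z q \<sigma> l) \<tau> = (\<Sum>m<n (Suc q). \<Phi> (Suc q) l m * Z (Suc q) \<tau> m)"
    and Zd: "\<And>q m \<tau> \<gamma>. q \<le> i \<Longrightarrow> m < n q \<Longrightarrow> \<gamma> \<in> keys (Z q \<tau> m) \<Longrightarrow> int (mdeg (\<gamma> + exp_set \<tau>)) + d q m = D"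
    using Z by (simp_all add: good_def)
  \<comment> \<open>The end of the zigzag: a Koszul cycle with coefficients in the resolved
    ideal.\<close>
  define u where "u \<tau> = (\<Sum>m<n 0. \<Phi> 0 0 m * Z 0 \<tau> m)" for \<tau>
  have uS: "u \<tau> \<in> exp_span S" for \<tau>
    unfolding u_def using im0 by (intro is_ideal_sum is_ideal_multI2 is_ideal_exp_span S) auto
  have "\<exists>w. (\<forall>\<tau>. koszul w \<tau> = u \<tau>) \<and> (\<forall>\<tau>. w \<tau> \<in> exp_span S)"
  proof -
    have "koszul u \<tau> = 0" for \<tau> using cycle[OF Z, of 0 0 \<tau>] r by (simp add: u_def[abs_def])
    moreover have "\<exists>j. cone_at S (\<gamma> + exp_set \<tau>) j" if g: "\<gamma> \<in> keys (u \<tau>)" for \<gamma> \<tau>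
    proof (rule cone)
      show "\<gamma> + exp_set \<tau> \<in> S" using uS[of \<tau>] g by (auto simp: exp_span_def intro!: up_closed_addI[OF S])
      have "int (mdeg (\<gamma> + exp_set \<tau>)) + 0 = D"
        using g unfolding u_def
      proof (rule hom_sum)
        show "homogeneous (d 0 m - 0) (\<Phi> 0 0 m)" if "m < n 0" for m using hom0[OF that] by simp
        show "int (mdeg (\<beta> + exp_set \<tau>)) + d 0 m = D" if "m < n 0" "\<beta> \<in> keys (Z 0 \<tau> m)" for m \<beta>
          by (rule Zd) (use that in auto)
      qed
      then show "int (mdeg (\<gamma> + exp_set \<tau>)) = d i m0" by (simp add: D_def)
    qed
    ultimately show ?thesis using koszul_exact[of u S] uS by blast
  qed
  then obtain w where w: "\<And>\<tau>. koszul w \<tau> = u \<tau>" "\<And>\<tau>. w \<tau> \<in> exp_span S" by blast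
  \<comment> \<open>The descent: corrected by a Koszul boundary, each column lies in the kernel of
    the resolution map, and exactness of the resolution yields the correction for the next
    column.\<close>
  have "\<exists>Y. \<forall>\<tau>. \<forall>l<r q. (\<Sum>m<n q. \<Phi> q l m * (Z q \<tau> m - koszul (\<lambda>\<sigma>. Y \<sigma> m) \<tau>)) = 0" if "q \<le> i" for q
    using that
  proof (induction q)
    case 0
    have "\<forall>\<tau>. \<exists>y. w \<tau> = (\<Sum>m<n 0. \<Phi> 0 0 m * y m)" using im1 w(2) by blast
    from choice[OF this] obtain Y where Y: "\<forall>\<tau>. w \<tau> = (\<Sum>m<n 0. \<Phi> 0 0 m * Y \<tau> m)" ..
    have "(\<Sum>m<n 0. \<Phi> 0 0 m * (Z 0 \<tau> m - koszul (\<lambda>\<sigma>. Y \<sigma> m) \<tau>)) = 0" for \<tau>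
    proof -
      have "(\<lambda>\<sigma>. \<Sum>m<n 0. \<Phi> 0 0 m * Y \<sigma> m) = w" by (rule ext) (rule Y[rule_format, symmetric])
      then have "u \<tau> = koszul (\<lambda>\<sigma>. \<Sum>m<n 0. \<Phi> 0 0 m * Y \<sigma> m) \<tau>" using w(1)[of \<tau>] by (simp only:)
      then show ?thesis unfolding koszul_sum u_def by (simp add: right_diff_distrib sum_subtractf)
    qed
    then show ?case using r by (intro exI[of _ Y]) auto
  next
    case (Suc q)
    then obtain Y where Y: "\<And>\<tau> l. l < r q \<Longrightarrow> (\<Sum>m<n q. \<Phi> q l m * (Z q \<tau> m - koszul (\<lambda>\<sigma>. Y \<sigma> m) \<tau>)) = 0" by auto
    have "\<forall>\<tau>. \<exists>V. \<forall>m<n q. Z q \<tau> m - koszul (\<lambda>\<sigma>. Y \<sigma> m) \<tau> = (\<Sum>m'<n (Suc q). \<Phi> (Suc q) m m' * V m')"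
      by (rule allI, rule exact, rule Y)
    from choice[OF this] obtain V where V: "\<forall>\<tau>. \<forall>m<n q. Z q \<tau> m - koszul (\<lambda>\<sigma>. Y \<sigma> m) \<tau> = (\<Sum>m'<n (Suc q). \<Phi> (Suc q) m m' * V \<tau> m')" ..
    have "(\<Sum>m<n (Suc q). \<Phi> (Suc q) l m * (Z (Suc q) \<tau> m - koszul (\<lambda>\<sigma>. V \<sigma> m) \<tau>)) = 0" if l: "l < n q" for \<tau> l
    proof -
      have Vl: "(\<lambda>\<sigma>. \<Sum>m'<n (Suc q). \<Phi> (Suc q) l m' * V \<sigma> m') = (\<lambda>\<sigma>. Z q \<sigma> l - koszul (\<lambda>\<sigma>. Y \<sigma> l) \<sigma>)" using V l by auto
      have "koszul (\<lambda>\<sigma>. \<Sum>m'<n (Suc q). \<Phi> (Suc q) l m' * V \<sigma> m') \<tau> = koszul (\<lambda>\<sigma>. Z q \<sigma> l) \<tau>"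
        unfolding Vl koszul_diff by (simp add: koszul_koszul)
      also have "\<dots> = (\<Sum>m<n (Suc q). \<Phi> (Suc q) l m * Z (Suc q) \<tau> m)" using Zk[of q l \<tau>] l Suc.prems by simp
      finally show ?thesis unfolding koszul_sum by (simp add: right_diff_distrib sum_subtractf)
    qed
    then show ?case using r(2) by (intro exI[of _ V]) simp
  qed
  then obtain Y where Y: "\<And>\<tau> l. l < r i \<Longrightarrow> (\<Sum>m<n i. \<Phi> i l m * (Z i \<tau> m - koszul (\<lambda>\<sigma>. Y \<sigma> m) \<tau>)) = 0" by blast
  obtain v where v: "\<forall>m<n i. Z i {} m - koszul (\<lambda>\<sigma>. Y \<sigma> m) {} = (\<Sum>m'<n (Suc i). \<Phi> (Suc i) m m' * v m')"
    using exact[of i "\<lambda>m. Z i {} m - koszul (\<lambda>\<sigma>. Y \<sigma> m) {}"] Y by blast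
  \<comment> \<open>Koszul images have no constant term, so the left side has constant term 1, while
    the image of a minimal map has constant term 0.\<close>
  have "1 - koszul (\<lambda>\<sigma>. Y \<sigma> m0) {} = (\<Sum>m'<n (Suc i). \<Phi> (Suc i) m0 m' * v m')"
    using v[rule_format, OF m0] by (simp add: Zi z0_def)
  also have "\<dots> \<in> variables_ideal" using minim[OF m0] by (intro is_ideal_sum is_ideal_multI2 is_ideal_variables) auto
  finally have "lookup (1 - koszul (\<lambda>\<sigma>. Y \<sigma> m0) {}) 0 = 0" by (simp only: in_variables_ideal)
  then show False by (simp add: lookup_minus lookup_koszul_0)
qed

section \<open>Existence of minimal graded free resolutions\<close>

definition multihom :: "nat \<Rightarrow> (nat \<Rightarrow> 'x \<Rightarrow>\<^sub>0 nat) \<Rightarrow> ('x \<Rightarrow>\<^sub>0 nat) \<Rightarrow> (nat \<Rightarrow> ('x::finite, 'k::field) mpoly) \<Rightarrow> bool" where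
  "multihom n A b v \<longleftrightarrow> (\<forall>l<n. \<forall>\<gamma>\<in>keys (v l). \<gamma> + A l = b)"

text \<open>Multigraded submodules of the direct sum of the \<open>R(-A l)\<close> with \<open>l < n\<close>; entries of vectors beyond \<open>n\<close> are irrelevant.\<close>

definition multigraded :: "nat \<Rightarrow> (nat \<Rightarrow> 'x \<Rightarrow>\<^sub>0 nat) \<Rightarrow> (nat \<Rightarrow> ('x::finite, 'k::field) mpoly) set \<Rightarrow> bool" where
  "multigraded n A M \<longleftrightarrow> (\<lambda>_. 0) \<in> M \<and> (\<forall>v\<in>M. \<forall>w\<in>M. (\<lambda>l. v l + w l) \<in> M) \<and> (\<forall>c. \<forall>v\<in>M. (\<lambda>l. c * v l) \<in> M) \<and>
     (\<forall>b. \<forall>v\<in>M. (\<lambda>l. poly_filter (\<lambda>\<gamma>. \<gamma> + A l = b) (v l)) \<in> M)"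

text \<open>Vectors are paired with their multidegrees because the degree of a generator becomes a
  shift in the next free module.\<close>

definition spans :: "nat \<Rightarrow> (('x \<Rightarrow>\<^sub>0 nat) \<times> (nat \<Rightarrow> ('x::finite, 'k::field) mpoly)) set \<Rightarrow> (nat \<Rightarrow> ('x, 'k) mpoly) \<Rightarrow> bool" where
  "spans n H v \<longleftrightarrow> (\<exists>w. \<forall>l<n. v l = (\<Sum>h\<in>H. w h * snd h l))"

lemma spans_add: "spans n H v \<Longrightarrow> spans n H v' \<Longrightarrow> spans n H (\<lambda>l. v l + v' l)"
proof -
  assume "spans n H v" "spans n H v'"
  then obtain w w' where "\<forall>l<n. v l = (\<Sum>h\<in>H. w h * snd h l)" "\<forall>l<n. v' l = (\<Sum>h\<in>H. w' h * snd h l)"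
    by (auto simp: spans_def)
  then have "\<forall>l<n. v l + v' l = (\<Sum>h\<in>H. (w h + w' h) * snd h l)" by (simp add: distrib_right sum.distrib)
  then show ?thesis unfolding spans_def by (rule exI[of _ "\<lambda>h. w h + w' h"])
qed

lemma spans_mult: "spans n H v \<Longrightarrow> spans n H (\<lambda>l. c * v l)"
proof -
  assume "spans n H v"
  then obtain w where "\<forall>l<n. v l = (\<Sum>h\<in>H. w h * snd h l)" by (auto simp: spans_def)
  then have "\<forall>l<n. c * v l = (\<Sum>h\<in>H. (c * w h) * snd h l)" by (simp add: sum_distrib_left mult.assoc)
  then show ?thesis unfolding spans_def by (rule exI[of _ "\<lambda>h. c * w h"])
qed

lemma spans_zero: "(\<And>l. l < n \<Longrightarrow> v l = 0) \<Longrightarrow> spans n H v"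
  unfolding spans_def by (intro exI[of _ "\<lambda>_. 0"]) simp

lemma spans_cong: "spans n H v \<Longrightarrow> (\<And>l. l < n \<Longrightarrow> v l = v' l) \<Longrightarrow> spans n H v'"
  unfolding spans_def by simp

lemma spans_member: "finite H \<Longrightarrow> h \<in> H \<Longrightarrow> spans n H (snd h)"
  unfolding spans_def by (intro exI[of _ "\<lambda>h'. if h' = h then 1 else 0"]) (simp add: if_distrib[of "\<lambda>c. c * _"] cong: if_cong)

lemma spans_sum: "(\<And>i. i \<in> A \<Longrightarrow> spans n H (v i)) \<Longrightarrow> spans n H (\<lambda>l. \<Sum>i\<in>A. v i l)"
  by (induction A rule: infinite_finite_induct) (auto intro: spans_zero spans_add)

lemma spans_trans: "spans n H v \<Longrightarrow> (\<And>h. h \<in> H \<Longrightarrow> spans n H' (snd h)) \<Longrightarrow> spans n H' v"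
proof -
  assume "spans n H v" and *: "\<And>h. h \<in> H \<Longrightarrow> spans n H' (snd h)"
  then obtain w where w: "\<forall>l<n. v l = (\<Sum>h\<in>H. w h * snd h l)" by (auto simp: spans_def)
  have "spans n H' (\<lambda>l. \<Sum>h\<in>H. w h * snd h l)" by (intro spans_sum spans_mult *)
  then show ?thesis by (rule spans_cong) (simp add: w)
qed

text \<open>In a fixed multidegree every entry is a scalar multiple of one monomial, so one
  subtraction clears it.\<close>

lemma keys_single_eq:
  assumes "\<forall>\<gamma>\<in>keys f. \<gamma> + a = b" "\<gamma> + a = (b :: 'x \<Rightarrow>\<^sub>0 nat)"
  shows "f = single \<gamma> (lookup f \<gamma>)"
proof (rule poly_mapping_eqI)
  fix \<delta>
  show "lookup f \<delta> = lookup (single \<gamma> (lookup f \<gamma>)) \<delta>"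
  proof (cases "\<delta> \<in> keys f")
    case True
    then have "\<delta> + a = \<gamma> + a" using assms by simp
    then show ?thesis by simp
  next
    case False
    then show ?thesis by (auto simp: in_keys_iff lookup_single when_def)
  qed
qed

text \<open>The generators are found like a Groebner basis, by the position of the first nonzero entry.\<close>

lemma multigraded_finitely_generated:
  fixes M :: "(nat \<Rightarrow> ('x::finite, 'k::field) mpoly) set"
  assumes M: "multigraded n A M"
  shows "\<exists>H. finite H \<and> (\<forall>h\<in>H. snd h \<in> M \<and> multihom n A (fst h) (snd h)) \<and> (\<forall>v\<in>M. spans n H v)"
proof -
  \<comment> \<open>\<open>l\<close> is the position of the first nonzero entry; Dickson's lemma is
    applied to the multidegrees at each position separately.\<close>
  define lead where "lead l b v \<longleftrightarrow> v \<in> M \<and> multihom n A b v \<and> v l \<noteq> 0 \<and> (\<forall>l'<l. v l' = 0)" for l b v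
  have "\<forall>l. \<exists>F\<subseteq>{b. \<exists>v. lead l b v}. finite F \<and> (\<forall>b\<in>{b. \<exists>v. lead l b v}. \<exists>b'\<in>F. b' \<preceq> b)"
    using dickson by blast
  from choice[OF this] obtain F where F: "\<forall>l. F l \<subseteq> {b. \<exists>v. lead l b v} \<and> finite (F l) \<and> (\<forall>b\<in>{b. \<exists>v. lead l b v}. \<exists>b'\<in>F l. b' \<preceq> b)" ..
  define V where "V l b = (SOME v. lead l b v)" for l b
  have V: "lead l b (V l b)" if "b \<in> F l" for l b
  proof -
    have "\<exists>v. lead l b v" using F that by blast
    then show ?thesis unfolding V_def by (rule someI_ex)
  qed
  define H where "H = (\<Union>l<n. (\<lambda>b. (b, V l b)) ` F l)"
  have fin: "finite H" unfolding H_def using F by blast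
  have HM: "\<forall>h\<in>H. snd h \<in> M \<and> multihom n A (fst h) (snd h)" unfolding H_def using V by (auto simp: lead_def)
  \<comment> \<open>\<open>k\<close> counts the trailing positions that may be nonzero; clearing the
    first nonzero entry lowers it.\<close>
  have hom: "spans n H v" if "v \<in> M" "multihom n A b v" "\<forall>l'<n - k. v l' = 0" for v b k
    using that
  proof (induction k arbitrary: v)
    case 0
    then show ?case by (intro spans_zero) simp
  next
    case (Suc k)
    show ?case
    proof (cases "n - Suc k < n \<and> v (n - Suc k) \<noteq> 0")
      case False
      have "v l' = 0" if "l' < n - k" for l'
      proof -
        have "l' < n - Suc k \<or> l' = n - Suc k" "l' < n" using that by linarith+
        then show ?thesis using Suc.prems(3) False by auto
      qed
      then show ?thesis using Suc.IH Suc.prems by blast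
    next
      case True
      define l where "l = n - Suc k"
      have l: "l < n" "v l \<noteq> 0" "\<forall>l'<l. v l' = 0" using True Suc.prems(3) by (auto simp: l_def)
      have "lead l b v" using Suc.prems l by (simp add: lead_def)
      then obtain b' where b': "b' \<in> F l" "b' \<preceq> b" using F by blast
      define g where "g = V l b'"
      have g: "lead l b' g" using V[OF b'(1)] by (simp add: g_def)
      obtain \<gamma> where \<gamma>: "\<gamma> \<in> keys (v l)" using l(2) by (metis ex_in_conv keys_eq_empty)
      obtain \<gamma>' where \<gamma>': "\<gamma>' \<in> keys (g l)" using g by (metis ex_in_conv keys_eq_empty lead_def)
      have eqs: "\<gamma> + A l = b" "\<gamma>' + A l = b'" using Suc.prems(2) g l(1) \<gamma> \<gamma>' by (auto simp: lead_def multihom_def)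
      define \<delta> where "\<delta> = b - b'"
      have \<delta>: "\<delta> + b' = b" using exp_le_minus[OF b'(2)] by (simp add: \<delta>_def)
      have "(\<delta> + \<gamma>') + A l = \<gamma> + A l" using \<delta> eqs by (simp add: add.assoc)
      then have \<delta>\<gamma>: "\<delta> + \<gamma>' = \<gamma>" by simp
      \<comment> \<open>Both entries at \<open>l\<close> are scalar multiples of monomials, so
        \<open>c * g\<close> cancels the entry of \<open>v\<close> completely.\<close>
      define c where "c = single \<delta> (lookup (v l) \<gamma> / lookup (g l) \<gamma>')"
      define v' where "v' m = v m + (- c) * g m" for m
      have "v l = single \<gamma> (lookup (v l) \<gamma>)"
        by (rule keys_single_eq[of _ "A l" b]) (use Suc.prems(2) l(1) eqs in \<open>auto simp: multihom_def\<close>)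
      moreover have "g l = single \<gamma>' (lookup (g l) \<gamma>')"
        by (rule keys_single_eq[of _ "A l" b']) (use g l(1) eqs in \<open>auto simp: multihom_def lead_def\<close>)
      then have "c * g l = c * single \<gamma>' (lookup (g l) \<gamma>')" by (rule arg_cong)
      then have "c * g l = single \<gamma> (lookup (v l) \<gamma>)"
        using \<gamma>' by (simp add: c_def mult_single \<delta>\<gamma> in_keys_iff)
      ultimately have "v' l = 0" by (simp add: v'_def)
      moreover have "v' l' = 0" if "l' < l" for l' using l(3) g that by (simp add: v'_def lead_def)
      moreover have "l' < l \<or> l' = l" if "l' < n - k" for l' using that unfolding l_def by linarith
      ultimately have z: "\<forall>l'<n - k. v' l' = 0" by blast
      have "(\<lambda>m. (- c) * g m) \<in> M" using M g unfolding multigraded_def lead_def by blast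
      moreover have "(\<lambda>l. v1 l + v2 l) \<in> M" if "v1 \<in> M" "v2 \<in> M" for v1 v2
        using M that by (simp add: multigraded_def)
      ultimately have "(\<lambda>m. v m + (- c) * g m) \<in> M" using Suc.prems(1) by fast
      then have "v' \<in> M" by (simp add: v'_def[abs_def])
      moreover have "multihom n A b v'"
        unfolding multihom_def
      proof (intro allI impI ballI)
        fix m \<epsilon> assume m: "m < n" "\<epsilon> \<in> keys (v' m)"
        then consider "\<epsilon> \<in> keys (v m)" | "\<epsilon> \<in> keys (- c * g m)"
          unfolding v'_def using Poly_Mapping.keys_add[of "v m" "- c * g m"] by auto
        then show "\<epsilon> + A m = b"
        proof cases
          case 1 then show ?thesis using Suc.prems(2) m by (simp add: multihom_def)
        next
          case 2
          then obtain \<alpha> \<beta> where ab: "\<epsilon> = \<alpha> + \<beta>" "\<alpha> \<in> keys (- c)" "\<beta> \<in> keys (g m)"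
            using keys_mult[of "- c" "g m"] by blast
          have "\<alpha> = \<delta>" using ab(2) by (auto simp: c_def in_keys_iff lookup_single when_def split: if_splits)
          moreover have "\<beta> + A m = b'" using g ab(3) m(1) by (simp add: lead_def multihom_def)
          ultimately show ?thesis using \<delta> by (simp add: ab(1) add.assoc)
        qed
      qed
      ultimately have "spans n H v'" using Suc.IH z by blast
      moreover have "spans n H g"
        using spans_member[OF fin, of "(b', g)" n] b'(1) l(1) by (auto simp: H_def g_def)
      ultimately have "spans n H (\<lambda>m. v' m + c * g m)" by (intro spans_add spans_mult)
      then show ?thesis by (rule spans_cong) (simp add: v'_def)
    qed
  qed
  have "spans n H v" if v: "v \<in> M" for v
  proof -
    \<comment> \<open>The finitely many multidegrees occurring in \<open>v\<close>; the components
      of these degrees lie in \<open>M\<close> and add up to \<open>v\<close>.\<close>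
    define B where "B = (\<Union>l<n. (\<lambda>\<gamma>. \<gamma> + A l) ` keys (v l))"
    define f where "f b l = poly_filter (\<lambda>\<gamma>. \<gamma> + A l = b) (v l)" for b l
    have "spans n H (f b)" for b
    proof (rule hom[where k = n])
      show "f b \<in> M" using M v unfolding multigraded_def f_def by blast
      show "multihom n A b (f b)" by (simp add: multihom_def f_def)
    qed simp
    then have "spans n H (\<lambda>l. \<Sum>b\<in>B. f b l)" by (intro spans_sum)
    then show ?thesis
    proof (rule spans_cong)
      fix l assume l: "l < n"
      have "finite B" by (simp add: B_def)
      show "(\<Sum>b\<in>B. f b l) = v l"
      proof (rule poly_mapping_eqI)
        fix \<gamma>
        have "lookup (\<Sum>b\<in>B. f b l) \<gamma> = (if \<gamma> + A l \<in> B then lookup (v l) \<gamma> else 0)"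
          using \<open>finite B\<close> by (simp add: lookup_sum f_def)
        moreover have "\<gamma> + A l \<in> B" if "\<gamma> \<in> keys (v l)" using l that by (auto simp: B_def)
        ultimately show "lookup (\<Sum>b\<in>B. f b l) \<gamma> = lookup (v l) \<gamma>"
          by (auto simp: in_keys_iff)
      qed
    qed
  qed
  then show ?thesis using fin HM by blast
qed

text \<open>Take a multihomogeneous generating set of least cardinality. A relation with a nonzero
  constant term in some coefficient would make that generator redundant; the resulting condition on
  relations becomes the minimality of the next map.\<close>

lemma multigraded_minimal_generators:
  fixes M :: "(nat \<Rightarrow> ('x::finite, 'k::field) mpoly) set"
  assumes M: "multigraded n A M"
  shows "\<exists>(n'::nat) A' g. (\<forall>m<n'. (\<lambda>l. g l m) \<in> M) \<and> (\<forall>l<n. \<forall>m<n'. \<forall>\<gamma>\<in>keys (g l m). \<gamma> + A l = A' m) \<and>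
    (\<forall>v\<in>M. \<exists>w. \<forall>l<n. v l = (\<Sum>m<n'. g l m * w m)) \<and>
    (\<forall>w. (\<forall>l<n. (\<Sum>m<n'. g l m * w m) = 0) \<longrightarrow> (\<forall>m<n'. w m \<in> (variables_ideal :: ('x, 'k) mpoly set)))"
proof -
  define gen where "gen H \<longleftrightarrow> finite H \<and> (\<forall>h\<in>H. snd h \<in> M \<and> multihom n A (fst h) (snd h)) \<and> (\<forall>v\<in>M. spans n H v)" for H
  obtain H0 where "gen H0" using multigraded_finitely_generated[OF M] unfolding gen_def by blast
  then obtain H where H: "gen H" "\<And>H'. gen H' \<Longrightarrow> card H \<le> card H'" using ex_has_least_nat[of gen H0 card] by blast
  have fin: "finite H" and HM: "\<And>h. h \<in> H \<Longrightarrow> snd h \<in> M" "\<And>h. h \<in> H \<Longrightarrow> multihom n A (fst h) (snd h)"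
    and Hs: "\<And>v. v \<in> M \<Longrightarrow> spans n H v" using H(1) by (auto simp: gen_def)
  have rel: "lookup (w h0) 0 = 0" if w: "\<forall>l<n. (\<Sum>h\<in>H. w h * snd h l) = 0" and h0: "h0 \<in> H" for w h0
  proof (rule ccontr)
    assume c0: "lookup (w h0) 0 \<noteq> 0"
    define c where "c = lookup (w h0) 0"
    \<comment> \<open>Restricted to the multidegree of \<open>h0\<close>, the relation has a nonzero
      constant as its coefficient at \<open>h0\<close>.\<close>
    define w' where "w' h = poly_filter (\<lambda>\<delta>. \<delta> + fst h = fst h0) (w h)" for h
    have w'0: "w' h0 = single 0 c"
      by (rule poly_mapping_eqI) (auto simp: w'_def c_def lookup_single when_def)
    have w'sum: "(\<Sum>h\<in>H. w' h * snd h l) = 0" if l: "l < n" for l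
    proof -
      have "poly_filter (\<lambda>\<gamma>. \<gamma> + A l = fst h0) (w h * snd h l) = w' h * snd h l" if h: "h \<in> H" for h
        unfolding w'_def
      proof (rule poly_filter_mult)
        fix \<alpha> \<beta> assume "\<beta> \<in> keys (snd h l)"
        then have "\<beta> + A l = fst h" using HM(2)[OF h] l by (simp add: multihom_def)
        then show "(\<alpha> + \<beta> + A l = fst h0) \<longleftrightarrow> (\<alpha> + fst h = fst h0)" by (simp add: add.assoc)
      qed
      then have "(\<Sum>h\<in>H. w' h * snd h l) = (\<Sum>h\<in>H. poly_filter (\<lambda>\<gamma>. \<gamma> + A l = fst h0) (w h * snd h l))" by simp
      also have "\<dots> = poly_filter (\<lambda>\<gamma>. \<gamma> + A l = fst h0) (\<Sum>h\<in>H. w h * snd h l)" by (simp only: poly_filter_sum)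
      finally show ?thesis using w l by simp
    qed
    define e where "e = single 0 (1 / c) * (1 :: ('x, 'k) mpoly)"
    have e: "e * single 0 c = 1" using c0 by (simp add: e_def c_def mult_single)
    have h0l: "snd h0 l = (\<Sum>h\<in>H - {h0}. (- e * w' h) * snd h l)" if "l < n" for l
    proof -
      have "w' h0 * snd h0 l + (\<Sum>h\<in>H - {h0}. w' h * snd h l) = 0"
        using w'sum[OF that] sum.remove[OF fin h0, of "\<lambda>h. w' h * snd h l"] by simp
      then have "single 0 c * snd h0 l = - (\<Sum>h\<in>H - {h0}. w' h * snd h l)"
        unfolding w'0 by (simp only: eq_neg_iff_add_eq_0)
      then have "e * (single 0 c * snd h0 l) = e * - (\<Sum>h\<in>H - {h0}. w' h * snd h l)" by simp
      then have "snd h0 l = e * - (\<Sum>h\<in>H - {h0}. w' h * snd h l)" using e by (simp flip: mult.assoc)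
      then show ?thesis by (simp add: sum_distrib_left mult.assoc sum_negf)
    qed
    have "spans n (H - {h0}) (snd h0)" unfolding spans_def
      by (rule exI[of _ "\<lambda>h. - e * w' h"]) (use h0l in blast)
    then have "spans n (H - {h0}) (snd h)" if "h \<in> H" for h
      using spans_member[of "H - {h0}" h n] fin that by (cases "h = h0") auto
    then have "\<forall>v\<in>M. spans n (H - {h0}) v" using spans_trans[OF Hs] by blast
    then have "gen (H - {h0})" using fin HM by (simp add: gen_def)
    then have "card H \<le> card (H - {h0})" by (rule H(2))
    then show False using card_Diff1_less[OF fin h0] by simp
  qed
  obtain hs where hs: "set hs = H" "distinct hs" using finite_distinct_list[OF fin] by blast
  have sumH: "(\<Sum>h\<in>H. f h) = (\<Sum>m<length hs. f (hs ! m))" for f :: "_ \<Rightarrow> ('x, 'k) mpoly"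
    using sum.reindex_bij_betw[OF bij_betw_nth[OF hs(2) refl hs(1)[symmetric]], of f] by simp
  have nth: "hs ! m \<in> H" if "m < length hs" for m using that hs(1) nth_mem by blast
  show ?thesis
  proof (rule exI[of _ "length hs"], rule exI[of _ "\<lambda>m. fst (hs ! m)"], rule exI[of _ "\<lambda>l m. snd (hs ! m) l"],
      intro conjI allI impI ballI)
    show "(\<lambda>l. snd (hs ! m) l) \<in> M" if "m < length hs" for m using HM(1)[OF nth[OF that]] by simp
    show "\<gamma> + A l = fst (hs ! m)" if "l < n" "m < length hs" "\<gamma> \<in> keys (snd (hs ! m) l)" for l m \<gamma>
      using HM(2)[OF nth[OF that(2)]] that by (simp add: multihom_def)
    show "\<exists>w. \<forall>l<n. v l = (\<Sum>m<length hs. snd (hs ! m) l * w m)" if v: "v \<in> M" for v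
    proof -
      obtain w where w: "\<forall>l<n. v l = (\<Sum>h\<in>H. w h * snd h l)" using Hs[OF v] by (auto simp: spans_def)
      show ?thesis by (rule exI[of _ "\<lambda>m. w (hs ! m)"]) (simp add: w sumH mult.commute)
    qed
    fix w m assume w: "\<forall>l<n. (\<Sum>m<length hs. snd (hs ! m) l * w m) = 0" and m: "m < length hs"
    define w' where "w' h = w (THE m. m < length hs \<and> hs ! m = h)" for h
    have w': "w' (hs ! m) = w m" if "m < length hs" for m
    proof -
      have "(THE m'. m' < length hs \<and> hs ! m' = hs ! m) = m"
        by (rule the_equality) (use that nth_eq_iff_index_eq[OF hs(2)] in auto)
      then show ?thesis by (simp add: w'_def)
    qed
    have "\<forall>l<n. (\<Sum>h\<in>H. w' h * snd h l) = 0" using w by (simp add: sumH w' mult.commute)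
    from rel[OF this nth[OF m]] show "w m \<in> variables_ideal" by (simp add: in_variables_ideal w' m)
  qed
qed

text \<open>The matrix entries are multihomogeneous, so the components of a relation are again
  relations.\<close>

lemma multigraded_kernel:
  fixes \<Phi> :: "nat \<Rightarrow> nat \<Rightarrow> ('x::finite, 'k::field) mpoly"
  assumes h: "\<forall>l<r. \<forall>m<n. \<forall>\<gamma>\<in>keys (\<Phi> l m). \<gamma> + B l = A m"
  shows "multigraded n A {w. \<forall>l<r. (\<Sum>m<n. \<Phi> l m * w m) = 0}"
  unfolding multigraded_def
proof (intro conjI ballI allI)
  fix b w assume w: "w \<in> {w. \<forall>l<r. (\<Sum>m<n. \<Phi> l m * w m) = 0}"
  show "(\<lambda>l. poly_filter (\<lambda>\<gamma>. \<gamma> + A l = b) (w l)) \<in> {w. \<forall>l<r. (\<Sum>m<n. \<Phi> l m * w m) = 0}"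
  proof (intro CollectI allI impI)
    fix l assume l: "l < r"
    have "\<Phi> l m * poly_filter (\<lambda>\<gamma>. \<gamma> + A m = b) (w m) = poly_filter (\<lambda>\<gamma>. \<gamma> + B l = b) (\<Phi> l m * w m)" if m: "m < n" for m
    proof -
      have "poly_filter (\<lambda>\<gamma>. \<gamma> + B l = b) (w m * \<Phi> l m) = poly_filter (\<lambda>\<gamma>. \<gamma> + A m = b) (w m) * \<Phi> l m"
      proof (rule poly_filter_mult)
        fix \<alpha> \<beta> assume "\<beta> \<in> keys (\<Phi> l m)"
        then have "\<beta> + B l = A m" using h l m by blast
        then show "(\<alpha> + \<beta> + B l = b) \<longleftrightarrow> (\<alpha> + A m = b)" by (simp add: add.assoc)
      qed
      then show ?thesis by (simp add: mult.commute)
    qed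
    then have "(\<Sum>m<n. \<Phi> l m * poly_filter (\<lambda>\<gamma>. \<gamma> + A m = b) (w m)) = poly_filter (\<lambda>\<gamma>. \<gamma> + B l = b) (\<Sum>m<n. \<Phi> l m * w m)"
      by (simp add: poly_filter_sum)
    then show "(\<Sum>m<n. \<Phi> l m * poly_filter (\<lambda>\<gamma>. \<gamma> + A m = b) (w m)) = 0" using w l by simp
  qed
next
  fix c w assume "w \<in> {w. \<forall>l<r. (\<Sum>m<n. \<Phi> l m * w m) = 0}"
  then have "\<forall>l<r. c * (\<Sum>m<n. \<Phi> l m * w m) = 0" by simp
  then show "(\<lambda>l. c * w l) \<in> {w. \<forall>l<r. (\<Sum>m<n. \<Phi> l m * w m) = 0}" by (simp add: sum_distrib_left mult.left_commute)
qed (simp_all add: distrib_left sum.distrib)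

text \<open>Minimal generators of kernels are taken repeatedly, beginning with the ideal. Degrees
  are still exponents here; \<open>minimal_resolution_exists\<close> passes to matrices and total
  degrees.\<close>

lemma minimal_free_resolution_functions:
  fixes S :: "('x::finite \<Rightarrow>\<^sub>0 nat) set"
  assumes S: "up_closed S"
  shows "\<exists>(r :: nat \<Rightarrow> nat) n A (\<Phi> :: nat \<Rightarrow> nat \<Rightarrow> nat \<Rightarrow> ('x, 'k::field) mpoly). r 0 = 1 \<and> (\<forall>q. r (Suc q) = n q) \<and>
     (\<forall>m<n 0. \<forall>\<gamma>\<in>keys (\<Phi> 0 0 m). \<gamma> = A 0 m) \<and>
     (\<forall>f. f \<in> exp_span S \<longleftrightarrow> (\<exists>w. f = (\<Sum>m<n 0. \<Phi> 0 0 m * w m))) \<and>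
     (\<forall>q. (\<forall>l<n q. \<forall>m<n (Suc q). (\<forall>\<gamma>\<in>keys (\<Phi> (Suc q) l m). \<gamma> + A q l = A (Suc q) m) \<and>
         \<Phi> (Suc q) l m \<in> variables_ideal) \<and>
       (\<forall>v. (\<forall>l<r q. (\<Sum>m<n q. \<Phi> q l m * v m) = 0) \<longleftrightarrow> (\<exists>w. \<forall>m<n q. v m = (\<Sum>m'<n (Suc q). \<Phi> (Suc q) m m' * w m'))))"
proof -
  \<comment> \<open>A state is one map: target rank \<open>r\<close> with degrees \<open>B\<close>,
    source rank \<open>n\<close> with degrees \<open>A\<close>, and the entries. The condition on
    relations in \<open>good\<close> yields the minimality of the next map in
    \<open>step\<close>.\<close>
  define good :: "nat \<times> (nat \<Rightarrow> 'x \<Rightarrow>\<^sub>0 nat) \<times> nat \<times> (nat \<Rightarrow> 'x \<Rightarrow>\<^sub>0 nat) \<times> (nat \<Rightarrow> nat \<Rightarrow> ('x, 'k) mpoly) \<Rightarrow> bool"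
    where "good = (\<lambda>(r, B, n, A, \<Phi>). (\<forall>l<r. \<forall>m<n. \<forall>\<gamma>\<in>keys (\<Phi> l m). \<gamma> + B l = A m) \<and>
     (\<forall>w. (\<forall>l<r. (\<Sum>m<n. \<Phi> l m * w m) = 0) \<longrightarrow> (\<forall>m<n. w m \<in> (variables_ideal :: ('x, 'k) mpoly set))))"
  define start :: "nat \<times> (nat \<Rightarrow> 'x \<Rightarrow>\<^sub>0 nat) \<times> nat \<times> (nat \<Rightarrow> 'x \<Rightarrow>\<^sub>0 nat) \<times> (nat \<Rightarrow> nat \<Rightarrow> ('x, 'k) mpoly) \<Rightarrow> bool"
    where "start = (\<lambda>(r, B, n, A, \<Phi>). r = 1 \<and> B = (\<lambda>_. 0) \<and> (\<forall>f. f \<in> exp_span S \<longleftrightarrow> (\<exists>w. f = (\<Sum>m<n. \<Phi> 0 m * w m))))"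
  define step :: "nat \<times> (nat \<Rightarrow> 'x \<Rightarrow>\<^sub>0 nat) \<times> nat \<times> (nat \<Rightarrow> 'x \<Rightarrow>\<^sub>0 nat) \<times> (nat \<Rightarrow> nat \<Rightarrow> ('x, 'k) mpoly) \<Rightarrow> nat \<times> (nat \<Rightarrow> 'x \<Rightarrow>\<^sub>0 nat) \<times> nat \<times> (nat \<Rightarrow> 'x \<Rightarrow>\<^sub>0 nat) \<times> (nat \<Rightarrow> nat \<Rightarrow> ('x, 'k) mpoly) \<Rightarrow> bool"
    where "step = (\<lambda>(r, B, n, A, \<Phi>) (r', B', n', A', \<Phi>'). r' = n \<and> B' = A \<and>
     (\<forall>l<n. \<forall>m<n'. \<Phi>' l m \<in> (variables_ideal :: ('x, 'k) mpoly set)) \<and>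
     (\<forall>v. (\<forall>l<r. (\<Sum>m<n. \<Phi> l m * v m) = 0) \<longleftrightarrow> (\<exists>w. \<forall>m<n. v m = (\<Sum>m'<n'. \<Phi>' m m' * w m'))))"
  have "\<exists>s. good s \<and> start s"
  proof -
    define M where "M = {v :: nat \<Rightarrow> ('x, 'k) mpoly. v 0 \<in> (exp_span S :: ('x, 'k) mpoly set)}"
    have id: "is_ideal (exp_span S :: ('x, 'k) mpoly set)" by (rule is_ideal_exp_span[OF S])
    have "multigraded 1 (\<lambda>_. 0) M"
      using id unfolding multigraded_def M_def is_ideal_iff by (auto simp: exp_span_def)
    from multigraded_minimal_generators[OF this] obtain n :: nat and A g where g:
      "\<forall>m<n. (\<lambda>l. g l m) \<in> M" "\<forall>l<1. \<forall>m<n. \<forall>\<gamma>\<in>keys (g l m). \<gamma> + 0 = A m"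
      "\<forall>v\<in>M. \<exists>w. \<forall>l<1. v l = (\<Sum>m<n. g l m * w m)"
      "\<forall>w. (\<forall>l<1. (\<Sum>m<n. g l m * w m) = 0) \<longrightarrow> (\<forall>m<n. w m \<in> (variables_ideal :: ('x, 'k) mpoly set))"
      by (elim exE conjE)
    have "f \<in> exp_span S \<longleftrightarrow> (\<exists>w. f = (\<Sum>m<n. g 0 m * w m))" for f
    proof
      assume "f \<in> exp_span S"
      then have "(\<lambda>_. f) \<in> M" by (simp add: M_def)
      from bspec[OF g(3) this] show "\<exists>w. f = (\<Sum>m<n. g 0 m * w m)" by auto
    next
      assume "\<exists>w. f = (\<Sum>m<n. g 0 m * w m)"
      then obtain w where "f = (\<Sum>m<n. g 0 m * w m)" by blast
      moreover have "g 0 m * w m \<in> exp_span S" if "m < n" for m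
        using g(1) that by (intro is_ideal_multI2[OF id]) (simp add: M_def)
      ultimately show "f \<in> exp_span S" using is_ideal_sum[OF id, of "{..<n}"] by auto
    qed
    then have "start (1, \<lambda>_. 0, n, A, g)" by (simp add: start_def)
    moreover have "good (1, \<lambda>_. 0, n, A, g)" using g(2,4) by (simp add: good_def)
    ultimately show ?thesis by blast
  qed
  moreover have "\<exists>s'. good s' \<and> step s s'" if "good s" for s
  proof -
    obtain r B n A \<Phi> where s: "s = (r, B, n, A, \<Phi>)" by (cases s) auto
    have hom: "\<forall>l<r. \<forall>m<n. \<forall>\<gamma>\<in>keys (\<Phi> l m). \<gamma> + B l = A m"
      and rel: "\<forall>w. (\<forall>l<r. (\<Sum>m<n. \<Phi> l m * w m) = 0) \<longrightarrow> (\<forall>m<n. w m \<in> (variables_ideal :: ('x, 'k) mpoly set))"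
      using that by (simp_all add: s good_def)
    let ?M = "{w. \<forall>l<r. (\<Sum>m<n. \<Phi> l m * w m) = 0}"
    obtain n' :: nat and A' g where g: "\<forall>m<n'. (\<lambda>l. g l m) \<in> ?M" "\<forall>l<n. \<forall>m<n'. \<forall>\<gamma>\<in>keys (g l m). \<gamma> + A l = A' m"
      "\<forall>v\<in>?M. \<exists>w. \<forall>l<n. v l = (\<Sum>m<n'. g l m * w m)"
      "\<forall>w. (\<forall>l<n. (\<Sum>m<n'. g l m * w m) = 0) \<longrightarrow> (\<forall>m<n'. w m \<in> (variables_ideal :: ('x, 'k) mpoly set))"
      using multigraded_minimal_generators[OF multigraded_kernel[OF hom]] by (elim exE conjE)
    have "g l m \<in> variables_ideal" if "l < n" "m < n'" for l m
      using rel[rule_format, of "\<lambda>l. g l m" l] g(1) that by simp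
    moreover have "\<forall>l<r. (\<Sum>m<n. \<Phi> l m * v m) = 0" if v: "\<forall>m<n. v m = (\<Sum>m'<n'. g m m' * w m')" for v w
    proof (intro allI impI)
      fix l assume l: "l < r"
      have "(\<Sum>m<n. \<Phi> l m * v m) = (\<Sum>m<n. \<Sum>m'<n'. (\<Phi> l m * g m m') * w m')"
        using v by (simp add: sum_distrib_left mult.assoc)
      also have "\<dots> = (\<Sum>m'<n'. (\<Sum>m<n. \<Phi> l m * g m m') * w m')" by (subst sum.swap) (simp add: sum_distrib_right)
      also have "\<dots> = 0" using g(1) l by simp
      finally show "(\<Sum>m<n. \<Phi> l m * v m) = 0" .
    qed
    then have "(\<forall>l<r. (\<Sum>m<n. \<Phi> l m * v m) = 0) \<longleftrightarrow> (\<exists>w. \<forall>m<n. v m = (\<Sum>m'<n'. g m m' * w m'))" for v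
      using g(3) by blast
    ultimately have "step s (n, A, n', A', g)" by (simp add: step_def s)
    moreover have "good (n, A, n', A', g)" using g(2,4) by (simp add: good_def)
    ultimately show ?thesis by blast
  qed
  ultimately have "\<exists>f. \<forall>q. (good (f q) \<and> (q = 0 \<longrightarrow> start (f q))) \<and> step (f q) (f (Suc q))"
    by (intro dependent_nat_choice) auto
  then obtain f where f: "\<And>q. good (f q)" "start (f 0)" "\<And>q. step (f q) (f (Suc q))" by metis
  define r where "r q = fst (f q)" for q
  define B where "B q = fst (snd (f q))" for q
  define n where "n q = fst (snd (snd (f q)))" for q
  define A where "A q = fst (snd (snd (snd (f q))))" for q
  define \<Phi> where "\<Phi> q = snd (snd (snd (snd (f q))))" for q
  have fq: "f q = (r q, B q, n q, A q, \<Phi> q)" for q by (simp add: r_def B_def n_def A_def \<Phi>_def)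
  note * = f[unfolded fq good_def start_def step_def prod.case]
  show ?thesis
  proof (rule exI[of _ r], rule exI[of _ n], rule exI[of _ A], rule exI[of _ \<Phi>], intro conjI)
    show "r 0 = 1" using *(2) by simp
    show "\<forall>q. r (Suc q) = n q" using *(3) by simp
    show "\<forall>m<n 0. \<forall>\<gamma>\<in>keys (\<Phi> 0 0 m). \<gamma> = A 0 m" using *(1)[of 0] *(2) by simp
    show "\<forall>g. g \<in> exp_span S \<longleftrightarrow> (\<exists>w. g = (\<Sum>m<n 0. \<Phi> 0 0 m * w m))" using *(2) by simp
    have rs: "r (Suc q) = n q" "B (Suc q) = A q" for q using *(3)[of q] by simp_all
    show "\<forall>q. (\<forall>l<n q. \<forall>m<n (Suc q). (\<forall>\<gamma>\<in>keys (\<Phi> (Suc q) l m). \<gamma> + A q l = A (Suc q) m) \<and>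
         \<Phi> (Suc q) l m \<in> (variables_ideal :: ('x, 'k) mpoly set)) \<and>
       (\<forall>v. (\<forall>l<r q. (\<Sum>m<n q. \<Phi> q l m * v m) = 0) \<longleftrightarrow> (\<exists>w. \<forall>m<n q. v m = (\<Sum>m'<n (Suc q). \<Phi> (Suc q) m m' * w m')))"
    proof
      fix q show "(\<forall>l<n q. \<forall>m<n (Suc q). (\<forall>\<gamma>\<in>keys (\<Phi> (Suc q) l m). \<gamma> + A q l = A (Suc q) m) \<and>
         \<Phi> (Suc q) l m \<in> (variables_ideal :: ('x, 'k) mpoly set)) \<and>
       (\<forall>v. (\<forall>l<r q. (\<Sum>m<n q. \<Phi> q l m * v m) = 0) \<longleftrightarrow> (\<exists>w. \<forall>m<n q. v m = (\<Sum>m'<n (Suc q). \<Phi> (Suc q) m m' * w m')))"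
        using *(1)[of "Suc q"] *(3)[of q] by (simp add: rs)
    qed
  qed
qed

section \<open>Translation to matrices\<close>

lemma mult_mat_vec_sum:
  assumes "A \<in> carrier_mat r n" "w \<in> carrier_vec n" "l < r"
  shows "vec_index (A *\<^sub>v w) l = (\<Sum>m<n. A $$ (l, m) * vec_index w m)"
  using assms by (simp add: scalar_prod_def lessThan_atLeast0)

lemma mat_kernel_iff:
  assumes "A \<in> carrier_mat r n" "v \<in> carrier_vec n"
  shows "v \<in> mat_kernel A \<longleftrightarrow> (\<forall>l<r. (\<Sum>m<n. A $$ (l, m) * vec_index v m) = 0)"
proof -
  have "v \<in> mat_kernel A \<longleftrightarrow> A *\<^sub>v v = 0\<^sub>v r" using assms by (auto simp: mat_kernel_def)
  also have "\<dots> \<longleftrightarrow> (\<forall>l<r. vec_index (A *\<^sub>v v) l = 0)" using assms by (auto simp: Matrix.vec_eq_iff)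
  finally show ?thesis using mult_mat_vec_sum[OF assms] by simp
qed

lemma minimal_resolution_exists:
  fixes S :: "('x::finite \<Rightarrow>\<^sub>0 nat) set"
  assumes S: "up_closed S"
  shows "\<exists>d \<phi>. minimal_graded_free_resolution (exp_span S :: ('x, 'k::field) mpoly set) d \<phi>"
proof -
  obtain r n A and \<Phi> :: "nat \<Rightarrow> nat \<Rightarrow> nat \<Rightarrow> ('x, 'k) mpoly" where R: "r 0 = 1" "\<forall>q. r (Suc q) = n q"
     "\<forall>m<n 0. \<forall>\<gamma>\<in>keys (\<Phi> 0 0 m). \<gamma> = A 0 m"
     "\<forall>f :: ('x, 'k) mpoly. f \<in> exp_span S \<longleftrightarrow> (\<exists>w. f = (\<Sum>m<n 0. \<Phi> 0 0 m * w m))"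
     "\<forall>q. (\<forall>l<n q. \<forall>m<n (Suc q). (\<forall>\<gamma>\<in>keys (\<Phi> (Suc q) l m). \<gamma> + A q l = A (Suc q) m) \<and>
         \<Phi> (Suc q) l m \<in> variables_ideal) \<and>
       (\<forall>v. (\<forall>l<r q. (\<Sum>m<n q. \<Phi> q l m * v m) = 0) \<longleftrightarrow> (\<exists>w. \<forall>m<n q. v m = (\<Sum>m'<n (Suc q). \<Phi> (Suc q) m m' * w m')))"
    using minimal_free_resolution_functions[OF S, where 'k = 'k] by (elim exE conjE)
  define d where "d q = map (\<lambda>m. int (mdeg (A q m))) [0..<n q]" for q
  define \<phi> where "\<phi> q = mat (r q) (n q) (\<lambda>(l, m). \<Phi> q l m)" for q
  have car: "\<phi> q \<in> carrier_mat (r q) (n q)" for q by (simp add: \<phi>_def)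
  have len: "length (d q) = n q" for q by (simp add: d_def)
  have ent: "\<phi> q $$ (l, m) = \<Phi> q l m" if "l < r q" "m < n q" for q l m using that by (simp add: \<phi>_def)
  have mult: "vec_index (\<phi> q *\<^sub>v w) l = (\<Sum>m<n q. \<Phi> q l m * vec_index w m)" if "w \<in> carrier_vec (n q)" "l < r q" for q w l
    using mult_mat_vec_sum[OF car that] ent[OF that(2)] by simp
  have F1: "(\<lambda>w. vec_index (\<phi> 0 *\<^sub>v w) 0) ` carrier_vec (n 0) = exp_span S"
  proof (intro equalityI subsetI)
    fix f assume "f \<in> (\<lambda>w. vec_index (\<phi> 0 *\<^sub>v w) 0) ` carrier_vec (n 0)"
    then obtain w where "w \<in> carrier_vec (n 0)" "f = vec_index (\<phi> 0 *\<^sub>v w) 0" by blast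
    then have "f = (\<Sum>m<n 0. \<Phi> 0 0 m * vec_index w m)" using mult[of w 0 0] R(1) by simp
    then show "f \<in> exp_span S" using R(4) by blast
  next
    fix f :: "('x, 'k) mpoly" assume "f \<in> exp_span S"
    then obtain w where "f = (\<Sum>m<n 0. \<Phi> 0 0 m * w m)" using R(4) by blast
    then have "f = vec_index (\<phi> 0 *\<^sub>v vec (n 0) w) 0" using mult[of "vec (n 0) w" 0 0] R(1) by simp
    then show "f \<in> (\<lambda>w. vec_index (\<phi> 0 *\<^sub>v w) 0) ` carrier_vec (n 0)" by (rule image_eqI) simp
  qed
  have F2: "(\<lambda>w. \<phi> (Suc q) *\<^sub>v w) ` carrier_vec (n (Suc q)) = mat_kernel (\<phi> q)" for q
  proof -
    have ker: "v \<in> mat_kernel (\<phi> q) \<longleftrightarrow> v \<in> carrier_vec (n q) \<and> (\<forall>l<r q. (\<Sum>m<n q. \<Phi> q l m * vec_index v m) = 0)" for v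
    proof (cases "v \<in> carrier_vec (n q)")
      case True
      then show ?thesis using mat_kernel_iff[OF car True] ent by simp
    next
      case False
      then show ?thesis using car[of q] by (auto simp: mat_kernel_def)
    qed
    have rq: "r (Suc q) = n q" using R(2) by simp
    have ex: "(\<forall>l<r q. (\<Sum>m<n q. \<Phi> q l m * v m) = 0) \<longleftrightarrow> (\<exists>w. \<forall>m<n q. v m = (\<Sum>m'<n (Suc q). \<Phi> (Suc q) m m' * w m'))" for v
      using R(5) by blast
    show ?thesis
    proof (intro equalityI subsetI)
      fix v assume "v \<in> (\<lambda>w. \<phi> (Suc q) *\<^sub>v w) ` carrier_vec (n (Suc q))"
      then obtain w where w: "w \<in> carrier_vec (n (Suc q))" "v = \<phi> (Suc q) *\<^sub>v w" by blast
      have "\<forall>m<n q. vec_index v m = (\<Sum>m'<n (Suc q). \<Phi> (Suc q) m m' * vec_index w m')"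
        using mult[OF w(1)] rq w(2) by simp
      then have "\<forall>l<r q. (\<Sum>m<n q. \<Phi> q l m * vec_index v m) = 0" using ex[of "vec_index v"] by blast
      moreover have "v \<in> carrier_vec (n q)" using w mult_mat_vec_carrier[OF car[of "Suc q"] w(1)] rq by simp
      ultimately show "v \<in> mat_kernel (\<phi> q)" by (simp add: ker)
    next
      fix v assume "v \<in> mat_kernel (\<phi> q)"
      then have v: "v \<in> carrier_vec (n q)" "\<forall>l<r q. (\<Sum>m<n q. \<Phi> q l m * vec_index v m) = 0" by (simp_all add: ker)
      then obtain w where w: "\<forall>m<n q. vec_index v m = (\<Sum>m'<n (Suc q). \<Phi> (Suc q) m m' * w m')" using ex[of "vec_index v"] by blast
      have "v = \<phi> (Suc q) *\<^sub>v vec (n (Suc q)) w"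
      proof (rule eq_vecI)
        show "dim_vec v = dim_vec (\<phi> (Suc q) *\<^sub>v vec (n (Suc q)) w)" using v(1) car[of "Suc q"] rq by auto
        fix m assume "m < dim_vec (\<phi> (Suc q) *\<^sub>v vec (n (Suc q)) w)"
        then have "m < n q" using car[of "Suc q"] rq by auto
        then show "vec_index v m = vec_index (\<phi> (Suc q) *\<^sub>v vec (n (Suc q)) w) m"
          using mult[of "vec (n (Suc q)) w" "Suc q" m] rq w by simp
      qed
      then show "v \<in> (\<lambda>w. \<phi> (Suc q) *\<^sub>v w) ` carrier_vec (n (Suc q))" by (rule image_eqI) simp
    qed
  qed
  have F3: "homogeneous (d 0 ! m) (\<phi> 0 $$ (0, m))" if "m < n 0" for m
    using R(1,3) that ent[of 0 0 m] by (auto simp: homogeneous_def d_def)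
  have F4: "homogeneous (d (Suc q) ! m - d q ! l) (\<phi> (Suc q) $$ (l, m))" "\<phi> (Suc q) $$ (l, m) \<in> variables_ideal"
    if lm: "l < n q" "m < n (Suc q)" for q l m
  proof -
    have e: "\<phi> (Suc q) $$ (l, m) = \<Phi> (Suc q) l m" using ent[of l "Suc q" m] R(2) lm by simp
    have "int (mdeg \<gamma>) = int (mdeg (A (Suc q) m)) - int (mdeg (A q l))" if "\<gamma> \<in> keys (\<Phi> (Suc q) l m)" for \<gamma>
    proof -
      have "\<gamma> + A q l = A (Suc q) m" using R(5) lm that by blast
      then have "mdeg (A (Suc q) m) = mdeg \<gamma> + mdeg (A q l)" by (metis mdeg_add)
      then show ?thesis by simp
    qed
    moreover have "\<Phi> (Suc q) l m \<in> variables_ideal" using R(5) lm by blast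
    ultimately show "homogeneous (d (Suc q) ! m - d q ! l) (\<phi> (Suc q) $$ (l, m))" "\<phi> (Suc q) $$ (l, m) \<in> variables_ideal"
      using lm by (simp_all add: e homogeneous_def d_def)
  qed
  have F5: "\<phi> 0 \<in> carrier_mat 1 (n 0)" using car[of 0] R(1) by simp
  have F6: "\<phi> (Suc q) \<in> carrier_mat (n q) (n (Suc q))" for q using car[of "Suc q"] R(2) by simp
  have "minimal_graded_free_resolution (exp_span S) d \<phi>"
    unfolding minimal_graded_free_resolution_def len by (intro conjI allI impI F1 F2 F3 F4 F5 F6)
  then show ?thesis by blast
qed

section \<open>Generator degrees and regularity\<close>

context
  fixes S :: "('x::finite \<Rightarrow>\<^sub>0 nat) set" and d :: "nat \<Rightarrow> int list" and \<phi> :: "nat \<Rightarrow> ('x, 'k::field) mpoly mat"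
  assumes S: "up_closed S" and R: "minimal_graded_free_resolution (exp_span S) d \<phi>"
begin

text \<open>The rank of the target of \<open>\<phi> q\<close>; the augmentation maps to the ring, of
  rank 1.\<close>

private definition rk :: "nat \<Rightarrow> nat" where "rk q = (case q of 0 \<Rightarrow> 1 | Suc q' \<Rightarrow> length (d q'))"

private lemma rk: "rk 0 = 1" "rk (Suc q) = length (d q)"
  by (simp_all add: rk_def)

private lemma car: "\<phi> q \<in> carrier_mat (rk q) (length (d q))"
  using R by (cases q) (simp_all add: minimal_graded_free_resolution_def rk_def)

private lemma hom0: "m < length (d 0) \<Longrightarrow> homogeneous (d 0 ! m) (\<phi> 0 $$ (0, m))"
  using R by (simp add: minimal_graded_free_resolution_def)

private lemma img0: "(\<lambda>w. vec_index (\<phi> 0 *\<^sub>v w) 0) ` carrier_vec (length (d 0)) = exp_span S"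
  using R by (simp add: minimal_graded_free_resolution_def)

private lemma ent: "l < length (d q) \<Longrightarrow> m < length (d (Suc q)) \<Longrightarrow>
    homogeneous (d (Suc q) ! m - d q ! l) (\<phi> (Suc q) $$ (l, m)) \<and> \<phi> (Suc q) $$ (l, m) \<in> variables_ideal"
  using R by (simp add: minimal_graded_free_resolution_def)

private lemma ker: "(\<lambda>w. \<phi> (Suc q) *\<^sub>v w) ` carrier_vec (length (d (Suc q))) = mat_kernel (\<phi> q)"
  using R by (simp add: minimal_graded_free_resolution_def)

private lemma exact:
  assumes "\<And>l. l < rk q \<Longrightarrow> (\<Sum>m<length (d q). \<phi> q $$ (l, m) * v m) = 0"
  shows "\<exists>w. \<forall>m<length (d q). v m = (\<Sum>m'<length (d (Suc q)). \<phi> (Suc q) $$ (m, m') * w m')"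
proof -
  have "vec (length (d q)) v \<in> mat_kernel (\<phi> q)"
    unfolding mat_kernel_iff[OF car vec_carrier] using assms by simp
  then obtain w where w: "w \<in> carrier_vec (length (d (Suc q)))" "vec (length (d q)) v = \<phi> (Suc q) *\<^sub>v w" using ker by blast
  have "v m = (\<Sum>m'<length (d (Suc q)). \<phi> (Suc q) $$ (m, m') * vec_index w m')" if "m < length (d q)" for m
    using mult_mat_vec_sum[OF car w(1), of m] that unfolding w(2)[symmetric] rk by simp
  then show ?thesis by blast
qed

private lemma complex:
  assumes "l < rk q" "m' < length (d (Suc q))"
  shows "(\<Sum>m<length (d q). \<phi> q $$ (l, m) * \<phi> (Suc q) $$ (m, m')) = 0"
proof -
  let ?w = "\<phi> (Suc q) *\<^sub>v unit_vec (length (d (Suc q))) m'"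
  have "?w \<in> mat_kernel (\<phi> q)" unfolding ker[symmetric] by simp
  moreover have wc: "?w \<in> carrier_vec (length (d q))" using mult_mat_vec_carrier[OF car[of "Suc q"]] rk by simp
  ultimately have "(\<Sum>m<length (d q). \<phi> q $$ (l, m) * vec_index ?w m) = 0"
    using mat_kernel_iff[OF car wc] assms(1) by blast
  moreover have "vec_index ?w m = \<phi> (Suc q) $$ (m, m')" if "m < length (d q)" for m
    using mult_mat_vec_sum[OF car, of "unit_vec (length (d (Suc q))) m'" "Suc q" m] that assms(2) rk
    by (simp add: if_distrib cong: if_cong)
  ultimately show ?thesis by simp
qed

text \<open>If column \<open>m\<close> vanished, basis element \<open>m\<close> would be a relation
  and by exactness lie in the image of the next map, whose entries have no constant term.\<close>

private lemma column_nonzero: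
  assumes "m < length (d q)"
  shows "\<exists>l<rk q. \<phi> q $$ (l, m) \<noteq> 0"
proof (rule ccontr)
  assume "\<not> (\<exists>l<rk q. \<phi> q $$ (l, m) \<noteq> 0)"
  then have z: "\<phi> q $$ (l, m) = 0" if "l < rk q" for l using that by blast
  have "(\<Sum>m'<length (d q). \<phi> q $$ (l, m') * (if m' = m then 1 else 0)) = 0" if "l < rk q" for l
    using z[OF that] by (intro sum.neutral) auto
  from exact[OF this] obtain w where
    "\<forall>i<length (d q). (if i = m then 1 else 0) = (\<Sum>m'<length (d (Suc q)). \<phi> (Suc q) $$ (i, m') * w m')" by blast
  then have "1 = (\<Sum>m'<length (d (Suc q)). \<phi> (Suc q) $$ (m, m') * w m')" using assms by auto
  also have "\<dots> \<in> variables_ideal"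
    using ent[OF assms] by (intro is_ideal_sum is_ideal_multI2 is_ideal_variables) auto
  finally show False by (simp add: in_variables_ideal)
qed

text \<open>Nonzero entries of a minimal matrix have positive degree, so degrees grow strictly along
  the resolution. This bounds the differences \<open>j - i\<close> in the regularity from
  below.\<close>

lemma resolution_degree_ge: "m < length (d q) \<Longrightarrow> int q \<le> d q ! m"
proof (induction q arbitrary: m)
  case 0
  then obtain \<alpha> where "\<alpha> \<in> keys (\<phi> 0 $$ (0, m))"
    using column_nonzero[of m 0] by (metis rk(1) less_one ex_in_conv keys_eq_empty)
  then have "int (mdeg \<alpha>) = d 0 ! m" using hom0[OF 0] by (simp add: homogeneous_def)
  then show ?case by simp
next
  case (Suc q)
  obtain l where l: "l < length (d q)" "\<phi> (Suc q) $$ (l, m) \<noteq> 0" using column_nonzero[OF Suc.prems] by (auto simp: rk)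
  obtain \<alpha> where a: "\<alpha> \<in> keys (\<phi> (Suc q) $$ (l, m))" using l(2) by (metis ex_in_conv keys_eq_empty)
  have "\<alpha> \<noteq> 0" using a ent[OF l(1) Suc.prems] by (auto simp: in_variables_ideal in_keys_iff)
  then have "mdeg \<alpha> \<noteq> 0" by (simp add: mdeg_eq_0_iff)
  moreover have "int (mdeg \<alpha>) = d (Suc q) ! m - d q ! l" using ent[OF l(1) Suc.prems] a by (simp add: homogeneous_def)
  ultimately show ?case using Suc.IH[OF l(1)] by linarith
qed

lemma resolution_degree_cone:
  assumes "m < length (d q)"
  shows "\<exists>\<alpha>\<in>S. int (mdeg \<alpha>) = d q ! m \<and> (\<nexists>j. cone_at S \<alpha> j)"
proof (rule ccontr)
  assume no: "\<not> ?thesis"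
  show False
  proof (rule resolution_degree_bound[of S rk "\<lambda>q. length (d q)" "\<lambda>q m. d q ! m" "\<lambda>q l m. \<phi> q $$ (l, m)" m q, OF S])
    have vi: "vec_index (\<phi> 0 *\<^sub>v w) 0 = (\<Sum>m<length (d 0). \<phi> 0 $$ (0, m) * vec_index w m)"
      if "w \<in> carrier_vec (length (d 0))" for w
      using mult_mat_vec_sum[OF car that, of 0] by (simp add: rk)
    show "\<phi> 0 $$ (0, i) \<in> exp_span S" if i: "i < length (d 0)" for i
    proof -
      have "vec_index (\<phi> 0 *\<^sub>v unit_vec (length (d 0)) i) 0 \<in> exp_span S" unfolding img0[symmetric] by simp
      then show ?thesis using i by (simp add: vi if_distrib cong: if_cong)
    qed
    show "\<exists>w. f = (\<Sum>m<length (d 0). \<phi> 0 $$ (0, m) * w m)" if f: "f \<in> exp_span S" for f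
    proof -
      obtain w where "w \<in> carrier_vec (length (d 0))" "f = vec_index (\<phi> 0 *\<^sub>v w) 0" using f unfolding img0[symmetric] by blast
      then show ?thesis using vi by blast
    qed
    show "\<exists>j. cone_at S \<alpha> j" if "\<alpha> \<in> S" "int (mdeg \<alpha>) = d q ! m" for \<alpha> using no that by blast
  qed (use rk hom0 ent complex exact assms in auto)
qed

text \<open>A minimal monomial can only come from an entry of the augmentation that contains it. The
  degrees of \<open>F\<^sub>0\<close> thus bound the regularity from below.\<close>

lemma resolution_minimal_exponent:
  assumes a: "\<alpha> \<in> S" "\<And>\<beta>. \<beta> \<in> S \<Longrightarrow> \<beta> \<preceq> \<alpha> \<Longrightarrow> \<beta> = \<alpha>"
  shows "\<exists>m<length (d 0). d 0 ! m = int (mdeg \<alpha>)"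
proof -
  have vi: "vec_index (\<phi> 0 *\<^sub>v w) 0 = (\<Sum>m<length (d 0). \<phi> 0 $$ (0, m) * vec_index w m)"
    if "w \<in> carrier_vec (length (d 0))" for w
    using mult_mat_vec_sum[OF car that, of 0] by (simp add: rk)
  have "monomial \<alpha> \<in> (exp_span S :: ('x, 'k) mpoly set)" using a(1) by (simp add: exp_span_def)
  then obtain w where w: "w \<in> carrier_vec (length (d 0))" "monomial \<alpha> = vec_index (\<phi> 0 *\<^sub>v w) 0"
    unfolding img0[symmetric] by blast
  have "\<alpha> \<in> keys (\<Sum>m<length (d 0). \<phi> 0 $$ (0, m) * vec_index w m)" using w vi[OF w(1)] by (metis keys_single singletonI zero_neq_one)
  then obtain m where m: "m < length (d 0)" "\<alpha> \<in> keys (\<phi> 0 $$ (0, m) * vec_index w m)"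
    using keys_sum[of "\<lambda>m. \<phi> 0 $$ (0, m) * vec_index w m" "{..<length (d 0)}"] by auto
  then obtain \<beta> \<gamma> where b: "\<alpha> = \<beta> + \<gamma>" "\<beta> \<in> keys (\<phi> 0 $$ (0, m))" using keys_mult by blast
  have "vec_index (\<phi> 0 *\<^sub>v unit_vec (length (d 0)) m) 0 \<in> exp_span S" unfolding img0[symmetric] by simp
  then have "\<phi> 0 $$ (0, m) \<in> exp_span S" using m(1) by (simp add: vi if_distrib cong: if_cong)
  then have "\<beta> \<in> S" using b(2) by (auto simp: exp_span_def)
  moreover have "\<beta> \<preceq> \<alpha>" by (simp add: b(1))
  ultimately have "\<beta> = \<alpha>" by (rule a(2))
  then show ?thesis using hom0[OF m(1)] b(2) m(1) unfolding homogeneous_def by metis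
qed

end

section \<open>Degrees of minimal generators\<close>

definition minimal_exps :: "('x \<Rightarrow>\<^sub>0 nat) set \<Rightarrow> ('x \<Rightarrow>\<^sub>0 nat) set" where
  "minimal_exps S = {\<alpha> \<in> S. \<forall>\<beta>\<in>S. \<beta> \<preceq> \<alpha> \<longrightarrow> \<beta> = \<alpha>}"

lemma minimal_exps_below:
  fixes S :: "('x::finite \<Rightarrow>\<^sub>0 nat) set"
  assumes "\<alpha> \<in> S" shows "\<exists>\<beta>\<in>minimal_exps S. \<beta> \<preceq> \<alpha>"
proof -
  have "\<alpha> \<in> S \<and> \<alpha> \<preceq> \<alpha>" using assms by simp
  from ex_has_least_nat[of "\<lambda>\<beta>. \<beta> \<in> S \<and> \<beta> \<preceq> \<alpha>", OF this, of mdeg] obtain \<beta> where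
    bb: "(\<beta> \<in> S \<and> \<beta> \<preceq> \<alpha>) \<and> (\<forall>\<gamma>. \<gamma> \<in> S \<and> \<gamma> \<preceq> \<alpha> \<longrightarrow> mdeg \<beta> \<le> mdeg \<gamma>)" ..
  note b = bb[THEN conjunct1] bb[THEN conjunct2]
  have "\<gamma> = \<beta>" if g: "\<gamma> \<in> S" "\<gamma> \<preceq> \<beta>" for \<gamma>
  proof -
    have "\<gamma> \<preceq> \<alpha>" using b(1) exp_le_trans[OF g(2)] by simp
    then have "mdeg \<beta> \<le> mdeg \<gamma>" using b(2) g(1) by simp
    then have "mdeg \<gamma> = mdeg \<beta>" using mdeg_mono[OF g(2)] by simp
    then show ?thesis by (rule exp_le_mdeg_eq[OF g(2)])
  qed
  then have "\<beta> \<in> minimal_exps S" using b(1) by (simp add: minimal_exps_def)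
  then show ?thesis using b(1) by (intro bexI[of _ \<beta>]) simp_all
qed

lemma minimal_generators_exist:
  fixes S :: "('x::finite \<Rightarrow>\<^sub>0 nat) set"
  assumes S: "up_closed S"
  shows "minimal_homogeneous_generators (exp_span S :: ('x, 'k::field) mpoly set) (monomial ` minimal_exps S)"
  unfolding minimal_homogeneous_generators_def
proof (intro conjI ballI allI impI)
  fix g :: "('x, 'k) mpoly" assume "g \<in> monomial ` minimal_exps S"
  then obtain \<alpha> where "g = monomial \<alpha>" by blast
  then show "\<exists>d. homogeneous d g" by (intro exI[of _ "int (mdeg \<alpha>)"]) (simp add: homogeneous_def)
next
  have "\<beta> \<in> S" if "\<alpha> \<in> minimal_exps S" "\<alpha> \<preceq> \<beta>" for \<alpha> \<beta>
    using that up_closed_le[OF S, of \<alpha> \<beta>] by (simp add: minimal_exps_def)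
  then have "{\<alpha>. \<exists>\<beta>\<in>minimal_exps S. \<beta> \<preceq> \<alpha>} = S" using minimal_exps_below by blast
  then show "ideal_gen (monomial ` minimal_exps S) = (exp_span S :: ('x, 'k) mpoly set)" by (simp only: ideal_gen_monomials)
next
  fix G' :: "('x, 'k) mpoly set" assume G': "G' \<subset> monomial ` minimal_exps S"
  then obtain S' where S': "S' \<subseteq> minimal_exps S" "G' = monomial ` S'" by (meson psubset_imp_subset subset_imageE)
  then obtain \<alpha> where a: "\<alpha> \<in> minimal_exps S" "\<alpha> \<notin> S'" using G' by blast
  show "ideal_gen G' \<noteq> exp_span S"
  proof
    assume "ideal_gen G' = exp_span S"
    then have "{\<alpha>. \<exists>\<beta>\<in>S'. \<beta> \<preceq> \<alpha>} = S" unfolding S'(2) ideal_gen_monomials by (metis exponents_exp_span)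
    then obtain \<beta> where "\<beta> \<in> S'" "\<beta> \<preceq> \<alpha>" using a(1) by (auto simp: minimal_exps_def)
    then show False using a S'(1) by (auto simp: minimal_exps_def)
  qed
qed

text \<open>For a homogeneous generator, truncating a multiple amounts to truncating the
  coefficient, with a shifted bound.\<close>

lemma ideal_gen_homogeneous_filter:
  fixes H :: "('x::finite, 'k::field) mpoly set"
  assumes H: "\<And>h. h \<in> H \<Longrightarrow> \<exists>e. homogeneous e h"
  assumes f: "f \<in> ideal_gen H"
  shows "poly_filter (\<lambda>\<alpha>. int (mdeg \<alpha>) < e) f \<in> ideal_gen H"
  using f unfolding ideal_gen_def
proof (induction rule: Modules.module.span_induct_alt[OF module_mult, consumes 1, case_names base step])
  case base
  show ?case using is_ideal_gen[of H] by (simp add: is_ideal_iff ideal_gen_def)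
next
  case (step c h f)
  obtain e' where e': "homogeneous e' h" using H step(1) by blast
  have "poly_filter (\<lambda>\<alpha>. int (mdeg \<alpha>) < e) (c * h) = poly_filter (\<lambda>\<alpha>. int (mdeg \<alpha>) < e - e') c * h"
    by (rule poly_filter_mult) (use e' in \<open>auto simp: homogeneous_def mdeg_add\<close>)
  moreover have "h \<in> ideal_gen H" using step(1) ideal_gen_superset by blast
  ultimately have "poly_filter (\<lambda>\<alpha>. int (mdeg \<alpha>) < e) (c * h) \<in> ideal_gen H"
    by (simp add: is_ideal_multI[OF is_ideal_gen])
  then show ?case using step is_ideal_gen[of H] by (simp add: poly_filter_add is_ideal_iff ideal_gen_def)
qed

text \<open>The generators in \<open>G\<close> may be arbitrary homogeneous polynomials, so graded
  Nakayama is used: if every exponent of degree \<open>e\<close> were a multiple of one of lower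
  degree, all terms of \<open>g\<close> would come from degrees where \<open>g\<close> does not
  contribute, and \<open>g\<close> would be redundant.\<close>

lemma generator_degree_minimal:
  fixes S :: "('x::finite \<Rightarrow>\<^sub>0 nat) set" and G :: "('x, 'k::field) mpoly set"
  assumes S: "up_closed S" and G: "minimal_homogeneous_generators (exp_span S) G" and g: "g \<in> G" "homogeneous e g"
  shows "\<exists>\<alpha>\<in>S. int (mdeg \<alpha>) = e \<and> (\<nexists>j \<beta>. \<beta> \<in> S \<and> \<alpha> = \<beta> + single j 1)"
proof (rule ccontr)
  assume no: "\<not> ?thesis"
  let ?H = "G - {g}"
  have hom: "\<And>h. h \<in> G \<Longrightarrow> \<exists>d. homogeneous d h" and gen: "ideal_gen G = exp_span S"
    and irr: "\<And>G'. G' \<subset> G \<Longrightarrow> ideal_gen G' \<noteq> exp_span S"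
    using G by (auto simp: minimal_homogeneous_generators_def)
  \<comment> \<open>Subtracting a multiple of \<open>g\<close> and truncating below degree
    \<open>e\<close> leaves \<open>f\<close> itself, now generated without \<open>g\<close>.\<close>
  have low: "f \<in> ideal_gen ?H" if f: "f \<in> exp_span S" "\<And>\<alpha>. \<alpha> \<in> keys f \<Longrightarrow> int (mdeg \<alpha>) < e" for f
  proof -
    have "f \<in> Modules.module.span (*) (insert g ?H)" using f(1) gen g(1) by (simp add: ideal_gen_def insert_absorb)
    then obtain c where "f - c * g \<in> Modules.module.span (*) ?H"
      using Modules.module.span_breakdown[OF module_mult, of g "insert g ?H" f] by auto
    then have "f - c * g \<in> ideal_gen ?H" by (simp add: ideal_gen_def)
    then have "poly_filter (\<lambda>\<alpha>. int (mdeg \<alpha>) < e) (f - c * g) \<in> ideal_gen ?H"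
      by (intro ideal_gen_homogeneous_filter hom) auto
    moreover have "poly_filter (\<lambda>\<alpha>. int (mdeg \<alpha>) < e) (f - c * g) = f"
    proof (rule poly_mapping_eqI)
      fix \<alpha>
      have "lookup (c * g) \<alpha> = 0" if "int (mdeg \<alpha>) < e"
      proof (rule ccontr)
        assume "lookup (c * g) \<alpha> \<noteq> 0"
        then obtain \<beta> \<gamma> where "\<alpha> = \<beta> + \<gamma>" "\<gamma> \<in> keys g" using keys_mult[of c g] by (auto simp: in_keys_iff)
        then show False using g(2) that by (auto simp: homogeneous_def mdeg_add)
      qed
      then show "lookup (poly_filter (\<lambda>\<alpha>. int (mdeg \<alpha>) < e) (f - c * g)) \<alpha> = lookup f \<alpha>"
        using f(2)[of \<alpha>] by (auto simp: lookup_minus in_keys_iff)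
    qed
    ultimately show ?thesis by simp
  qed
  have "g \<in> ideal_gen ?H"
  proof (rule is_ideal_keysI[OF is_ideal_gen])
    fix \<alpha> assume a: "\<alpha> \<in> keys g"
    have "g \<in> exp_span S" using gen g(1) ideal_gen_superset by blast
    then have "\<alpha> \<in> S" using a by (auto simp: exp_span_def)
    moreover have da: "int (mdeg \<alpha>) = e" using g(2) a by (simp add: homogeneous_def)
    ultimately obtain j \<beta> where b: "\<beta> \<in> S" "\<alpha> = \<beta> + single j 1" using no by blast
    have "monomial \<beta> \<in> ideal_gen ?H"
      by (rule low) (use b da in \<open>auto simp: exp_span_def mdeg_add\<close>)
    then show "monomial \<alpha> \<in> ideal_gen ?H"
      unfolding b(2) monomial_mult[symmetric] by (rule is_ideal_multI2[OF is_ideal_gen])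
  qed
  then have "insert g ?H \<subseteq> ideal_gen ?H" using ideal_gen_superset[of ?H] by (rule insert_subsetI)
  then have "G \<subseteq> ideal_gen ?H" using g(1) by (simp add: insert_absorb)
  then have "ideal_gen G \<subseteq> ideal_gen ?H" by (rule ideal_gen_least[OF _ is_ideal_gen])
  moreover have "ideal_gen ?H \<subseteq> ideal_gen G" by (rule ideal_gen_mono) auto
  ultimately have "ideal_gen ?H = exp_span S" using gen by auto
  moreover have "?H \<subset> G" using g(1) by auto
  ultimately show False using irr by blast
qed

section \<open>Asymptotics\<close>

lemma symbolic_exponents_scaled:
  fixes E :: "('x::finite \<Rightarrow>\<^sub>0 nat) set"
  assumes E: "up_closed E" and a: "\<alpha> \<in> symbolic_exponents E n" and n: "0 < n"
  shows "(1 / real n) *\<^sub>R exponent_vector \<alpha> \<in> exp_polyhedron E"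
  unfolding exp_polyhedron_def
proof
  fix T assume "T \<in> minimal_covers E"
  then have "\<alpha> \<in> exp_power (exp_loc T E) (Suc (n - 1))" using a n by (auto simp: symbolic_exponents_def)
  from exp_power_hull[OF this] obtain y where y: "y \<in> convex hull (exponent_vector ` exp_loc T E)"
    "\<forall>x. real n * vec_nth y x \<le> real (lookup \<alpha> x)" using n by auto
  show "(1 / real n) *\<^sub>R exponent_vector \<alpha> \<in> convex hull (exponent_vector ` exp_loc T E)"
    by (rule hull_up_closed[OF up_closed_exp_loc[OF E] y(1)]) (use y(2) n in \<open>simp add: field_simps\<close>)
qed

lemma coord_sum_scaled: "coord_sum ((1 / real n) *\<^sub>R exponent_vector \<alpha>) = real (mdeg \<alpha>) / real n"
  by (simp add: coord_sum_def mdeg_def sum_divide_distrib)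

text \<open>Below the scaled exponent lies a point \<open>c\<close> with coordinate sum at most
  \<open>exp_delta E\<close>. The total surplus of \<open>\<alpha>\<close> over \<open>n * c\<close>
  exceeds \<open>CARD('x) * D\<close>, so one coordinate has surplus at least
  \<open>D\<close>.\<close>

lemma symbolic_exponents_upper:
  fixes E :: "('x::finite \<Rightarrow>\<^sub>0 nat) set"
  assumes E: "up_closed E" "E \<noteq> {}" "0 \<notin> E"
  shows "\<exists>C. \<forall>n>0. \<forall>\<alpha>\<in>symbolic_exponents E n. exp_delta E * real n + C < real (mdeg \<alpha>) \<longrightarrow>
    (\<exists>j. cone_at (symbolic_exponents E n) \<alpha> j) \<and> (\<exists>j \<beta>. \<beta> \<in> symbolic_exponents E n \<and> \<alpha> = \<beta> + single j 1)"
proof -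
  obtain p where p: "common_exponent E p" using common_exponent_exists[OF E(1)] by blast
  \<comment> \<open>\<open>K\<close> copies of a variable make it an apex
    (\<open>cone_at_symbolic\<close>); the rest of \<open>D\<close> is the rounding reserve of
    \<open>symbolic_exponents_removable\<close>.\<close>
  define K where "K = CARD('x) * p + 1"
  define D where "D = real ((CARD('x) + 1) * p + K)"
  have "(\<exists>j. cone_at (symbolic_exponents E n) \<alpha> j) \<and> (\<exists>j \<beta>. \<beta> \<in> symbolic_exponents E n \<and> \<alpha> = \<beta> + single j 1)"
    if n: "0 < n" and a: "\<alpha> \<in> symbolic_exponents E n" and big: "exp_delta E * real n + real CARD('x) * D < real (mdeg \<alpha>)" for n \<alpha>
  proof -
    obtain c where c: "c \<in> exp_polyhedron E" "\<forall>x. vec_nth c x \<le> vec_nth ((1 / real n) *\<^sub>R exponent_vector \<alpha>) x" "coord_sum c \<le> exp_delta E"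
      using exp_polyhedron_below[OF E symbolic_exponents_scaled[OF E(1) a n]] by blast
    have le: "real n * vec_nth c x \<le> real (lookup \<alpha> x)" for x
      using c(2)[rule_format, of x] n by (simp add: field_simps)
    have "\<exists>j. real n * vec_nth c j + D \<le> real (lookup \<alpha> j)"
    proof (rule ccontr)
      assume "\<not> ?thesis"
      then have "real (lookup \<alpha> x) \<le> real n * vec_nth c x + D" for x by (meson linear)
      then have "(\<Sum>x\<in>UNIV. real (lookup \<alpha> x)) \<le> (\<Sum>x\<in>UNIV. real n * vec_nth c x + D)" by (intro sum_mono)
      also have "\<dots> = real n * coord_sum c + real CARD('x) * D" by (simp add: sum.distrib coord_sum_def sum_distrib_left)
      also have "real n * coord_sum c \<le> real n * exp_delta E" using c(3) by (intro mult_left_mono) auto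
      finally show False using big by (simp add: mdeg_def mult.commute)
    qed
    then obtain j where j: "real n * vec_nth c j + real ((CARD('x) + 1) * p + K) \<le> real (lookup \<alpha> j)"
      unfolding D_def by blast
    obtain \<alpha>' where a': "\<alpha>' \<in> symbolic_exponents E n" "\<alpha> = \<alpha>' + single j K"
      using symbolic_exponents_removable[OF p c(1) a le j exp_polyhedron_basic(4)[OF E c(1)]] by blast
    have "cone_at (symbolic_exponents E n) \<alpha> j" by (rule cone_at_symbolic[OF p K_def a'])
    moreover have "\<alpha>' + single j (K - 1) \<in> symbolic_exponents E n"
      by (rule up_closed_addI[OF up_closed_symbolic_exponents a'(1)])
    moreover have "\<alpha> = \<alpha>' + single j (K - 1) + single j 1"
      unfolding a'(2) K_def by (simp add: add.assoc flip: single_add)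
    ultimately show ?thesis by blast
  qed
  then show ?thesis by (intro exI[of _ "real CARD('x) * D"] allI impI ballI)
qed

text \<open>A minimal exponent below one near \<open>n * v\<close> might be much smaller. Scaled by
  \<open>1 / n\<close> it lies in the polyhedron and is at most \<open>v + h\<close> in each entry,
  so \<open>extreme_point_rigid\<close> prevents this.\<close>

lemma symbolic_exponents_lower:
  fixes E :: "('x::finite \<Rightarrow>\<^sub>0 nat) set"
  assumes E: "up_closed E" "E \<noteq> {}" "0 \<notin> E" and e: "0 < e"
  shows "\<forall>\<^sub>F n in sequentially. \<exists>\<alpha>\<in>minimal_exps (symbolic_exponents E n). (exp_delta E - e) * real n \<le> real (mdeg \<alpha>)"
proof -
  obtain v where v: "v extreme_point_of exp_polyhedron E" "coord_sum v = exp_delta E" using exp_delta_attained[OF E] by metis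
  have vP: "v \<in> exp_polyhedron E" using v by (simp add: extreme_point_of_def)
  obtain h where h: "h > 0" "\<forall>y\<in>exp_polyhedron E. (\<forall>x. vec_nth y x \<le> vec_nth v x + h) \<longrightarrow> coord_sum v - e \<le> coord_sum y"
    using extreme_point_rigid[OF E v(1) e] by blast
  obtain M where M: "M \<ge> 0" "\<forall>n. \<exists>\<beta>\<in>symbolic_exponents E n. \<forall>x. real (lookup \<beta> x) \<le> real n * vec_nth v x + M"
    using symbolic_exponents_near[OF vP exp_polyhedron_basic(4)[OF E vP]] by blast
  have "\<exists>\<alpha>\<in>minimal_exps (symbolic_exponents E n). (exp_delta E - e) * real n \<le> real (mdeg \<alpha>)"
    if n: "max 1 (nat \<lceil>M / h\<rceil>) \<le> n" for n
  proof -
    have n0: "0 < n" using n by simp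
    \<comment> \<open>From such \<open>n\<close> on, the bounded error \<open>M\<close> is at most
      \<open>h\<close> after division by \<open>n\<close>.\<close>
    have "M / h \<le> real n" using n by linarith
    then have nh: "M \<le> real n * h" using h(1) by (simp add: field_simps)
    obtain \<beta> where b: "\<beta> \<in> symbolic_exponents E n" "\<forall>x. real (lookup \<beta> x) \<le> real n * vec_nth v x + M"
      using M(2) by blast
    obtain \<alpha> where a: "\<alpha> \<in> minimal_exps (symbolic_exponents E n)" "\<alpha> \<preceq> \<beta>" using minimal_exps_below[OF b(1)] by blast
    have aS: "\<alpha> \<in> symbolic_exponents E n" using a(1) by (simp add: minimal_exps_def)
    have "vec_nth ((1 / real n) *\<^sub>R exponent_vector \<alpha>) x \<le> vec_nth v x + h" for x
    proof -
      have "real (lookup \<alpha> x) \<le> real (lookup \<beta> x)" using a(2) by (simp add: exp_le_def)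
      also have "\<dots> \<le> real n * vec_nth v x + M" using b(2) by blast
      also have "\<dots> \<le> real n * (vec_nth v x + h)" using nh by (simp add: algebra_simps)
      finally show ?thesis using n0 by (simp add: field_simps)
    qed
    then have "coord_sum v - e \<le> real (mdeg \<alpha>) / real n"
      using h(2) symbolic_exponents_scaled[OF E(1) aS n0] unfolding coord_sum_scaled[symmetric] by blast
    then have "(exp_delta E - e) * real n \<le> real (mdeg \<alpha>)" using n0 v(2) by (simp add: field_simps)
    then show ?thesis using a(1) by blast
  qed
  then show ?thesis unfolding eventually_sequentially by blast
qed

text \<open>The lower bound 0 makes \<open>X n\<close> finite for positive \<open>n\<close>, so
  \<open>Max\<close> is a genuine maximum; the slack \<open>C / n\<close> tends to 0.\<close>

lemma Max_growth:
  fixes X :: "nat \<Rightarrow> int set" and C :: real and \<delta> :: real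
  assumes up: "\<And>n d. 0 < n \<Longrightarrow> d \<in> X n \<Longrightarrow> 0 \<le> d \<and> real_of_int d \<le> \<delta> * real n + C"
    and low: "\<And>e. 0 < e \<Longrightarrow> \<forall>\<^sub>F n in sequentially. \<exists>d\<in>X n. (\<delta> - e) * real n \<le> real_of_int d"
  shows "(\<lambda>n. real_of_int (Max (X n)) / real n) \<longlonglongrightarrow> \<delta>"
proof (rule tendstoI)
  fix e :: real assume e: "0 < e"
  have "(\<lambda>n. C / real n) \<longlonglongrightarrow> 0" by (rule lim_const_over_n)
  then have "\<forall>\<^sub>F n in sequentially. C / real n < e" using e by (rule order_tendstoD)
  moreover have "\<forall>\<^sub>F n in sequentially. 0 < (n::nat)" by (rule eventually_gt_at_top)
  moreover have "\<forall>\<^sub>F n in sequentially. \<exists>d\<in>X n. (\<delta> - e / 2) * real n \<le> real_of_int d" using e by (intro low) simp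
  ultimately show "\<forall>\<^sub>F n in sequentially. dist (real_of_int (Max (X n)) / real n) \<delta> < e"
  proof eventually_elim
    case (elim n)
    have fin: "finite (X n)"
    proof (rule finite_subset)
      show "X n \<subseteq> {0..\<lfloor>\<delta> * real n + C\<rfloor>}" using up[OF elim(2)] by (auto simp: le_floor_iff)
    qed simp
    obtain d where d: "d \<in> X n" "(\<delta> - e / 2) * real n \<le> real_of_int d" using elim(3) by blast
    then have "(\<delta> - e / 2) * real n \<le> real_of_int (Max (X n))" using Max_ge[OF fin d(1)] by linarith
    then have "\<delta> - e / 2 \<le> real_of_int (Max (X n)) / real n" using elim(2) by (simp add: field_simps)
    moreover have "Max (X n) \<in> X n" using Max_in[OF fin] d(1) by blast
    then have "real_of_int (Max (X n)) \<le> \<delta> * real n + C" using up[OF elim(2)] by blast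
    then have "real_of_int (Max (X n)) / real n \<le> \<delta> + C / real n" using elim(2) by (simp add: field_simps)
    ultimately show ?case using elim(1) e by (simp add: dist_real_def abs_less_iff)
  qed
qed

theorem theorem1p3:
  fixes I :: "('x::finite, 'k::field) mpoly set"
  assumes "monomial_ideal I" and "I \<noteq> {0}" and "I \<noteq> UNIV"
  shows "((\<lambda>n. real_of_int (omega (symbolic_power I n)) / real n) \<longlonglongrightarrow> delta I) \<and>
         ((\<lambda>n. real_of_int (regularity (symbolic_power I n)) / real n) \<longlonglongrightarrow> delta I)"
proof -
  define E where "E = exponents I"
  have I: "I = exp_span E" "up_closed E" using monomial_ideal_exponents[OF assms(1)] by (simp_all add: E_def)
  have "E \<noteq> {}" using assms(2) I(1) by (auto simp: exp_span_def)
  moreover have "0 \<notin> E"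
  proof
    assume "0 \<in> E"
    then have "1 \<in> I" unfolding I(1) by (simp add: exp_span_def)
    moreover have "is_ideal I" unfolding I(1) by (rule is_ideal_exp_span[OF I(2)])
    ultimately have "r \<in> I" for r using is_ideal_multI[of I 1 r] by simp
    then show False using assms(3) by auto
  qed
  ultimately have E: "up_closed E" "E \<noteq> {}" "0 \<notin> E" using I(2) by auto
  let ?S = "symbolic_exponents E" and ?\<delta> = "exp_delta E"
  have sym: "symbolic_power I n = exp_span (?S n)" for n unfolding I(1) by (rule symbolic_power_exp_span[OF E(1)])
  have S: "up_closed (?S n)" for n by (rule up_closed_symbolic_exponents)
  have delta: "delta I = ?\<delta>"
    unfolding delta_def exp_delta_def symbolic_polyhedron_eq[OF assms(1)] exp_polyhedron_def coord_sum_def E_def ..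
  obtain C where C: "\<And>n \<alpha>. 0 < n \<Longrightarrow> \<alpha> \<in> ?S n \<Longrightarrow> ?\<delta> * real n + C < real (mdeg \<alpha>) \<Longrightarrow>
    (\<exists>j. cone_at (?S n) \<alpha> j) \<and> (\<exists>j \<beta>. \<beta> \<in> ?S n \<and> \<alpha> = \<beta> + single j 1)"
    using symbolic_exponents_upper[OF E] by blast
  have "(\<lambda>n. real_of_int (omega (symbolic_power I n)) / real n) \<longlonglongrightarrow> ?\<delta>"
    unfolding omega_def
  proof (rule Max_growth)
    fix n d assume n: "(0::nat) < n" and "d \<in> {d. \<exists>G. minimal_homogeneous_generators (symbolic_power I n) G \<and> (\<exists>g\<in>G. homogeneous d g)}"
    then obtain G g where G: "minimal_homogeneous_generators (exp_span (?S n) :: ('x, 'k) mpoly set) G" "g \<in> G" "homogeneous d g"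
      unfolding sym by blast
    obtain \<alpha> where a: "\<alpha> \<in> ?S n" "int (mdeg \<alpha>) = d" "\<nexists>j \<beta>. \<beta> \<in> ?S n \<and> \<alpha> = \<beta> + single j 1"
      using generator_degree_minimal[OF S G] by blast
    have "real (mdeg \<alpha>) \<le> ?\<delta> * real n + C" using C[OF n a(1)] a(3) not_le by blast
    then show "0 \<le> d \<and> real_of_int d \<le> ?\<delta> * real n + C" using a(2) by auto
  next
    fix e :: real assume "0 < e"
    from symbolic_exponents_lower[OF E this]
    show "\<forall>\<^sub>F n in sequentially. \<exists>d\<in>{d. \<exists>G. minimal_homogeneous_generators (symbolic_power I n) G \<and> (\<exists>g\<in>G. homogeneous d g)}.
        (?\<delta> - e) * real n \<le> real_of_int d"
    proof eventually_elim
      case (elim n)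
      then obtain \<alpha> where a: "\<alpha> \<in> minimal_exps (?S n)" "(?\<delta> - e) * real n \<le> real (mdeg \<alpha>)" by blast
      have "homogeneous (int (mdeg \<alpha>)) (monomial \<alpha> :: ('x, 'k) mpoly)" by (simp add: homogeneous_def)
      then have "\<exists>G. minimal_homogeneous_generators (symbolic_power I n) G \<and> (\<exists>g\<in>G. homogeneous (int (mdeg \<alpha>)) g)"
        unfolding sym using minimal_generators_exist[OF S] a(1) by blast
      then show ?case using a(2) by (intro bexI[of _ "int (mdeg \<alpha>)"]) simp_all
    qed
  qed
  moreover have "(\<lambda>n. real_of_int (regularity (symbolic_power I n)) / real n) \<longlonglongrightarrow> ?\<delta>"
    unfolding regularity_def
  proof (rule Max_growth)
    fix n k assume n: "(0::nat) < n" and "k \<in> {j - int i | i j. \<exists>d \<phi>. minimal_graded_free_resolution (symbolic_power I n) d \<phi> \<and> j \<in> set (d i)}"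
    then obtain i j d \<phi> where k: "k = j - int i" and R: "minimal_graded_free_resolution (exp_span (?S n) :: ('x, 'k) mpoly set) d \<phi>" and j: "j \<in> set (d i)"
      unfolding sym by blast
    obtain m where m: "m < length (d i)" "d i ! m = j" using j by (auto simp: in_set_conv_nth)
    obtain \<alpha> where a: "\<alpha> \<in> ?S n" "int (mdeg \<alpha>) = j" "\<nexists>j. cone_at (?S n) \<alpha> j"
      using resolution_degree_cone[OF S R m(1)] m(2) by blast
    have "real (mdeg \<alpha>) \<le> ?\<delta> * real n + C" using C[OF n a(1)] a(3) not_le by blast
    moreover have "int i \<le> j" using resolution_degree_ge[OF S R m(1)] m(2) by simp
    ultimately show "0 \<le> k \<and> real_of_int k \<le> ?\<delta> * real n + C" using a(2) k by auto
  next
    fix e :: real assume "0 < e"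
    from symbolic_exponents_lower[OF E this]
    show "\<forall>\<^sub>F n in sequentially. \<exists>k\<in>{j - int i | i j. \<exists>d \<phi>. minimal_graded_free_resolution (symbolic_power I n) d \<phi> \<and> j \<in> set (d i)}.
        (?\<delta> - e) * real n \<le> real_of_int k"
    proof eventually_elim
      case (elim n)
      then obtain \<alpha> where a: "\<alpha> \<in> minimal_exps (?S n)" "(?\<delta> - e) * real n \<le> real (mdeg \<alpha>)" by blast
      obtain d \<phi> where R: "minimal_graded_free_resolution (exp_span (?S n) :: ('x, 'k) mpoly set) d \<phi>"
        using minimal_resolution_exists[OF S] by blast
      \<comment> \<open>Homological position 0 suffices for the lower bound: there
        \<open>j - i\<close> is the degree of a minimal generator.\<close>
      obtain m where "m < length (d 0)" "d 0 ! m = int (mdeg \<alpha>)"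
        using resolution_minimal_exponent[OF S R, of \<alpha>] a(1) by (auto simp: minimal_exps_def)
      then have "int (mdeg \<alpha>) \<in> set (d 0)" by (metis nth_mem)
      then have mem: "int (mdeg \<alpha>) - int 0 \<in> {j - int i | i j. \<exists>d \<phi>. minimal_graded_free_resolution (symbolic_power I n) d \<phi> \<and> j \<in> set (d i)}"
        unfolding sym using R by blast
      have "(?\<delta> - e) * real n \<le> real_of_int (int (mdeg \<alpha>) - int 0)" using a(2) by simp
      from this mem show ?case by (rule bexI)
    qed
  qed
  ultimately show ?thesis unfolding delta by blast
qed

end
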